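(* Let $\Sigma$ be a fan in $N_{\mathbb R}$, and let $I\subseteq\mathrm{Cox}(\mathrm{trop}(X_\Sigma))$ be a locally tropical ideal. Then the variety $V_\Sigma(I)\subseteq\mathrm{trop}(X_\Sigma)$ is the support of a finite $\mathbb R$-rational polyhedral complex in $\mathrm{trop}(X_\Sigma)$.
   Context: $\overline{\mathbb R}=(\mathbb R\cup\{\infty\},\oplus=\min,\odot=+)$ is the tropical semiring. Polynomials over $\overline{\mathbb R}$ are formal (not functions). An ideal of a semiring is a nonempty subset closed under addition and under multiplication by elements of the semiring. Tropical toric varieties. $N\cong\mathbb Z^n$ is a lattice, $M=\mathrm{Hom}(N,\mathbb Z)$, $N_{\mathbb R}=N\otimes\mathbb R$; a fan means a (finite) rational polyhedral fan, as in toric geometry. For $\sigma\in\Sigma$ put $N(\sigma)=N_{\mathbb R}/\mathrm{span}(\sigma)\cong\mathbb R^{n-\dim\sigma}$, and $\mathrm{trop}(X_\Sigma)=\coprod_{\sigma\in\Sigma}N(\sigma)$. The space $U^{\mathrm{trop}}_\sigma=\mathrm{Hom}(\sigma^\vee\cap M,\overline{\mathbb R})$ of monoid homomorphisms to $(\overline{\mathbb R},\odot)$ is identified with $\coprod_{\tau\preceq\sigma}N(\tau)$: $\mathbf w\in N(\tau)$ is the homomorphism sending $\mathbf u$ to $\langle \mathbf u,\mathbf w\rangle$ if $\mathbf u\in\tau^\perp$ and to $\infty$ otherwise. $\overline{\mathbb R}$ has the topology with basis the open intervals of $\mathbb R$ and the sets $(a,\infty]$; $U_\sigma^{\mathrm{trop}}$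 has the topology induced from the product topology on $\overline{\mathbb R}^{\sigma^\vee\cap M}$, and $\mathrm{trop}(X_\Sigma)$ is topologized by gluing the $U_\sigma^{\mathrm{trop}}$ as open subsets. Cox semiring. Let $s$ be the number of rays of $\Sigma$, $t=n-\dim\mathrm{span}(\Sigma)$, $m=s+t$, and $S=\mathrm{Cox}(\mathrm{trop}(X_\Sigma))=\overline{\mathbb R}[x_1,\dots,x_m]$. Write $N=N'\oplus N''$ where the rays of $\Sigma$ span $N'_{\mathbb R}$; $Q$ is an $m\times n$ matrix whose $i$th row for $i\le s$ is the first lattice point on the $i$th ray, and whose last $t$ rows form a basis of $N''$. $S$ is graded by $\mathrm{coker}(\mathbb Z^n\cong M\to\mathbb Z^m,\ \mathbf u\mapsto Q\mathbf u)$, with $\deg(x_i)$ the class of $\mathbf e_i$. Rays are identified with $\{1,\dots,s\}$ and cones with subsets of $\{1,\dots,s\}$. For $\sigma\in\Sigma$, $\mathbf x^{\hat\sigma}=\prod_{i\notin\sigma}x_i$ (product over $i\in\{1,\dots,m\}\setminus\sigma$). The degree-$\mathbf 0$ part of the localization satisfies $(S_{\mathbf x^{\hat\sigma}})_{\mathbf 0}\cong\overline{\mathbb R}[\sigma^\vee\cap M]$, with $\mathbf x^{Q\mathbf u}$ corresponding to $\mathbf u$. Tropical and locally tropical ideals. An ideal $J\subseteq\overline{\mathbb R}[\sigma^\vee\cap M]$ is a tropical ideal if for every finite set $E$ of monomials the set of polynomials in $J$ with support in $E$ is the set of vectors of a valuated matroid on $E$; equivalently, this set $\mathcal V$ satisfies: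 for $f,g\in\mathcal V$ and a monomial $e\in E$ at which $f,g$ have equal coefficients $\ne\infty$, there is $h\in\mathcal V$ whose coefficient at $e$ is $\infty$, whose coefficient at each $e'\in E$ is at least the minimum of those of $f$ and $g$, with equality whenever those of $f$ and $g$ at $e'$ differ. A homogeneous ideal $I\subseteq S$ is locally tropical if $(IS_{\mathbf x^{\hat\sigma}})_{\mathbf 0}\subseteq\overline{\mathbb R}[\sigma^\vee\cap M]$ is a tropical ideal for every $\sigma\in\Sigma$. Varieties. For a homogeneous ideal $I\subseteq S$ and $\sigma\in\Sigma$, let $I_{(\sigma)}=(IS_{\mathbf x^{\hat\sigma}}/\langle x_i\sim\infty:i\in\sigma\rangle)_{\mathbf 0}\subseteq\overline{\mathbb R}[\sigma^\perp\cap M]$ (the set of polynomials obtained from elements of $(IS_{\mathbf x^{\hat\sigma}})_{\mathbf 0}$ by deleting all terms divisible by some $x_i$, $i\in\sigma$). $V_\sigma(I)$ is the set of $\mathbf w\in N(\sigma)$ such that for every $f\in I_{(\sigma)}$, $f\neq\infty$, the minimum in $f(\mathbf w)$ is achieved at least twice, and $V_\Sigma(I)=\coprod_{\sigma}V_\sigma(I)\subseteq\mathrm{trop}(X_\Sigma)$. Polyhedral complexes. A polyhedral complex $\Delta$ in $\mathrm{trop}(X_\Sigma)$ consists of a polyhedral complex $\Delta_\sigma$ in each $N(\sigma)$, such that if $\tau$ is a face of $\sigma$ and $P\in\Delta_\tau$, then the closure of $P$ in $\mathrm{trop}(X_\Sigma)$ intersected with $N(\sigma)$ is contained in a polyhedron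 of $\Delta_\sigma$. It is $\mathbb R$-rational if every polyhedron of each $\Delta_\sigma$ has the form $\{\mathbf x\in\mathbb R^{n-\dim\sigma}:A\mathbf x\le\mathbf b\}$ with $A$ a rational matrix (with respect to the lattice structure of $N(\sigma)$) and $\mathbf b$ a real vector. Its support is the union of all its polyhedra. *)

theory Defs
  imports "HOL-Analysis.Analysis" "HOL-Library.Poly_Mapping"
begin

section \<open>The tropical semiring\<close>

text \<open>
  The additive neutral element is \<open>\<infinity>\<close>. Consequently \<open>Poly_Mapping.keys f\<close> is the set of
  exponents of \<open>f\<close> with coefficient different from \<open>\<infinity>\<close>, and the formal polynomial
  \<open>\<infinity>\<close> is \<open>0\<close>.
\<close>

datatype trop = Fin real | Infty

instantiation trop :: linorder
begin

fun less_eq_trop :: "trop \<Rightarrow> trop \<Rightarrow> bool" where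
  "less_eq_trop (Fin a) (Fin b) \<longleftrightarrow> a \<le> b"
| "less_eq_trop x Infty \<longleftrightarrow> True"
| "less_eq_trop Infty (Fin b) \<longleftrightarrow> False"

definition less_trop :: "trop \<Rightarrow> trop \<Rightarrow> bool" where
  "less_trop x y \<longleftrightarrow> x \<le> y \<and> \<not> y \<le> x"

instance
proof
  fix x y z :: trop
  show "(x < y) = (x \<le> y \<and> \<not> y \<le> x)" by (rule less_trop_def)
  show "x \<le> x" by (cases x) auto
  show "x \<le> y \<Longrightarrow> y \<le> z \<Longrightarrow> x \<le> z" by (cases x; cases y; cases z) auto
  show "x \<le> y \<Longrightarrow> y \<le> x \<Longrightarrow> x = y" by (cases x; cases y) auto
  show "x \<le> y \<or> y \<le> x" by (cases x; cases y) auto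
qed

end

instantiation trop :: comm_semiring_1
begin

definition "0 = Infty"
definition "1 = Fin 0"
definition "x + y = min x (y :: trop)"

fun times_trop :: "trop \<Rightarrow> trop \<Rightarrow> trop" where
  "times_trop (Fin a) (Fin b) = Fin (a + b)"
| "times_trop x Infty = Infty"
| "times_trop Infty (Fin b) = Infty"

instance
proof
  fix a b c :: trop
  show "a * b * c = a * (b * c)" by (cases a; cases b; cases c) auto
  show "a * b = b * a" by (cases a; cases b) auto
  show "1 * a = a" by (cases a) (auto simp: one_trop_def)
  show "a + b + c = a + (b + c)" by (simp add: plus_trop_def min.assoc)
  show "a + b = b + a" by (simp add: plus_trop_def min.commute)
  show "0 + a = a" by (cases a) (auto simp: plus_trop_def zero_trop_def min_def)
  show "0 * a = 0" "a * 0 = 0" by (cases a; auto simp: zero_trop_def)+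
  show "(a + b) * c = a * c + b * c"
    by (cases a; cases b; cases c) (auto simp: plus_trop_def min_def)
  show "(0 :: trop) \<noteq> 1" by (simp add: zero_trop_def one_trop_def)
qed

end

definition trop_topology :: "trop topology" where
  "trop_topology = topology_generated_by
     ({{Fin r |r. a < r \<and> r < b} |a b. True} \<union> {{x. Fin a < x} |a. True})"


section \<open>Ideals in semirings of polynomials\<close>

definition semiring_ideal :: "'a::comm_semiring_1 set \<Rightarrow> 'a set \<Rightarrow> bool" where
  "semiring_ideal R J \<longleftrightarrow> J \<subseteq> R \<and> J \<noteq> {}
     \<and> (\<forall>f\<in>J. \<forall>g\<in>J. f + g \<in> J) \<and> (\<forall>r\<in>R. \<forall>f\<in>J. r * f \<in> J)"

definition poly_over :: "'e::comm_monoid_add set \<Rightarrow> ('e \<Rightarrow>\<^sub>0 trop) set" where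
  "poly_over A = {f. Poly_Mapping.keys f \<subseteq> A}"

definition filter_terms :: "('e \<Rightarrow> bool) \<Rightarrow> ('e \<Rightarrow>\<^sub>0 trop) \<Rightarrow> ('e \<Rightarrow>\<^sub>0 trop)" where
  "filter_terms P f = Poly_Mapping.mapp (\<lambda>e c. c when P e) f"

definition tropical_ideal :: "'e::comm_monoid_add set \<Rightarrow> ('e \<Rightarrow>\<^sub>0 trop) set \<Rightarrow> bool" where
  "tropical_ideal A J \<longleftrightarrow> semiring_ideal (poly_over A) J \<and>
     (\<forall>E. finite E \<and> E \<subseteq> A \<longrightarrow>
       (\<forall>f \<in> J \<inter> poly_over E. \<forall>g \<in> J \<inter> poly_over E. \<forall>e\<in>E.
          Poly_Mapping.lookup f e = Poly_Mapping.lookup g e \<and> Poly_Mapping.lookup f e \<noteq> Infty \<longrightarrow>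
          (\<exists>h \<in> J \<inter> poly_over E. Poly_Mapping.lookup h e = Infty \<and>
             (\<forall>e'\<in>E. min (Poly_Mapping.lookup f e') (Poly_Mapping.lookup g e') \<le> Poly_Mapping.lookup h e'
                \<and> (Poly_Mapping.lookup f e' \<noteq> Poly_Mapping.lookup g e' \<longrightarrow>
                     Poly_Mapping.lookup h e' = min (Poly_Mapping.lookup f e') (Poly_Mapping.lookup g e'))))))"


section \<open>Lattices and fans\<close>

text \<open>
  A lattice \<open>N\<close> of rank \<open>n\<close> is realised as a discrete subgroup of a Euclidean space, not
  necessarily of full rank, and \<open>N\<^sub>\<real>\<close> is \<open>span N\<close>. In this way every rank, including \<open>0\<close>,
  is covered. The inner product identifies \<open>Hom(N, \<int>)\<close> with the dual lattice inside
  \<open>span N\<close>, the pairing of \<open>M\<close> and \<open>N\<close> being the inner product.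
\<close>

definition lattice_basis :: "'v::euclidean_space set \<Rightarrow> 'v set \<Rightarrow> bool" where
  "lattice_basis B N \<longleftrightarrow> independent B \<and> N = {\<Sum>b\<in>B. of_int (c b) *\<^sub>R b |c. True}"

definition is_lattice :: "'v::euclidean_space set \<Rightarrow> bool" where
  "is_lattice N \<longleftrightarrow> (\<exists>B. lattice_basis B N)"

definition dual_lattice :: "'v::euclidean_space set \<Rightarrow> 'v set" where
  "dual_lattice N = {u \<in> span N. \<forall>w\<in>N. u \<bullet> w \<in> \<int>}"

definition dual_monoid :: "'v::euclidean_space set \<Rightarrow> 'v set \<Rightarrow> 'v set" where
  "dual_monoid N \<sigma> = {u \<in> dual_lattice N. \<forall>w\<in>\<sigma>. 0 \<le> u \<bullet> w}"

definition perp_lattice :: "'v::euclidean_space set \<Rightarrow> 'v set \<Rightarrow> 'v set" where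
  "perp_lattice N \<sigma> = {u \<in> dual_lattice N. \<forall>w\<in>\<sigma>. u \<bullet> w = 0}"

definition strongly_convex_rational_cone :: "'v::euclidean_space set \<Rightarrow> 'v set \<Rightarrow> bool" where
  "strongly_convex_rational_cone N \<sigma> \<longleftrightarrow>
     (\<exists>S. finite S \<and> S \<subseteq> N \<and> \<sigma> = convex_cone hull S) \<and> (\<forall>x\<in>\<sigma>. - x \<in> \<sigma> \<longrightarrow> x = 0)"

text \<open>The library relation \<open>face_of\<close> counts the empty set as a face.\<close>

definition fan :: "'v::euclidean_space set \<Rightarrow> 'v set set \<Rightarrow> bool" where
  "fan N \<Sigma> \<longleftrightarrow> finite \<Sigma>
     \<and> (\<forall>\<sigma>\<in>\<Sigma>. strongly_convex_rational_cone N \<sigma>)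
     \<and> (\<forall>\<sigma>\<in>\<Sigma>. \<forall>\<tau>. \<tau> face_of \<sigma> \<and> \<tau> \<noteq> {} \<longrightarrow> \<tau> \<in> \<Sigma>)
     \<and> (\<forall>\<sigma>\<in>\<Sigma>. \<forall>\<tau>\<in>\<Sigma>. (\<sigma> \<inter> \<tau>) face_of \<sigma> \<and> (\<sigma> \<inter> \<tau>) face_of \<tau>)"

definition fan_rays :: "'v::euclidean_space set set \<Rightarrow> 'v set set" where
  "fan_rays \<Sigma> = {\<rho>\<in>\<Sigma>. dim \<rho> = 1}"


section \<open>The tropical toric variety\<close>

text \<open>
  \<open>N(\<sigma>) = N\<^sub>\<real> / span \<sigma>\<close> is represented by the orthogonal complement of \<open>span \<sigma>\<close> in
  \<open>N\<^sub>\<real>\<close>, which meets every class exactly once; for \<open>u \<in> \<sigma>\<^sup>\<bottom>\<close> the pairing of \<open>u\<close> with a class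
  is the inner product with its representative. A point of the disjoint union is a pair
  \<open>(\<sigma>, w)\<close> with \<open>w \<in> N(\<sigma>)\<close>.
\<close>

definition stratum :: "'v::euclidean_space set \<Rightarrow> 'v set \<Rightarrow> 'v set" where
  "stratum N \<sigma> = {w \<in> span N. \<forall>x \<in> span \<sigma>. w \<bullet> x = 0}"

definition trop_toric :: "'v::euclidean_space set \<Rightarrow> 'v set set \<Rightarrow> ('v set \<times> 'v) set" where
  "trop_toric N \<Sigma> = (SIGMA \<sigma>:\<Sigma>. stratum N \<sigma>)"

definition chart_points :: "'v::euclidean_space set \<Rightarrow> 'v set set \<Rightarrow> 'v set \<Rightarrow> ('v set \<times> 'v) set" where
  "chart_points N \<Sigma> \<sigma> = (SIGMA \<tau>:{\<tau>\<in>\<Sigma>. \<tau> face_of \<sigma>}. stratum N \<tau>)"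

definition monoid_homs :: "'e::comm_monoid_add set \<Rightarrow> ('e \<Rightarrow> trop) set" where
  "monoid_homs A = {\<phi> \<in> extensional A. \<phi> 0 = 1 \<and> (\<forall>a\<in>A. \<forall>b\<in>A. \<phi> (a + b) = \<phi> a * \<phi> b)}"

definition hom_topology :: "'e::comm_monoid_add set \<Rightarrow> ('e \<Rightarrow> trop) topology" where
  "hom_topology A = subtopology (product_topology (\<lambda>_. trop_topology) A) (monoid_homs A)"

definition hom_of_point :: "'v::euclidean_space set \<Rightarrow> 'v set \<Rightarrow> 'v set \<times> 'v \<Rightarrow> ('v \<Rightarrow> trop)" where
  "hom_of_point N \<sigma> = (\<lambda>(\<tau>, w). \<lambda>u \<in> dual_monoid N \<sigma>.
     if u \<in> perp_lattice N \<tau> then Fin (u \<bullet> w) else Infty)"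

definition chart_topology ::
  "'v::euclidean_space set \<Rightarrow> 'v set set \<Rightarrow> 'v set \<Rightarrow> ('v set \<times> 'v) topology" where
  "chart_topology N \<Sigma> \<sigma> =
     pullback_topology (chart_points N \<Sigma> \<sigma>) (hom_of_point N \<sigma>) (hom_topology (dual_monoid N \<sigma>))"

definition trop_toric_topology ::
  "'v::euclidean_space set \<Rightarrow> 'v set set \<Rightarrow> ('v set \<times> 'v) topology" where
  "trop_toric_topology N \<Sigma> = topology (\<lambda>U. U \<subseteq> trop_toric N \<Sigma>
     \<and> (\<forall>\<sigma>\<in>\<Sigma>. openin (chart_topology N \<Sigma> \<sigma>) (U \<inter> chart_points N \<Sigma> \<sigma>)))"

lemma openin_trop_toric_topology:
  "openin (trop_toric_topology N \<Sigma>) U \<longleftrightarrow> U \<subseteq> trop_toric N \<Sigma>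
     \<and> (\<forall>\<sigma>\<in>\<Sigma>. openin (chart_topology N \<Sigma> \<sigma>) (U \<inter> chart_points N \<Sigma> \<sigma>))"
proof -
  have "istopology (\<lambda>U. U \<subseteq> trop_toric N \<Sigma>
     \<and> (\<forall>\<sigma>\<in>\<Sigma>. openin (chart_topology N \<Sigma> \<sigma>) (U \<inter> chart_points N \<Sigma> \<sigma>)))"
    unfolding istopology_def
  proof (intro conjI allI impI ballI; (elim conjE)?)
    fix S T \<sigma>
    assume \<sigma>: "\<sigma> \<in> \<Sigma>"
      and S: "\<forall>\<sigma>\<in>\<Sigma>. openin (chart_topology N \<Sigma> \<sigma>) (S \<inter> chart_points N \<Sigma> \<sigma>)"
      and T: "\<forall>\<sigma>\<in>\<Sigma>. openin (chart_topology N \<Sigma> \<sigma>) (T \<inter> chart_points N \<Sigma> \<sigma>)"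
    have "S \<inter> T \<inter> chart_points N \<Sigma> \<sigma> =
        (S \<inter> chart_points N \<Sigma> \<sigma>) \<inter> (T \<inter> chart_points N \<Sigma> \<sigma>)"
      by blast
    then show "openin (chart_topology N \<Sigma> \<sigma>) (S \<inter> T \<inter> chart_points N \<Sigma> \<sigma>)"
      using openin_Int[OF S[rule_format, OF \<sigma>] T[rule_format, OF \<sigma>]] by metis
  next
    fix K \<sigma>
    assume \<sigma>: "\<sigma> \<in> \<Sigma>" and K: "\<forall>U\<in>K. U \<subseteq> trop_toric N \<Sigma>
      \<and> (\<forall>\<sigma>\<in>\<Sigma>. openin (chart_topology N \<Sigma> \<sigma>) (U \<inter> chart_points N \<Sigma> \<sigma>))"
    have "openin (chart_topology N \<Sigma> \<sigma>) (\<Union>((\<lambda>U. U \<inter> chart_points N \<Sigma> \<sigma>) ` K))"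
      using K \<sigma> by (intro openin_Union) blast
    moreover have "\<Union>K \<inter> chart_points N \<Sigma> \<sigma> = \<Union>((\<lambda>U. U \<inter> chart_points N \<Sigma> \<sigma>) ` K)"
      by blast
    ultimately show "openin (chart_topology N \<Sigma> \<sigma>) (\<Union>K \<inter> chart_points N \<Sigma> \<sigma>)"
      by metis
  qed blast+
  then show ?thesis
    by (simp add: trop_toric_topology_def topology_inverse')
qed


section \<open>The Cox semiring\<close>

text \<open>
  The matrix \<open>Q\<close> is given by its rows \<open>v 1, \<dots>, v m\<close>; its first \<open>s\<close> rows enumerate the rays.
  The choices of this enumeration, of the complement \<open>N''\<close> and of its basis are all part of
  the datum \<open>v\<close>.
\<close>

definition num_rays :: "'v::euclidean_space set set \<Rightarrow> nat" where
  "num_rays \<Sigma> = card (fan_rays \<Sigma>)"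

definition num_vars :: "'v::euclidean_space set \<Rightarrow> 'v set set \<Rightarrow> nat" where
  "num_vars N \<Sigma> = num_rays \<Sigma> + (dim N - dim (\<Union>\<Sigma>))"

definition first_lattice_point :: "'v::euclidean_space set \<Rightarrow> 'v set \<Rightarrow> 'v \<Rightarrow> bool" where
  "first_lattice_point N \<rho> w \<longleftrightarrow>
     w \<in> \<rho> \<inter> N \<and> w \<noteq> 0 \<and> (\<forall>c. 0 < c \<and> c < 1 \<longrightarrow> c *\<^sub>R w \<notin> N)"

definition cox_matrix :: "'v::euclidean_space set \<Rightarrow> 'v set set \<Rightarrow> (nat \<Rightarrow> 'v) \<Rightarrow> bool" where
  "cox_matrix N \<Sigma> v \<longleftrightarrow>
     (\<exists>\<rho>. bij_betw \<rho> {1..num_rays \<Sigma>} (fan_rays \<Sigma>)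
        \<and> (\<forall>i\<in>{1..num_rays \<Sigma>}. first_lattice_point N (\<rho> i) (v i)))
     \<and> (\<exists>N' N''. is_lattice N' \<and> span N' = span (\<Union>(fan_rays \<Sigma>))
        \<and> inj_on v {num_rays \<Sigma> + 1..num_vars N \<Sigma>}
        \<and> lattice_basis (v ` {num_rays \<Sigma> + 1..num_vars N \<Sigma>}) N''
        \<and> N = {a + b |a b. a \<in> N' \<and> b \<in> N''} \<and> N' \<inter> N'' = {0})"

definition cone_indices :: "'v::euclidean_space set set \<Rightarrow> (nat \<Rightarrow> 'v) \<Rightarrow> 'v set \<Rightarrow> nat set" where
  "cone_indices \<Sigma> v \<sigma> = {i\<in>{1..num_rays \<Sigma>}. (convex_cone hull {v i}) face_of \<sigma>}"

text \<open>
  All localizations of \<open>S\<close> at monomials are realised inside the semiring of Laurent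
  polynomials, whose exponents are finitely supported functions from \<open>nat\<close> to \<open>int\<close>. This
  loses nothing because multiplication by a monomial is injective on polynomials.
\<close>

type_synonym exponent = "nat \<Rightarrow>\<^sub>0 int"
type_synonym laurent = "exponent \<Rightarrow>\<^sub>0 trop"

definition cox_semiring :: "nat \<Rightarrow> laurent set" where
  "cox_semiring m =
     poly_over {e. Poly_Mapping.keys e \<subseteq> {1..m} \<and> (\<forall>i. 0 \<le> Poly_Mapping.lookup e i)}"

definition var :: "nat \<Rightarrow> laurent" where
  "var i = Poly_Mapping.single (Poly_Mapping.single i 1) 1"

definition localization :: "laurent set \<Rightarrow> laurent \<Rightarrow> laurent set" where
  "localization R x = {f. \<exists>k. x ^ k * f \<in> R}"

definition cox_localization ::
  "'v::euclidean_space set \<Rightarrow> 'v set set \<Rightarrow> (nat \<Rightarrow> 'v) \<Rightarrow> 'v set \<Rightarrow> laurent set" where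
  "cox_localization N \<Sigma> v \<sigma> = localization (cox_semiring (num_vars N \<Sigma>))
     (\<Prod>i \<in> {1..num_vars N \<Sigma>} - cone_indices \<Sigma> v \<sigma>. var i)"

text \<open>\<open>u \<mapsto> Q u\<close>; the floor is only applied to integers when \<open>u\<close> is in the dual lattice.\<close>

definition Q_map :: "'v::euclidean_space set \<Rightarrow> 'v set set \<Rightarrow> (nat \<Rightarrow> 'v) \<Rightarrow> 'v \<Rightarrow> exponent" where
  "Q_map N \<Sigma> v u = (\<Sum>i\<in>{1..num_vars N \<Sigma>}. Poly_Mapping.single i \<lfloor>v i \<bullet> u\<rfloor>)"

text \<open>The degree of a monomial, as a coset of the image of \<open>M\<close> under \<open>Q\<close>.\<close>

definition cox_degree ::
  "'v::euclidean_space set \<Rightarrow> 'v set set \<Rightarrow> (nat \<Rightarrow> 'v) \<Rightarrow> exponent \<Rightarrow> exponent set" where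
  "cox_degree N \<Sigma> v e = {e + Q_map N \<Sigma> v u |u. u \<in> dual_lattice N}"

definition homogeneous_ideal ::
  "'v::euclidean_space set \<Rightarrow> 'v set set \<Rightarrow> (nat \<Rightarrow> 'v) \<Rightarrow> laurent set \<Rightarrow> bool" where
  "homogeneous_ideal N \<Sigma> v I \<longleftrightarrow> semiring_ideal (cox_semiring (num_vars N \<Sigma>)) I
     \<and> (\<forall>f\<in>I. \<forall>d. filter_terms (\<lambda>e. cox_degree N \<Sigma> v e = d) f \<in> I)"

definition degree_zero_part ::
  "'v::euclidean_space set \<Rightarrow> 'v set set \<Rightarrow> (nat \<Rightarrow> 'v) \<Rightarrow> laurent set \<Rightarrow> laurent set" where
  "degree_zero_part N \<Sigma> v A =
     {f\<in>A. \<forall>e\<in>Poly_Mapping.keys f. cox_degree N \<Sigma> v e = cox_degree N \<Sigma> v 0}"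

definition local_degree_zero ::
  "'v::euclidean_space set \<Rightarrow> 'v set set \<Rightarrow> (nat \<Rightarrow> 'v) \<Rightarrow> laurent set \<Rightarrow> 'v set \<Rightarrow> laurent set" where
  "local_degree_zero N \<Sigma> v I \<sigma> =
     degree_zero_part N \<Sigma> v (semiring_ideal (cox_localization N \<Sigma> v \<sigma>) hull I)"

text \<open>
  The isomorphism between polynomials with exponents in \<open>M\<close> and Laurent polynomials of
  degree \<open>0\<close>, sending \<open>u\<close> to \<open>x\<^bsup>Qu\<^esup>\<close>.
\<close>

definition cox_poly ::
  "'v::euclidean_space set \<Rightarrow> 'v set set \<Rightarrow> (nat \<Rightarrow> 'v) \<Rightarrow> ('v \<Rightarrow>\<^sub>0 trop) \<Rightarrow> laurent" where
  "cox_poly N \<Sigma> v g = (\<Sum>u\<in>Poly_Mapping.keys g.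
     Poly_Mapping.single (Q_map N \<Sigma> v u) (Poly_Mapping.lookup g u))"

definition locally_tropical ::
  "'v::euclidean_space set \<Rightarrow> 'v set set \<Rightarrow> (nat \<Rightarrow> 'v) \<Rightarrow> laurent set \<Rightarrow> bool" where
  "locally_tropical N \<Sigma> v I \<longleftrightarrow> homogeneous_ideal N \<Sigma> v I
     \<and> (\<forall>\<sigma>\<in>\<Sigma>. tropical_ideal (dual_monoid N \<sigma>)
          {g \<in> poly_over (dual_monoid N \<sigma>). cox_poly N \<Sigma> v g \<in> local_degree_zero N \<Sigma> v I \<sigma>})"


section \<open>Varieties\<close>

definition stratum_ideal ::
  "'v::euclidean_space set \<Rightarrow> 'v set set \<Rightarrow> (nat \<Rightarrow> 'v) \<Rightarrow> laurent set \<Rightarrow> 'v set \<Rightarrow> ('v \<Rightarrow>\<^sub>0 trop) set"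
  where
  "stratum_ideal N \<Sigma> v I \<sigma> = {g \<in> poly_over (perp_lattice N \<sigma>). cox_poly N \<Sigma> v g \<in>
     filter_terms (\<lambda>e. \<forall>i\<in>cone_indices \<Sigma> v \<sigma>. \<not> 0 < Poly_Mapping.lookup e i)
       ` local_degree_zero N \<Sigma> v I \<sigma>}"

definition trop_eval :: "('v::euclidean_space \<Rightarrow>\<^sub>0 trop) \<Rightarrow> 'v \<Rightarrow> trop" where
  "trop_eval f w = (\<Sum>u\<in>Poly_Mapping.keys f. Poly_Mapping.lookup f u * Fin (u \<bullet> w))"

definition min_attained_twice :: "('v::euclidean_space \<Rightarrow>\<^sub>0 trop) \<Rightarrow> 'v \<Rightarrow> bool" where
  "min_attained_twice f w \<longleftrightarrow>
     2 \<le> card {u\<in>Poly_Mapping.keys f. Poly_Mapping.lookup f u * Fin (u \<bullet> w) = trop_eval f w}"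

definition stratum_variety ::
  "'v::euclidean_space set \<Rightarrow> 'v set set \<Rightarrow> (nat \<Rightarrow> 'v) \<Rightarrow> laurent set \<Rightarrow> 'v set \<Rightarrow> 'v set" where
  "stratum_variety N \<Sigma> v I \<sigma> =
     {w \<in> stratum N \<sigma>. \<forall>f \<in> stratum_ideal N \<Sigma> v I \<sigma>. f \<noteq> 0 \<longrightarrow> min_attained_twice f w}"

definition trop_variety ::
  "'v::euclidean_space set \<Rightarrow> 'v set set \<Rightarrow> (nat \<Rightarrow> 'v) \<Rightarrow> laurent set \<Rightarrow> ('v set \<times> 'v) set" where
  "trop_variety N \<Sigma> v I = (SIGMA \<sigma>:\<Sigma>. stratum_variety N \<Sigma> v I \<sigma>)"


section \<open>Polyhedral complexes\<close>

text \<open>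
  The empty polyhedron is allowed as a member of a complex, but not required to be one. It
  is what contains an empty intersection of a closure with a stratum when the complex in
  that stratum has no other members.
\<close>

definition polyhedral_complex :: "'v::euclidean_space set set \<Rightarrow> bool" where
  "polyhedral_complex D \<longleftrightarrow> (\<forall>P\<in>D. polyhedron P)
     \<and> (\<forall>P\<in>D. \<forall>F. F face_of P \<and> F \<noteq> {} \<longrightarrow> F \<in> D)
     \<and> (\<forall>P\<in>D. \<forall>P'\<in>D. (P \<inter> P') face_of P \<and> (P \<inter> P') face_of P')"

definition trop_polyhedral_complex ::
  "'v::euclidean_space set \<Rightarrow> 'v set set \<Rightarrow> ('v set \<Rightarrow> 'v set set) \<Rightarrow> bool" where
  "trop_polyhedral_complex N \<Sigma> \<Delta> \<longleftrightarrow>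
     (\<forall>\<sigma>\<in>\<Sigma>. polyhedral_complex (\<Delta> \<sigma>) \<and> (\<forall>P \<in> \<Delta> \<sigma>. P \<subseteq> stratum N \<sigma>))
     \<and> (\<forall>\<sigma>\<in>\<Sigma>. \<forall>\<tau>\<in>\<Sigma>. \<tau> face_of \<sigma> \<longrightarrow>
          (\<forall>P \<in> \<Delta> \<tau>. \<exists>P' \<in> \<Delta> \<sigma>.
             (trop_toric_topology N \<Sigma> closure_of ({\<tau>} \<times> P)) \<inter> ({\<sigma>} \<times> stratum N \<sigma>) \<subseteq> {\<sigma>} \<times> P'))"

text \<open>
  Linear forms on \<open>N(\<sigma>)\<close> are inner products with vectors of \<open>N\<^sub>\<real>\<close> that vanish on \<open>\<sigma>\<close>; such a
  form is rational if it takes rational values on the lattice of \<open>N(\<sigma>)\<close>, which is the image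
  of \<open>N\<close>. The pairs \<open>(a, b)\<close> are the rows of the system \<open>A x \<le> b\<close>.
\<close>

definition rational_forms :: "'v::euclidean_space set \<Rightarrow> 'v set \<Rightarrow> 'v set" where
  "rational_forms N \<sigma> = {a \<in> span N. (\<forall>x\<in>\<sigma>. a \<bullet> x = 0) \<and> (\<forall>w\<in>N. a \<bullet> w \<in> \<rat>)}"

definition real_rational_polyhedron :: "'v::euclidean_space set \<Rightarrow> 'v set \<Rightarrow> 'v set \<Rightarrow> bool" where
  "real_rational_polyhedron N \<sigma> P \<longleftrightarrow>
     (\<exists>C. finite C \<and> C \<subseteq> rational_forms N \<sigma> \<times> UNIV
        \<and> P = {x \<in> stratum N \<sigma>. \<forall>(a, b)\<in>C. a \<bullet> x \<le> b})"

definition real_rational_complex ::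
  "'v::euclidean_space set \<Rightarrow> 'v set set \<Rightarrow> ('v set \<Rightarrow> 'v set set) \<Rightarrow> bool" where
  "real_rational_complex N \<Sigma> \<Delta> \<longleftrightarrow> (\<forall>\<sigma>\<in>\<Sigma>. \<forall>P \<in> \<Delta> \<sigma>. real_rational_polyhedron N \<sigma> P)"

definition finite_complex :: "'v::euclidean_space set set \<Rightarrow> ('v set \<Rightarrow> 'v set set) \<Rightarrow> bool" where
  "finite_complex \<Sigma> \<Delta> \<longleftrightarrow> (\<forall>\<sigma>\<in>\<Sigma>. finite (\<Delta> \<sigma>))"

definition complex_support ::
  "'v::euclidean_space set set \<Rightarrow> ('v set \<Rightarrow> 'v set set) \<Rightarrow> ('v set \<times> 'v) set" where
  "complex_support \<Sigma> \<Delta> = (SIGMA \<sigma>:\<Sigma>. \<Union>(\<Delta> \<sigma>))"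

end

theory Submission
  imports Defs "HOL-Library.Multiset"
begin

text \<open>
  For a weight \<open>w\<close> and a monomial order, elimination shows that the monomials of bounded degree
  outside the initial ideal form a basis of a matroid, so the Hilbert function of the initial ideal
  does not depend on the weight or the order. With Dickson's lemma it follows that only finitely
  many initial ideals occur. If the same initial ideals occur at \<open>w\<close> and \<open>w'\<close>, then a monomial in the
  initial ideal at \<open>w\<close> is the unique initial term at \<open>w'\<close> of a relation from a finite list. Hence
  every tropical ideal has a finite tropical basis, and its variety is a union of cells of a finite
  rational hyperplane arrangement.

  Truncating the local ideal of \<open>\<sigma>\<close> to \<open>\<sigma>\<^sup>\<bottom>\<close> yields a tropical ideal defining the stratum in
  \<open>N(\<sigma>)\<close>. If a cell in \<open>N(\<tau>)\<close> lies in the variety, the points of \<open>N(\<sigma>)\<close> in its closure lie in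
  the variety as well and form a set closed under midpoints on one side of every hyperplane used
  in \<open>N(\<sigma>)\<close>. A point of this set on the fewest hyperplanes has a cell that contains the whole set.
\<close>

section \<open>Initial terms of tropical polynomials\<close>

text \<open>Ties shape the algebraic half. A weight alone can leave several initial terms, while
  elimination has to be steered by single leading terms, so an order \<open>R\<close> breaks ties.
  The order suited to comparing \<open>w\<close> with \<open>w'\<close> refines the direction
  \<open>w' - w\<close> and thus varies with the pair. Weights are therefore classified by the whole
  set of initial ideals that arise at them over all orders; finitely many initial ideals leave
  finitely many such sets.

  In the geometric half, closures are taken in a glued topology, whereas estimates live in a single
  chart. To see that a neighbourhood in one chart is open in the glued space, the common face of two
  cones has to be cut out by a lattice vector. This is why real supporting vectors are perturbed to
  rational ones. The extremal rays of a cone serve another end: they turn sign conditions on the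
  cone into conditions on the exponents of Cox monomials.\<close>

abbreviation lookup where "lookup \<equiv> Poly_Mapping.lookup"
abbreviation keys where "keys \<equiv> Poly_Mapping.keys"

lemma trop_zero_eq: "(0 :: trop) = Infty"
  by (rule zero_trop_def)

lemma trop_add_eq_min: "(a :: trop) + b = min a b"
  by (rule plus_trop_def)

lemma trop_le_Infty [simp]: "(a :: trop) \<le> Infty"
  by (cases a) auto

lemma trop_Infty_le_iff [simp]: "Infty \<le> a \<longleftrightarrow> a = Infty"
  by (cases a) auto

lemma trop_less_iff [simp]:
  "Fin a < Fin b \<longleftrightarrow> a < b" "Fin a < Infty" "\<not> Infty < x"
  by (auto simp: less_trop_def)

lemma Fin_times_eq_iff [simp]: "Fin c * x = Fin c * y \<longleftrightarrow> x = y"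
  by (cases x; cases y) auto

lemma times_Fin_eq_iff [simp]: "x * Fin c = y * Fin c \<longleftrightarrow> x = y"
  by (cases x; cases y) auto

lemma times_Fin_le_iff [simp]: "x * Fin c \<le> y * Fin c \<longleftrightarrow> x \<le> y"
  by (cases x; cases y) auto

lemma times_Fin_less_iff [simp]: "x * Fin c < y * Fin c \<longleftrightarrow> x < y"
  by (simp add: less_le)

lemma Fin_times_le_iff [simp]: "Fin c * x \<le> Fin c * y \<longleftrightarrow> x \<le> y"
  by (cases x; cases y) auto

lemma Fin_times_less_iff [simp]: "Fin c * x < Fin c * y \<longleftrightarrow> x < y"
  by (simp add: less_le)

lemma times_Fin_Infty_iff [simp]: "x * Fin c = Infty \<longleftrightarrow> x = Infty" "Fin c * x = Infty \<longleftrightarrow> x = Infty"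
  by (cases x; simp)+

lemma in_keys_trop: "e \<in> keys f \<longleftrightarrow> lookup f e \<noteq> Infty"
  by (simp add: in_keys_iff trop_zero_eq)

lemma not_in_keys_trop: "e \<notin> keys f \<Longrightarrow> lookup f e = Infty"
  by (simp add: in_keys_trop)

lemma trop_sum_le: "finite A \<Longrightarrow> x \<in> A \<Longrightarrow> (\<Sum>x\<in>A. g x :: trop) \<le> g x"
  by (induction A rule: finite_induct) (auto simp: trop_add_eq_min min_le_iff_disj)

lemma trop_sum_attained: "finite A \<Longrightarrow> A \<noteq> {} \<Longrightarrow> \<exists>x\<in>A. (\<Sum>x\<in>A. g x :: trop) = g x"
proof (induction A rule: finite_ne_induct)
  case (insert x F)
  then show ?case by (auto simp: trop_add_eq_min min_def)
qed simp

text \<open>Minima do not cancel: the smaller of two coefficients is infinite only if both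
  are.\<close>

lemma keys_add_trop: "keys (f + g :: _ \<Rightarrow>\<^sub>0 trop) = keys f \<union> keys g"
  by (auto simp: in_keys_trop lookup_add trop_add_eq_min min_def)

lemma lookup_single_times:
  fixes k :: "'e::cancel_comm_monoid_add" and f :: "'e \<Rightarrow>\<^sub>0 trop"
  shows "lookup (Poly_Mapping.single k c * f) (k + e) = c * lookup f e"
proof -
  have "lookup (Poly_Mapping.single k c * f) (k + e) =
      (\<Sum>l. lookup (Poly_Mapping.single k c) l * (\<Sum>q. lookup f q when k + e = l + q))"
    by (simp add: lookup_mult)
  also have "\<dots> = (\<Sum>l. ((c * lookup f e) when l = k))"
    by (rule Sum_any.cong) (auto simp: lookup_single when_def)
  finally show ?thesis by simp
qed

lemma keys_single_times:
  fixes k :: "'e::cancel_comm_monoid_add" and f :: "'e \<Rightarrow>\<^sub>0 trop"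
  shows "keys (Poly_Mapping.single k (Fin c) * f) = (+) k ` keys f"
proof (rule set_eqI)
  fix x
  show "x \<in> keys (Poly_Mapping.single k (Fin c) * f) \<longleftrightarrow> x \<in> (+) k ` keys f"
  proof
    assume x: "x \<in> keys (Poly_Mapping.single k (Fin c) * f)"
    then obtain e where "e \<in> keys f" "x = k + e"
      using keys_mult[of "Poly_Mapping.single k (Fin c)" f] by (auto split: if_splits)
    then show "x \<in> (+) k ` keys f" by blast
  next
    assume "x \<in> (+) k ` keys f"
    then obtain e where "e \<in> keys f" "x = k + e" by blast
    then show "x \<in> keys (Poly_Mapping.single k (Fin c) * f)"
      by (simp add: in_keys_trop lookup_single_times)
  qed
qed

lemma lookup_scale:
  fixes f :: "'e::cancel_comm_monoid_add \<Rightarrow>\<^sub>0 trop"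
  shows "lookup (Poly_Mapping.single 0 c * f) e = c * lookup f e"
  using lookup_single_times[of 0 c f e] by simp

section \<open>Values of terms at a weight and initial supports\<close>

definition term_value :: "('v::real_inner \<Rightarrow>\<^sub>0 trop) \<Rightarrow> 'v \<Rightarrow> 'v \<Rightarrow> trop" where
  "term_value f w u = lookup f u * Fin (u \<bullet> w)"

lemma term_value_eq_Infty [simp]: "term_value f w u = Infty \<longleftrightarrow> u \<notin> keys f"
  by (simp add: term_value_def in_keys_trop)

text \<open>The support of the initial form of \<open>f\<close> at \<open>w\<close>, phrased by
  comparisons of values so that it can be used without \<open>trop_eval\<close>. The minimum at
  \<open>w\<close> is attained exactly once when this set is a singleton.\<close>

definition initial_support :: "('v::real_inner \<Rightarrow>\<^sub>0 trop) \<Rightarrow> 'v \<Rightarrow> 'v set" where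
  "initial_support f w = {u\<in>keys f. \<forall>u'\<in>keys f. term_value f w u \<le> term_value f w u'}"

lemma initial_support_eq_trop_eval:
  fixes f :: "'v::euclidean_space \<Rightarrow>\<^sub>0 trop"
  shows   "initial_support f w = {u\<in>keys f. term_value f w u = trop_eval f w}"
proof (cases "keys f = {}")
  case False
  have ev: "trop_eval f w = (\<Sum>u\<in>keys f. term_value f w u)"
    by (simp add: trop_eval_def term_value_def)
  from trop_sum_attained[OF finite_keys False, of "term_value f w"]
  obtain m where m: "m \<in> keys f" "trop_eval f w = term_value f w m" unfolding ev by blast
  have "trop_eval f w \<le> term_value f w u" if "u \<in> keys f" for u
    unfolding ev by (rule trop_sum_le[OF finite_keys that])
  then show ?thesis
    unfolding initial_support_def using m by (auto intro: antisym) 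
qed (simp add: initial_support_def)

lemma initial_support_nonempty:
  fixes f :: "'v::euclidean_space \<Rightarrow>\<^sub>0 trop"
  assumes "f \<noteq> 0" shows "initial_support f w \<noteq> {}"
proof -
  have "keys f \<noteq> {}"
    using assms by simp
  from trop_sum_attained[OF finite_keys this, of "term_value f w"]
  obtain m where "m \<in> keys f" "trop_eval f w = term_value f w m"
    by (auto simp: trop_eval_def term_value_def)
  then show ?thesis unfolding initial_support_eq_trop_eval by auto
qed

lemma not_min_attained_twice_iff:
  fixes f :: "'v::euclidean_space \<Rightarrow>\<^sub>0 trop"
  assumes "f \<noteq> 0"
  shows "\<not> min_attained_twice f w \<longleftrightarrow> (\<exists>u. initial_support f w = {u})"
proof -
  have eq: "min_attained_twice f w \<longleftrightarrow> 2 \<le> card (initial_support f w)"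
    unfolding min_attained_twice_def initial_support_eq_trop_eval term_value_def ..
  have fin: "finite (initial_support f w)"
    by (simp add: initial_support_def)
  have "card (initial_support f w) \<noteq> 0"
    using initial_support_nonempty[OF assms] fin by simp
  then show ?thesis
    unfolding eq card_1_singleton_iff[symmetric] One_nat_def[symmetric] by linarith
qed

section \<open>Monomial orders and leading terms\<close>

definition monomial_order :: "('v::real_vector \<Rightarrow> 'v \<Rightarrow> bool) \<Rightarrow> bool" where
  "monomial_order R \<longleftrightarrow> irreflp R \<and> transp R \<and> totalp R \<and> (\<forall>x y z. R x y \<longrightarrow> R (z + x) (z + y))"

fun lex_less :: "'v::real_inner list \<Rightarrow> 'v \<Rightarrow> 'v \<Rightarrow> bool" where
  "lex_less [] x y = False"
| "lex_less (b # bs) x y = (b \<bullet> x < b \<bullet> y \<or> b \<bullet> x = b \<bullet> y \<and> lex_less bs x y)"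

lemma lex_less_irrefl: "\<not> lex_less bs x x"
  by (induction bs) auto

lemma lex_less_trans: "lex_less bs x y \<Longrightarrow> lex_less bs y z \<Longrightarrow> lex_less bs x z"
  by (induction bs) auto

lemma lex_less_translate: "lex_less bs x y \<Longrightarrow> lex_less bs (z + x) (z + y)"
  by (induction bs) (auto simp: inner_add_right)

lemma lex_less_total: "\<not> lex_less bs x y \<Longrightarrow> \<not> lex_less bs y x \<Longrightarrow> b \<in> set bs \<Longrightarrow> b \<bullet> x = b \<bullet> y"
  by (induction bs) auto

text \<open>The linear form \<open>c\<close> is compared first and the coordinates break ties. The
  coordinates make the order total, and comparing linear forms makes it invariant under
  translation.\<close>

lemma monomial_order_refining:
  fixes c :: "'v::euclidean_space"
  obtains R where "monomial_order R" "\<And>x y. c \<bullet> x < c \<bullet> y \<Longrightarrow> R x y"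
proof -
  obtain bs :: "'v list" where bs: "set bs = Basis"
    using finite_list[OF finite_Basis] by blast
  have "totalp (lex_less (c # bs))"
  proof (rule totalpI)
    fix x y :: 'v assume "x \<noteq> y"
    moreover have "x = y" if "\<not> lex_less (c # bs) x y" "\<not> lex_less (c # bs) y x"
    proof (rule euclidean_eqI)
      fix b :: 'v assume "b \<in> Basis"
      then have "b \<in> set (c # bs)" using bs by simp
      from lex_less_total[OF that this] show "x \<bullet> b = y \<bullet> b" by (simp only: inner_commute)
    qed
    ultimately show "lex_less (c # bs) x y \<or> lex_less (c # bs) y x" by blast
  qed
  moreover have "irreflp (lex_less (c # bs))"
    by (rule irreflpI) (rule lex_less_irrefl)
  moreover have "transp (lex_less (c # bs))"
    by (rule transpI) (rule lex_less_trans)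
  ultimately have "monomial_order (lex_less (c # bs))"
    unfolding monomial_order_def using lex_less_translate by blast
  then show ?thesis by (rule that) simp
qed

text \<open>Values at \<open>w\<close> are compared first, then \<open>R\<close>, and the smaller
  term leads, as suits the min convention. Only finite supports are compared, so \<open>R\<close>
  may order a group, in which infinite sets can lack least elements.\<close>

definition leading :: "('v::real_inner \<Rightarrow>\<^sub>0 trop) \<Rightarrow> 'v \<Rightarrow> ('v \<Rightarrow> 'v \<Rightarrow> bool) \<Rightarrow> 'v \<Rightarrow> bool" where
  "leading f w R u \<longleftrightarrow> u \<in> keys f \<and> (\<forall>e\<in>keys f. e \<noteq> u \<longrightarrow>
     term_value f w u < term_value f w e \<or> term_value f w u = term_value f w e \<and> R u e)"

lemma leading_in_initial_support: "leading f w R u \<Longrightarrow> u \<in> initial_support f w"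
  unfolding leading_def initial_support_def by (auto simp: less_imp_le)

lemma leading_least: "leading f w R u \<Longrightarrow> e \<in> initial_support f w \<Longrightarrow> e \<noteq> u \<Longrightarrow> R u e"
  unfolding leading_def initial_support_def by force

lemma leading_of_singleton: "initial_support f w = {u} \<Longrightarrow> leading f w R u"
  unfolding leading_def
proof (intro conjI ballI impI disjI1)
  assume u: "initial_support f w = {u}"
  then have u': "u \<in> keys f" "\<forall>e\<in>keys f. term_value f w u \<le> term_value f w e"
    by (auto simp: initial_support_def)
  then show "u \<in> keys f" by blast
  fix e assume e: "e \<in> keys f" "e \<noteq> u"
  then have "e \<notin> initial_support f w" using u by blast
  then obtain e' where "e' \<in> keys f" "term_value f w e' < term_value f w e"
    using e by (auto simp: initial_support_def not_le)
  then show "term_value f w u < term_value f w e" using u' by (metis le_less_trans)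
qed

lemma leading_exists:
  fixes f :: "'v::euclidean_space \<Rightarrow>\<^sub>0 trop"
  assumes "f \<noteq> 0" "monomial_order R"
  obtains u where "leading f w R u"
proof -
  have "finite (initial_support f w)"
    by (simp add: initial_support_def)
  moreover have "transp_on (initial_support f w) R" "totalp_on (initial_support f w) R"
    using assms(2) by (auto simp: monomial_order_def intro: transp_on_subset totalp_on_subset)
  ultimately obtain u where u: "u \<in> initial_support f w"
      "\<forall>e\<in>initial_support f w. e \<noteq> u \<longrightarrow> R u e"
    using Finite_Set.bex_least_element[OF _ initial_support_nonempty[OF assms(1)]] by blast
  have "leading f w R u"
    unfolding leading_def
  proof (intro conjI ballI impI)
    show "u \<in> keys f" using u by (simp add: initial_support_def)
    fix e assume e: "e \<in> keys f" "e \<noteq> u"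
    have le: "term_value f w u \<le> term_value f w e" using u e by (simp add: initial_support_def)
    show "term_value f w u < term_value f w e \<or> term_value f w u = term_value f w e \<and> R u e"
    proof (cases "term_value f w u = term_value f w e")
      case True
      then have "e \<in> initial_support f w" using u e by (simp add: initial_support_def)
      then show ?thesis using True u e by blast
    qed (use le in auto)
  qed
  then show ?thesis by (rule that)
qed

text \<open>Multiplication by the monomial \<open>k\<close> adds the constant
  \<open>k \<bullet> w\<close> to all values, and \<open>R\<close> is invariant under
  translation.\<close>

lemma leading_translate:
  assumes "leading f w R u" "monomial_order R"
  shows "leading (Poly_Mapping.single k 1 * f) w R (k + u)"
proof -
  have one: "Poly_Mapping.single k (1::trop) = Poly_Mapping.single k (Fin 0)"
    by (simp add: one_trop_def)
  have val: "term_value (Poly_Mapping.single k (Fin 0) * f) w (k + e) = Fin (k \<bullet> w) * term_value f w e" for e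
  proof (cases "lookup f e")
    case (Fin x)
    then show ?thesis
      by (simp add: term_value_def lookup_single_times inner_add_left)
  qed (simp add: term_value_def lookup_single_times)
  show ?thesis
    unfolding one leading_def keys_single_times
    using assms unfolding leading_def monomial_order_def by (auto simp: val)
qed

section \<open>Elimination and exchange in tropical ideals\<close>

lemma tropical_ideal_subset: "tropical_ideal L J \<Longrightarrow> f \<in> J \<Longrightarrow> keys f \<subseteq> L"
  by (auto simp: tropical_ideal_def semiring_ideal_def poly_over_def)

lemma tropical_ideal_mult: "tropical_ideal L J \<Longrightarrow> f \<in> J \<Longrightarrow> keys r \<subseteq> L \<Longrightarrow> r * f \<in> J"
  by (auto simp: tropical_ideal_def semiring_ideal_def poly_over_def)

text \<open>The exchange axiom asks for equal coefficients and a prescribed finite set of monomials.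
  A constant multiple of \<open>g\<close>, available because \<open>0 \<in> L\<close>, equalizes the
  coefficients at \<open>b\<close>. With \<open>E\<close> the union of the supports the bounds
  extend to all exponents, as every coefficient outside \<open>E\<close> is infinite.\<close>

lemma tropical_ideal_eliminate:
  fixes L :: "'e::cancel_comm_monoid_add set"
  assumes J: "tropical_ideal L J" and L: "0 \<in> L"
    and f: "f \<in> J" and g: "g \<in> J" and b: "b \<in> keys f" "b \<in> keys g"
  shows "\<exists>h\<in>J. \<exists>c. lookup f b = Fin c * lookup g b \<and> b \<notin> keys h
    \<and> (\<forall>e. min (lookup f e) (Fin c * lookup g e) \<le> lookup h e)
    \<and> (\<forall>e. lookup f e \<noteq> Fin c * lookup g e \<longrightarrow> lookup h e = min (lookup f e) (Fin c * lookup g e))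
    \<and> keys h \<subseteq> keys f \<union> keys g"
proof -
  obtain x y where xy: "lookup f b = Fin x" "lookup g b = Fin y"
    using b by (cases "lookup f b"; cases "lookup g b") (auto simp: in_keys_trop)
  define c where "c = x - y"
  define g' where "g' = Poly_Mapping.single 0 (Fin c) * g"
  define E where "E = keys f \<union> keys g"
  have g': "g' \<in> J"
    unfolding g'_def by (rule tropical_ideal_mult[OF J g]) (use L in \<open>auto split: if_splits\<close>)
  have lg': "lookup g' e = Fin c * lookup g e" for e
    by (simp add: g'_def lookup_scale)
  have kg': "keys g' = keys g"
    by (auto simp: in_keys_trop lg')
  have E: "finite E" "E \<subseteq> L"
    using tropical_ideal_subset[OF J] f g by (auto simp: E_def)
  have eq: "lookup f b = lookup g' b"
    by (simp add: lg' xy c_def)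
  have "f \<in> J \<inter> poly_over E" "g' \<in> J \<inter> poly_over E" "b \<in> E" "lookup f b \<noteq> Infty"
    using f g' kg' b xy by (auto simp: poly_over_def E_def)
  then obtain h where h: "h \<in> J \<inter> poly_over E" "lookup h b = Infty"
     "\<forall>e\<in>E. min (lookup f e) (lookup g' e) \<le> lookup h e
       \<and> (lookup f e \<noteq> lookup g' e \<longrightarrow> lookup h e = min (lookup f e) (lookup g' e))"
    using J[unfolded tropical_ideal_def, THEN conjunct2, rule_format, of E f g' b] E eq by blast
  have *: "min (lookup f e) (lookup g' e) \<le> lookup h e
       \<and> (lookup f e \<noteq> lookup g' e \<longrightarrow> lookup h e = min (lookup f e) (lookup g' e))" for e
  proof (cases "e \<in> E")
    case False
    then have "lookup h e = Infty" "lookup f e = Infty" "lookup g' e = Infty"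
      using h(1) kg' by (auto simp: poly_over_def E_def in_keys_trop)
    then show ?thesis by simp
  qed (use h in blast)
  show ?thesis
    by (rule bexI[of _ h], rule exI[of _ c])
      (use h * eq in \<open>auto simp: lg' in_keys_trop poly_over_def E_def\<close>)
qed

text \<open>After scaling, the term of \<open>g\<close> at \<open>b\<close> ties with that of
  \<open>f\<close>, hence comes after \<open>u\<close>, and all other terms of \<open>g\<close> come
  after \<open>b\<close>. So no term of the eliminant can precede \<open>u\<close>.\<close>

lemma eliminate_leading:
  fixes J :: "('v::euclidean_space \<Rightarrow>\<^sub>0 trop) set"
  assumes J: "tropical_ideal L J" "0 \<in> L" and R: "monomial_order R"
    and f: "f \<in> J" "leading f w R u" and g: "g \<in> J" "leading g w R b"
    and b: "b \<noteq> u" "b \<in> keys f"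
  obtains h where "h \<in> J" "leading h w R u" "b \<notin> keys h" "keys h \<subseteq> keys f \<union> keys g"
proof -
  have bg: "b \<in> keys g" using g by (simp add: leading_def)
  obtain h c where h: "h \<in> J" "lookup f b = Fin c * lookup g b" "b \<notin> keys h"
    "\<And>e. min (lookup f e) (Fin c * lookup g e) \<le> lookup h e"
    "\<And>e. lookup f e \<noteq> Fin c * lookup g e \<Longrightarrow> lookup h e = min (lookup f e) (Fin c * lookup g e)"
    "keys h \<subseteq> keys f \<union> keys g"
    using tropical_ideal_eliminate[OF J f(1) g(1) b(2) bg] by (elim bexE exE conjE) simp
  define tg where "tg e = Fin c * term_value g w e" for e
  have tg: "tg e = (Fin c * lookup g e) * Fin (e \<bullet> w)" for e
    by (simp add: tg_def term_value_def mult.assoc)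
  have hval: "min (term_value f w e) (tg e) \<le> term_value h w e" for e
    using h(4)[of e] unfolding tg term_value_def by (auto simp: min_le_iff_disj)
  have fb: "term_value f w b = tg b"
    using h(2) by (simp add: tg term_value_def)
  have asym: "\<not> (R x y \<and> R y x)" and trans: "R x y \<Longrightarrow> R y z \<Longrightarrow> R x z" for x y z
    using R unfolding monomial_order_def by (meson irreflpD transpD)+
  have F: "term_value f w u < term_value f w e \<or> term_value f w u = term_value f w e \<and> R u e"
    if "e \<in> keys f" "e \<noteq> u" for e
    using f(2) that by (auto simp: leading_def)
  have G: "tg b < tg e \<or> tg b = tg e \<and> R b e" if "e \<in> keys g" "e \<noteq> b" for e
    using g(2) that by (auto simp: leading_def tg_def)
  have uf: "u \<in> keys f" using f(2) by (simp add: leading_def)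
  have Fb: "term_value f w u < tg b \<or> term_value f w u = tg b \<and> R u b"
    using F[OF b(2,1)] fb by simp
  \<comment> \<open>Strictness makes the coefficient of the eliminant at \<open>u\<close> exact. A
    tie would put \<open>u\<close> both before and after \<open>b\<close> in
    \<open>R\<close>.\<close>
  have "term_value f w u < tg u"
  proof (cases "u \<in> keys g")
    case True
    from G[OF True] b(1) Fb asym[of u b] show ?thesis by auto
  next
    case False
    then have "tg u = Infty" by (simp add: tg_def)
    moreover have "term_value f w u \<noteq> Infty" using uf by simp
    ultimately show ?thesis by (simp add: less_le)
  qed
  then have lt: "lookup f u < Fin c * lookup g u"
    by (simp add: tg term_value_def)
  then have hu: "lookup h u = lookup f u"
    using h(5)[of u] less_imp_le[OF lt] less_imp_neq[OF lt] by (simp add: min_def)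
  then have tu: "term_value h w u = term_value f w u" by (simp add: term_value_def)
  have "leading h w R u"
    unfolding leading_def tu
  proof (intro conjI ballI impI)
    show "u \<in> keys h" using uf hu by (simp add: in_keys_trop)
    fix e assume e: "e \<in> keys h" "e \<noteq> u"
    have eb: "e \<noteq> b" using e h(3) by blast
    have nI: "term_value h w e \<noteq> Infty" using e by simp
    show "term_value f w u < term_value h w e \<or> term_value f w u = term_value h w e \<and> R u e"
    proof (cases "term_value f w e \<le> tg e")
      case True
      then have le: "term_value f w e \<le> term_value h w e"
        using hval[of e] by (simp add: min_def)
      then have "e \<in> keys f"
        using nI by (metis term_value_eq_Infty trop_Infty_le_iff)
      from F[OF this e(2)] le show ?thesis by auto
    next
      case False
      then have le: "tg e \<le> term_value h w e"
        using hval[of e] by (simp add: min_def)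
      then have "e \<in> keys g"
        using nI by (metis tg_def times_Fin_Infty_iff(2) term_value_eq_Infty trop_Infty_le_iff)
      from G[OF this eb] le Fb trans[of u b e] show ?thesis by auto
    qed
  qed
  then show ?thesis using that h by blast
qed

text \<open>Steinitz exchange: \<open>A\<close> contains the support of no nonzero member of
  \<open>J\<close>, and every element outside \<open>B\<close> is expressed through
  \<open>B\<close>. Exchanging an element of \<open>B - A\<close> for one of \<open>A - B\<close>
  keeps the size and the spanning property of \<open>B\<close> and shrinks
  \<open>A - B\<close>.\<close>

lemma independent_card_le_spanning:
  assumes J: "tropical_ideal L J" "0 \<in> L" and fin: "finite E"
    and A: "A \<subseteq> E" "\<And>f. f \<in> J \<Longrightarrow> keys f \<subseteq> A \<Longrightarrow> f = 0"
    and B: "B \<subseteq> E" "\<And>u. u \<in> E - B \<Longrightarrow> \<exists>f\<in>J. u \<in> keys f \<and> keys f \<subseteq> insert u B"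
  shows "card A \<le> card (B :: 'e::cancel_comm_monoid_add set)"
  using B
proof (induction "card (A - B)" arbitrary: B)
  case 0
  have "finite (A - B)" using A fin by (meson finite_Diff finite_subset)
  with 0 have "A \<subseteq> B" by auto
  then show ?case using 0 fin by (meson card_mono finite_subset)
next
  case (Suc n)
  then obtain u where u: "u \<in> A" "u \<notin> B"
    by (metis Diff_eq_empty_iff card.empty nat.distinct(1) subsetI)
  then obtain fu where fu: "fu \<in> J" "u \<in> keys fu" "keys fu \<subseteq> insert u B"
    using Suc.prems(2)[of u] A by blast
  have "fu \<noteq> 0" using fu(2) by auto
  \<comment> \<open>The relation expressing \<open>u\<close> through \<open>B\<close> cannot be
    supported in \<open>A\<close>, so it contains an element of \<open>B\<close> that may
    leave.\<close>
  then obtain b where b: "b \<in> keys fu" "b \<notin> A"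
    using A(2)[OF fu(1)] by blast
  then have bB: "b \<in> B" using fu u by auto
  define B' where "B' = insert u (B - {b})"
  have finB: "finite B" using Suc.prems fin by (meson finite_subset)
  have "card B' = card B"
    using bB u finB card_Suc_Diff1[of B b] by (simp add: B'_def)
  moreover have "A - B' = (A - B) - {u}" using b by (auto simp: B'_def)
  then have "n = card (A - B')" using Suc.hyps(2) u A fin
    by (simp add: card_Diff_singleton)
  moreover have "B' \<subseteq> E" using Suc.prems(1) u A by (auto simp: B'_def)
  moreover have "\<exists>f\<in>J. x \<in> keys f \<and> keys f \<subseteq> insert x B'" if x: "x \<in> E - B'" for x
  proof (cases "x = b")
    case True
    then show ?thesis using fu b by (intro bexI[of _ fu]) (auto simp: B'_def)
  next
    case False
    then have xB: "x \<in> E - B" "x \<noteq> u" using x by (auto simp: B'_def)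
    then obtain g where g: "g \<in> J" "x \<in> keys g" "keys g \<subseteq> insert x B"
      using Suc.prems(2) by blast
    show ?thesis
    proof (cases "b \<in> keys g")
      case True
      obtain h c where h: "h \<in> J" "lookup g b = Fin c * lookup fu b" "b \<notin> keys h"
         "\<And>e. min (lookup g e) (Fin c * lookup fu e) \<le> lookup h e"
         "\<And>e. lookup g e \<noteq> Fin c * lookup fu e \<Longrightarrow> lookup h e = min (lookup g e) (Fin c * lookup fu e)"
         "keys h \<subseteq> keys g \<union> keys fu"
        using tropical_ideal_eliminate[OF J g(1) fu(1) True b(1)] by (elim bexE exE conjE) simp
      \<comment> \<open>Since \<open>fu\<close> has no term at \<open>x\<close>, eliminating
        \<open>b\<close> leaves the coefficient of \<open>g\<close> at \<open>x\<close>
        intact.\<close>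
      have "lookup fu x = Infty" "lookup g x \<noteq> Infty"
        using fu(3) xB g(2) by (auto simp: in_keys_trop)
      then have "x \<in> keys h"
        using h(5)[of x] by (simp add: in_keys_trop min_def)
      then show ?thesis using h g fu by (intro bexI[of _ h]) (auto simp: B'_def)
    next
      case False
      then show ?thesis using g by (intro bexI[of _ g]) (auto simp: B'_def)
    qed
  qed
  ultimately show ?case using Suc.hyps(1)[of B'] by simp
qed

section \<open>Finite tropical bases\<close>

lemma nat_seq_mono_subseq:
  fixes s :: "nat \<Rightarrow> nat"
  shows "\<exists>r :: nat \<Rightarrow> nat. strict_mono r \<and> mono (\<lambda>n. s (r n))"
proof -
  obtain r where r: "strict_mono r" "monoseq (\<lambda>n. s (r n))"
    using seq_monosub[of s] by blast
  show ?thesis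
  proof (cases "incseq (\<lambda>n. s (r n))")
    case False
    then have dec: "decseq (\<lambda>n. s (r n))"
      using r(2) by (simp add: monoseq_iff)
    \<comment> \<open>A nonincreasing sequence of natural numbers is constant from any index at
      which its minimum is attained.\<close>
    define k where "k = (ARG_MIN (\<lambda>n. s (r n)) n. True)"
    have k: "s (r k) \<le> s (r n)" for n
      unfolding k_def by (rule arg_min_nat_le) simp
    have "s (r (n + k)) = s (r k)" for n
      using k[of "n + k"] decseqD[OF dec, of k "n + k"] by simp
    then have "mono (\<lambda>n. s (r (n + k)))" by (simp add: mono_def)
    moreover have "strict_mono (\<lambda>n. r (n + k))"
      using r(1) by (simp add: strict_mono_def)
    ultimately show ?thesis by (intro exI[of _ "\<lambda>n. r (n + k)"] conjI)
  qed (use r in blast)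
qed

lemma Dickson_subseq:
  fixes m :: "nat \<Rightarrow> 'a multiset"
  assumes "finite G"
  shows "\<exists>r :: nat \<Rightarrow> nat. strict_mono r \<and> (\<forall>g\<in>G. mono (\<lambda>n. count (m (r n)) g))"
  using assms
proof (induction G rule: finite_induct)
  case empty
  show ?case by (intro exI[of _ id]) (auto simp: strict_mono_def)
next
  case (insert x G)
  then obtain r :: "nat \<Rightarrow> nat" where r: "strict_mono r" "\<And>g. g \<in> G \<Longrightarrow> mono (\<lambda>n. count (m (r n)) g)" by blast
  obtain q :: "nat \<Rightarrow> nat" where q: "strict_mono q" "mono (\<lambda>n. count (m (r (q n))) x)"
    using nat_seq_mono_subseq[of "\<lambda>n. count (m (r n)) x"] by blast
  have "mono (\<lambda>n. count (m (r (q n))) g)" if "g \<in> G" for g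
    using r(2)[OF that] strict_mono_mono[OF q(1)] unfolding mono_def by blast
  moreover have "strict_mono (\<lambda>n. r (q n))"
    using r(1) q(1) by (simp add: strict_mono_def)
  ultimately show ?case
    using q(2) by (intro exI[of _ "\<lambda>n. r (q n)"]) auto
qed

text \<open>Otherwise, for every \<open>D\<close>, some \<open>m D\<close> in \<open>X\<close>
  contains no member of \<open>X\<close> of size at most \<open>D\<close>. This fails along a
  subsequence that increases in every multiplicity.\<close>

lemma Dickson_bounded_basis:
  fixes X :: "'a multiset set"
  assumes G: "finite G" and X: "\<And>\<mu>. \<mu> \<in> X \<Longrightarrow> set_mset \<mu> \<subseteq> G"
  shows "\<exists>D. \<forall>\<mu>\<in>X. \<exists>\<nu>\<in>X. size \<nu> \<le> D \<and> \<nu> \<subseteq># \<mu>"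
proof (rule ccontr)
  assume "\<not> ?thesis"
  then have "\<forall>D. \<exists>\<mu>\<in>X. \<forall>\<nu>\<in>X. size \<nu> \<le> D \<longrightarrow> \<not> \<nu> \<subseteq># \<mu>" by blast
  then obtain m where m: "\<And>D. m D \<in> X" "\<And>D \<nu>. \<nu> \<in> X \<Longrightarrow> size \<nu> \<le> D \<Longrightarrow> \<not> \<nu> \<subseteq># m D"
    by metis
  obtain r :: "nat \<Rightarrow> nat" where r: "strict_mono r" "\<forall>g\<in>G. mono (\<lambda>n. count (m (r n)) g)"
    using Dickson_subseq[OF G, of m] by blast
  \<comment> \<open>Strict monotonicity gives \<open>n \<le> r n\<close>, so \<open>m (r n)\<close>
    contains no member of \<open>X\<close> of size \<open>n\<close>; but \<open>m (r 0)\<close> is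
    such a member.\<close>
  define n where "n = size (m (r 0))"
  have "m (r 0) \<subseteq># m (r n)"
  proof (rule mset_subset_eqI)
    fix a
    show "count (m (r 0)) a \<le> count (m (r n)) a"
    proof (cases "a \<in> G")
      case True
      then show ?thesis using r(2) unfolding mono_def by blast
    next
      case False
      then have "a \<notin># m (r 0)" using X[OF m(1)] by blast
      then show ?thesis by (simp add: not_in_iff)
    qed
  qed
  moreover have "size (m (r 0)) \<le> r n"
    unfolding n_def by (rule seq_suble[OF r(1)])
  ultimately show False using m by blast
qed

text \<open>
  Filtering by the number of generators replaces homogenization: the generator \<open>0\<close> plays the role
  of the homogenizing variable.
\<close>

definition generator_sums :: "'v::comm_monoid_add set \<Rightarrow> nat \<Rightarrow> 'v set" where
  "generator_sums G d = {\<Sum>\<^sub># \<mu> |\<mu>. set_mset \<mu> \<subseteq> G \<and> size \<mu> = d}"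

lemma finite_generator_sums: "finite G \<Longrightarrow> finite (generator_sums G d)"
proof (induction d)
  case 0
  show ?case by (rule finite_subset[of _ "{0}"]) (auto simp: generator_sums_def)
next
  case (Suc d)
  have "generator_sums G (Suc d) \<subseteq> (\<Union>g\<in>G. (+) g ` generator_sums G d)"
  proof
    fix x assume "x \<in> generator_sums G (Suc d)"
    then obtain \<mu> where \<mu>: "x = \<Sum>\<^sub># \<mu>" "set_mset \<mu> \<subseteq> G" "size \<mu> = Suc d"
      by (auto simp: generator_sums_def)
    then obtain g \<nu> where "\<mu> = add_mset g \<nu>" by (metis size_eq_Suc_imp_eq_union)
    with \<mu> show "x \<in> (\<Union>g\<in>G. (+) g ` generator_sums G d)"
      by (auto simp: generator_sums_def)
  qed
  then show ?case using Suc by (meson finite_UN finite_imageI finite_subset)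
qed

lemma generator_sums_add: "u \<in> generator_sums G d \<Longrightarrow> g \<in> G \<Longrightarrow> g + u \<in> generator_sums G (Suc d)"
proof -
  assume "u \<in> generator_sums G d" and g: "g \<in> G"
  then obtain \<mu> where "u = \<Sum>\<^sub># \<mu>" "set_mset \<mu> \<subseteq> G" "size \<mu> = d"
    by (auto simp: generator_sums_def)
  then show ?thesis unfolding generator_sums_def
    using g by (intro CollectI exI[of _ "add_mset g \<mu>"]) auto
qed

lemma generator_sums_mono:
  assumes "0 \<in> G" "d \<le> d'" shows "generator_sums G d \<subseteq> generator_sums G d'"
  using assms(2)
proof (induction rule: dec_induct)
  case (step n)
  then show ?case using generator_sums_add[OF _ assms(1)] by force
qed simp

lemma generator_sums_exhaust:
  assumes "0 \<in> G" "finite K" "K \<subseteq> {\<Sum>\<^sub># \<mu> |\<mu>. set_mset \<mu> \<subseteq> G}"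
  shows "\<exists>d. K \<subseteq> generator_sums G d"
  using assms(2,3)
proof (induction K rule: finite_induct)
  case (insert x K)
  then obtain d where d: "K \<subseteq> generator_sums G d" by blast
  obtain \<mu> where "x = \<Sum>\<^sub># \<mu>" "set_mset \<mu> \<subseteq> G" using insert.prems by auto
  then have "x \<in> generator_sums G (size \<mu>)" by (auto simp: generator_sums_def)
  then have "insert x K \<subseteq> generator_sums G (max d (size \<mu>))"
    using d generator_sums_mono[OF assms(1), of d "max d (size \<mu>)"]
      generator_sums_mono[OF assms(1), of "size \<mu>" "max d (size \<mu>)"] by auto
  then show ?case by blast
qed simp

text \<open>The model is a monomial ideal in the homogenized semigroup ring, given by its monomials
  of each degree.\<close>

definition graded_upset :: "'v::comm_monoid_add set \<Rightarrow> (nat \<Rightarrow> 'v set) \<Rightarrow> bool" where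
  "graded_upset G M \<longleftrightarrow> (\<forall>d. M d \<subseteq> generator_sums G d \<and> (\<forall>u\<in>M d. \<forall>g\<in>G. g + u \<in> M (Suc d)))"

lemma graded_upset_mset_add:
  assumes "graded_upset G M" "set_mset \<kappa> \<subseteq> G" "\<Sum>\<^sub># \<nu> \<in> M (size \<nu>)"
  shows "\<Sum>\<^sub># (\<nu> + \<kappa>) \<in> M (size (\<nu> + \<kappa>))"
  using assms(2)
proof (induction \<kappa>)
  case (add x \<kappa>)
  then have "\<Sum>\<^sub># (\<nu> + \<kappa>) \<in> M (size (\<nu> + \<kappa>))" by simp
  then have "x + \<Sum>\<^sub># (\<nu> + \<kappa>) \<in> M (Suc (size (\<nu> + \<kappa>)))"
    using assms(1) add.prems unfolding graded_upset_def by simp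
  then show ?case by (simp add: ac_simps)
qed (use assms in simp)

text \<open>
  An infinite family would have a limit along a nested sequence of infinite subfamilies (Koenig's
  lemma). The limit is generated in bounded degree, so it is contained in every member that
  agrees with it up to that degree, and equal cardinalities turn the inclusion into an equality.
\<close>

lemma finite_graded_upsets:
  fixes \<M> :: "(nat \<Rightarrow> 'v::comm_monoid_add set) set"
  assumes G: "finite G"
    and up: "\<And>M. M \<in> \<M> \<Longrightarrow> graded_upset G M"
    and card: "\<And>M M' d. M \<in> \<M> \<Longrightarrow> M' \<in> \<M> \<Longrightarrow> card (M d) = card (M' d)"
  shows "finite \<M>"
proof (rule ccontr)
  assume inf: "infinite \<M>"
  have sub: "M d \<subseteq> generator_sums G d" if "M \<in> \<M>" for M d
    using up[OF that] by (auto simp: graded_upset_def)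
  define agree where "agree d T \<longleftrightarrow> (\<forall>M\<in>T. \<forall>M'\<in>T. M d = M' d)" for d :: nat and T :: "(nat \<Rightarrow> 'v set) set"
  have refine: "\<exists>T'. T' \<subseteq> T \<and> infinite T' \<and> agree d T'"
    if T: "T \<subseteq> \<M>" "infinite T" for T d
  proof -
    have "(\<lambda>M. M d) ` T \<subseteq> Pow (generator_sums G d)" using T sub by blast
    then have "finite ((\<lambda>M. M d) ` T)"
      using finite_generator_sums[OF G] by (meson finite_Pow_iff finite_subset)
    from pigeonhole_infinite[OF T(2) this] obtain M0 where
      "M0 \<in> T" "infinite {M\<in>T. M d = M0 d}" by auto
    then show ?thesis by (intro exI[of _ "{M\<in>T. M d = M0 d}"]) (auto simp: agree_def)
  qed
  have "\<exists>T. \<forall>d. (T d \<subseteq> \<M> \<and> infinite (T d) \<and> agree d (T d)) \<and> T (Suc d) \<subseteq> T d"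
  proof (rule dependent_nat_choice)
    show "\<exists>T. T \<subseteq> \<M> \<and> infinite T \<and> agree 0 T" by (rule refine[OF order.refl inf])
    fix T d assume T: "T \<subseteq> \<M> \<and> infinite T \<and> agree d T"
    then obtain T' where T': "T' \<subseteq> T" "infinite T'" "agree (Suc d) T'"
      using refine[of T "Suc d"] by auto
    then have "T' \<subseteq> \<M>" using T by (metis order.trans)
    then show "\<exists>T'. (T' \<subseteq> \<M> \<and> infinite T' \<and> agree (Suc d) T') \<and> T' \<subseteq> T"
      using T' by (intro exI[of _ T'] conjI)
  qed
  then obtain T where T: "\<And>d. T d \<subseteq> \<M>" "\<And>d. infinite (T d)" "\<And>d. agree d (T d)"
     "\<And>d. T (Suc d) \<subseteq> T d" by metis
  have Tmono: "T d' \<subseteq> T d" if "d \<le> d'" for d d'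
    using that by (induction rule: dec_induct) (use T(4) in blast)+
  have "\<forall>d. \<exists>M. M \<in> T d" using T(2) by (metis finite.emptyI ex_in_conv)
  then obtain R where R: "\<And>d. R d \<in> T d" by metis
  \<comment> \<open>All members of \<open>T d\<close> agree in degree \<open>d\<close>, so the limit
    does not depend on the choice of \<open>R d\<close>.\<close>
  define L where "L d = R d d" for d
  have L: "M d = L d" if "M \<in> T n" "d \<le> n" for M n d
    using T(3)[of d] R[of d] Tmono[OF that(2)] that(1) unfolding L_def agree_def by blast
  have R\<M>: "R n \<in> \<M>" for n using T(1) R by blast
  have upL: "graded_upset G L"
    unfolding graded_upset_def
  proof (intro allI conjI ballI)
    fix d
    show "L d \<subseteq> generator_sums G d" unfolding L_def by (rule sub[OF R\<M>])
    fix u g assume "u \<in> L d" "g \<in> G"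
    then have "g + u \<in> R (Suc d) (Suc d)"
      using up[OF R\<M>, of "Suc d"] L[OF R[of "Suc d"], of d] by (auto simp: graded_upset_def)
    then show "g + u \<in> L (Suc d)" by (simp add: L_def)
  qed
  \<comment> \<open>Several multisets may have the same sum, so the limit is lifted to multisets,
    where Dickson's lemma provides the degree bound \<open>D\<close>.\<close>
  define X where "X = {\<mu>. set_mset \<mu> \<subseteq> G \<and> \<Sum>\<^sub># \<mu> \<in> L (size \<mu>)}"
  obtain D where D: "\<And>\<mu>. \<mu> \<in> X \<Longrightarrow> \<exists>\<nu>\<in>X. size \<nu> \<le> D \<and> \<nu> \<subseteq># \<mu>"
    using Dickson_bounded_basis[OF G, of X] by (auto simp: X_def)
  have "M = L" if M: "M \<in> T D" for M
  proof
    fix d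
    have M\<M>: "M \<in> \<M>" using M T(1) by blast
    have "L d \<subseteq> M d"
    proof
      fix u assume u: "u \<in> L d"
      then obtain \<mu> where \<mu>: "u = \<Sum>\<^sub># \<mu>" "set_mset \<mu> \<subseteq> G" "size \<mu> = d"
        using upL by (auto simp: graded_upset_def generator_sums_def)
      then have "\<mu> \<in> X" using u by (simp add: X_def)
      then obtain \<nu> where \<nu>: "\<nu> \<in> X" "size \<nu> \<le> D" "\<nu> \<subseteq># \<mu>" using D by blast
      have "\<Sum>\<^sub># \<nu> \<in> M (size \<nu>)"
        using L[OF M \<nu>(2)] \<nu>(1) by (simp add: X_def)
      moreover have "set_mset (\<mu> - \<nu>) \<subseteq> G" using \<mu>(2) by (meson in_diffD subset_iff)
      ultimately have "\<Sum>\<^sub># (\<nu> + (\<mu> - \<nu>)) \<in> M (size (\<nu> + (\<mu> - \<nu>)))"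
        using graded_upset_mset_add[OF up[OF M\<M>]] by blast
      then show "u \<in> M d"
        unfolding subset_mset.add_diff_inverse[OF \<nu>(3)] using \<mu> by (simp only:)
    qed
    moreover have "card (M d) = card (L d)"
      unfolding L_def by (rule card[OF M\<M> R\<M>])
    moreover have "finite (M d)"
      using sub[OF M\<M>] finite_generator_sums[OF G] by (meson finite_subset)
    ultimately show "M d = L d" by (metis card_subset_eq)
  qed
  then have "T D \<subseteq> {L}" by blast
  then show False using T(2) by (meson finite.emptyI finite_insert finite_subset)
qed

definition tropical_basis :: "('v::euclidean_space \<Rightarrow>\<^sub>0 trop) set \<Rightarrow> ('v \<Rightarrow>\<^sub>0 trop) set \<Rightarrow> bool" where
  "tropical_basis J F \<longleftrightarrow> F \<subseteq> J - {0} \<and>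
    (\<forall>w. \<forall>f\<in>J - {0}. \<not> min_attained_twice f w \<longrightarrow> (\<exists>f'\<in>F. \<not> min_attained_twice f' w))"

section \<open>Initial ideals over a finitely generated monoid\<close>

locale fg_tropical_ideal =
  fixes L :: "'v::euclidean_space set" and J :: "('v \<Rightarrow>\<^sub>0 trop) set" and G :: "'v set"
  assumes tropical: "tropical_ideal L J"
    and finite_gens: "finite G" and zero_in_gens: "0 \<in> G"
    and generated: "L = {\<Sum>\<^sub># \<mu> |\<mu>. set_mset \<mu> \<subseteq> G}"
begin

lemma zero_mem: "0 \<in> L"
  unfolding generated by (rule CollectI, rule exI[of _ "{#}"]) simp

lemma gens_mem: "g \<in> G \<Longrightarrow> g \<in> L"
  unfolding generated by (rule CollectI, rule exI[of _ "{#g#}"]) simp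

text \<open>The degree bound applies to the whole support of \<open>f\<close> and not just to
  \<open>u\<close>. Leading terms of degree \<open>d\<close> and their complement can then be
  compared inside the finite set \<open>generator_sums G d\<close>.\<close>

definition leading_terms :: "'v \<Rightarrow> ('v \<Rightarrow> 'v \<Rightarrow> bool) \<Rightarrow> nat \<Rightarrow> 'v set" where
  "leading_terms w R d = {u. \<exists>f\<in>J. keys f \<subseteq> generator_sums G d \<and> leading f w R u}"

lemma leading_terms_subset: "leading_terms w R d \<subseteq> generator_sums G d"
  by (auto simp: leading_terms_def leading_def)

lemma graded_upset_leading_terms:
  assumes R: "monomial_order R"
  shows "graded_upset G (leading_terms w R)"
  unfolding graded_upset_def
proof (intro allI conjI ballI leading_terms_subset)
  fix d u g assume "u \<in> leading_terms w R d" and g: "g \<in> G"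
  then obtain f where f: "f \<in> J" "keys f \<subseteq> generator_sums G d" "leading f w R u"
    by (auto simp: leading_terms_def)
  have "Poly_Mapping.single g 1 * f \<in> J"
    by (rule tropical_ideal_mult[OF tropical f(1)]) (use gens_mem[OF g] in \<open>auto split: if_splits\<close>)
  moreover have "keys (Poly_Mapping.single g 1 * f) \<subseteq> generator_sums G (Suc d)"
    using f(2) generator_sums_add[OF _ g] by (auto simp: one_trop_def keys_single_times)
  ultimately show "g + u \<in> leading_terms w R (Suc d)"
    using leading_translate[OF f(3) R, of g] by (auto simp: leading_terms_def)
qed

text \<open>The analogue of an element of a reduced Groebner basis: leading terms other than
  \<open>u\<close> are eliminated one after another.\<close>

lemma reduced_relation:
  assumes R: "monomial_order R" and u: "u \<in> leading_terms w R d"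
  shows "\<exists>f\<in>J. leading f w R u \<and> keys f \<subseteq> insert u (generator_sums G d - leading_terms w R d)"
proof -
  \<comment> \<open>The claim is made for all \<open>u\<close> at once, since removing
    \<open>b\<close> uses a relation for \<open>b\<close> that already avoids \<open>X\<close>.
    Terms removed earlier thus cannot reappear.\<close>
  have avoid: "\<exists>f\<in>J. keys f \<subseteq> generator_sums G d \<and> leading f w R u \<and> keys f \<inter> X = {}"
    if "finite X" "X \<subseteq> leading_terms w R d - {u}" "u \<in> leading_terms w R d" for X u
    using that
  proof (induction X arbitrary: u rule: finite_induct)
    case empty
    then show ?case by (auto simp: leading_terms_def)
  next
    case (insert b X)
    obtain f where f: "f \<in> J" "keys f \<subseteq> generator_sums G d" "leading f w R u" "keys f \<inter> X = {}"
      using insert.IH[of u] insert.prems by blast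
    obtain g where g: "g \<in> J" "keys g \<subseteq> generator_sums G d" "leading g w R b" "keys g \<inter> X = {}"
      using insert.IH[of b] insert.prems insert.hyps by blast
    show ?case
    proof (cases "b \<in> keys f")
      case True
      have "b \<noteq> u" using insert.prems by blast
      from eliminate_leading[OF tropical zero_mem R f(1,3) g(1,3) this True]
      obtain h where "h \<in> J" "leading h w R u" "b \<notin> keys h" "keys h \<subseteq> keys f \<union> keys g"
        by blast
      then show ?thesis using f g by (intro bexI[of _ h]) auto
    next
      case False
      then show ?thesis using f by (intro bexI[of _ f]) auto
    qed
  qed
  have "finite (leading_terms w R d - {u})"
    using leading_terms_subset finite_generator_sums[OF finite_gens] by (meson finite_Diff finite_subset)
  from avoid[OF this order.refl u] show ?thesis by blast
qed

lemma standard_terms_independent: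
  assumes "monomial_order R" "f \<in> J" "keys f \<subseteq> generator_sums G d - leading_terms w R d"
  shows "f = 0"
proof (rule ccontr)
  assume "f \<noteq> 0"
  then obtain u where u: "leading f w R u" using leading_exists[OF _ assms(1)] by blast
  then have "u \<in> leading_terms w R d" "u \<in> keys f"
    using assms by (auto simp: leading_terms_def leading_def)
  then show False using assms(3) by blast
qed

text \<open>The terms that are not leading are independent, because a nonzero relation has a leading
  term, and spanning by reduced relations. Exchange in both directions compares any two choices of
  weight and order.\<close>

lemma card_leading_terms:
  assumes R: "monomial_order R" and R': "monomial_order R'"
  shows "card (leading_terms w R d) = card (leading_terms w' R' d)"
proof -
  let ?E = "generator_sums G d"
  have fin: "finite ?E" by (rule finite_generator_sums[OF finite_gens])
  have le: "card (?E - leading_terms w R d) \<le> card (?E - leading_terms w' R' d)"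
    if "monomial_order R" "monomial_order R'" for w w' R R'
  proof (rule independent_card_le_spanning[OF tropical zero_mem fin])
    show "?E - leading_terms w R d \<subseteq> ?E" "?E - leading_terms w' R' d \<subseteq> ?E" by auto
    show "f = 0" if "f \<in> J" "keys f \<subseteq> ?E - leading_terms w R d" for f
      using standard_terms_independent that \<open>monomial_order R\<close> by blast
    fix u assume "u \<in> ?E - (?E - leading_terms w' R' d)"
    then have "u \<in> leading_terms w' R' d" by blast
    from reduced_relation[OF \<open>monomial_order R'\<close> this]
    show "\<exists>f\<in>J. u \<in> keys f \<and> keys f \<subseteq> insert u (?E - leading_terms w' R' d)"
      by (auto simp: leading_def)
  qed
  have "card (?E - leading_terms w R d) = card ?E - card (leading_terms w R d)" for w R
    by (meson card_Diff_subset fin finite_subset leading_terms_subset)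
  moreover have "card (leading_terms w R d) \<le> card ?E" for w R
    by (meson card_mono fin leading_terms_subset)
  ultimately show ?thesis using le[OF R R', of w w'] le[OF R' R, of w' w]
    by (metis le_antisym diff_diff_cancel)
qed

definition initial_ideals :: "(nat \<Rightarrow> 'v set) set" where
  "initial_ideals = {leading_terms w R |w R. monomial_order R}"

text \<open>An initial ideal found at another weight may arise at \<open>w\<close> only with a
  different order, so the order is quantified away.\<close>

definition initial_ideals_at :: "'v \<Rightarrow> (nat \<Rightarrow> 'v set) set" where
  "initial_ideals_at w = {leading_terms w R |R. monomial_order R}"

lemma finite_initial_ideals: "finite initial_ideals"
  by (rule finite_graded_upsets[OF finite_gens])
    (auto simp: initial_ideals_def intro: graded_upset_leading_terms card_leading_terms)

text \<open>
  The order refines the direction from \<open>w\<close> to \<open>w'\<close>. Since its initial ideal also occurs at \<open>w\<close>,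
  the direction is constant on the initial support at \<open>w'\<close> of a reduced relation.
\<close>

lemma initial_monomial_transfer:
  assumes eq: "initial_ideals_at w' = initial_ideals_at w"
    and g: "g \<in> J" "keys g \<subseteq> generator_sums G d" "initial_support g w = {u}"
  shows "\<exists>M\<in>initial_ideals_at w'. u \<in> M d \<and>
    (\<forall>f\<in>J. u \<in> keys f \<and> keys f \<subseteq> insert u (generator_sums G d - M d) \<longrightarrow> initial_support f w' = {u})"
proof -
  obtain R' where R': "monomial_order R'" "\<And>x y. (w' - w) \<bullet> x < (w' - w) \<bullet> y \<Longrightarrow> R' x y"
    using monomial_order_refining[of "w' - w"] by blast
  define M where "M = leading_terms w' R'"
  have M: "M \<in> initial_ideals_at w'" using R' by (auto simp: M_def initial_ideals_at_def)
  then obtain R where R: "monomial_order R" "M = leading_terms w R"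
    unfolding eq by (auto simp: initial_ideals_at_def)
  have uM: "u \<in> M d"
    using g leading_of_singleton[OF g(3), of R] by (auto simp: R(2) leading_terms_def)
  have asym: "\<not> (R' x y \<and> R' y x)" for x y
    using R'(1) unfolding monomial_order_def by (meson irreflpD transpD)
  \<comment> \<open>A relation whose only term in \<open>M d\<close> is \<open>u\<close> has to lead
    with \<open>u\<close> wherever \<open>M\<close> is the initial ideal. This is applied to
    \<open>w'\<close> with \<open>R'\<close> and to \<open>w\<close> with \<open>R\<close>.\<close>
  have lead: "leading f v S u"
    if f: "f \<in> J" "u \<in> keys f" "keys f \<subseteq> insert u (generator_sums G d - M d)"
      and S: "monomial_order S" "M = leading_terms v S" for f v S
  proof -
    have "f \<noteq> 0" using f(2) by auto
    then obtain x where x: "leading f v S x" using leading_exists[OF _ S(1)] by blast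
    have "keys f \<subseteq> generator_sums G d" using f(3) uM leading_terms_subset R(2) by blast
    then have "x \<in> M d" using f(1) x S(2) by (auto simp: leading_terms_def)
    moreover have "x \<in> keys f" using x by (simp add: leading_def)
    ultimately have "x = u" using f(3) by blast
    then show ?thesis using x by simp
  qed
  have "initial_support f w' = {u}"
    if f: "f \<in> J" "u \<in> keys f" "keys f \<subseteq> insert u (generator_sums G d - M d)" for f
  proof -
    note l' = lead[OF f R'(1) M_def] and l = lead[OF f R]
    \<comment> \<open>A second initial term \<open>b\<close> at \<open>w\<close> survives the
      elimination of \<open>u\<close> between \<open>f\<close> and \<open>g\<close>, because
      \<open>g\<close> has its unique minimum at \<open>u\<close>. So the minimum of the eliminant
      is at most the value of \<open>b\<close>. Its leading term, however, lies in
      \<open>M d\<close> and outside \<open>f\<close>, hence comes from \<open>g\<close>, where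
      values are strictly larger.\<close>
    have single: "b = u" if b: "b \<in> initial_support f w" for b
    proof (rule ccontr)
      assume "b \<noteq> u"
      have ug: "u \<in> keys g" using g(3) by (auto simp: initial_support_def)
      from tropical_ideal_eliminate[OF tropical zero_mem f(1) g(1) f(2) ug]
      obtain h c where h: "h \<in> J" "lookup f u = Fin c * lookup g u" "u \<notin> keys h"
        "\<forall>e. min (lookup f e) (Fin c * lookup g e) \<le> lookup h e"
        "\<forall>e. lookup f e \<noteq> Fin c * lookup g e \<longrightarrow> lookup h e = min (lookup f e) (Fin c * lookup g e)"
        "keys h \<subseteq> keys f \<union> keys g"
        by (elim bexE exE conjE) simp
      define tg where "tg e = Fin c * term_value g w e" for e
      have tg: "tg e = (Fin c * lookup g e) * Fin (e \<bullet> w)" for e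
        by (simp add: tg_def term_value_def mult.assoc)
      have tu: "term_value f w u = tg u" using h(2) by (simp add: tg term_value_def)
      have gt: "tg u < tg e" if "e \<noteq> u" for e
      proof (cases "e \<in> keys g")
        case True
        then have "e \<notin> initial_support g w" using that g(3) by blast
        then obtain e' where "e' \<in> keys g" "term_value g w e' < term_value g w e"
          using True by (auto simp: initial_support_def not_le)
        moreover have "term_value g w u \<le> term_value g w e'"
          using g(3) \<open>e' \<in> keys g\<close> by (auto simp: initial_support_def)
        ultimately show ?thesis unfolding tg_def by simp
      next
        case False
        then have "tg e = Infty" by (simp add: tg_def)
        moreover have "tg u \<noteq> Infty" using ug by (simp add: tg_def)
        ultimately show ?thesis by (simp add: less_le)
      qed
      have min_u: "term_value f w u \<le> term_value f w e" for e
      proof (cases "e \<in> keys f")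
        case True
        then show ?thesis using leading_in_initial_support[OF l] by (auto simp: initial_support_def)
      next
        case False
        then have "term_value f w e = Infty" by (simp only: term_value_eq_Infty not_False_eq_True)
        then show ?thesis by (simp only: trop_le_Infty)
      qed
      have fb: "term_value f w b = tg u"
        using b f(2) min_u[of b] tu by (auto simp: initial_support_def)
      have "term_value f w b < tg b"
        unfolding fb by (rule gt[OF \<open>b \<noteq> u\<close>])
      then have lt: "lookup f b < Fin c * lookup g b"
        unfolding tg term_value_def by (simp only: times_Fin_less_iff)
      then have hb: "lookup h b = lookup f b"
        using h(5)[rule_format, of b] less_imp_le[OF lt] less_imp_neq[OF lt] by (simp add: min_def)
      have bf: "b \<in> keys f" using b by (simp add: initial_support_def)
      then have "h \<noteq> 0" using hb by (auto simp: in_keys_trop trop_zero_eq)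
      then obtain x where x: "leading h w R x" using leading_exists[OF _ R(1)] by blast
      have "keys h \<subseteq> generator_sums G d" using h(6) f(3) g(2) uM leading_terms_subset R(2) by blast
      then have "x \<in> M d" using h(1) x R(2) by (auto simp: leading_terms_def)
      moreover have "x \<in> keys h" using x by (simp add: leading_def)
      ultimately have xf: "x \<notin> keys f" using f(3) h(3) by blast
      have bh: "b \<in> keys h" using bf hb by (simp add: in_keys_trop)
      have "term_value h w x \<le> term_value h w b"
        using leading_in_initial_support[OF x] bh by (auto simp: initial_support_def)
      also have "\<dots> = tg u" using hb fb by (simp add: term_value_def)
      also have "\<dots> < tg x" using gt[of x] h(3) \<open>x \<in> keys h\<close> by metis
      also have "\<dots> \<le> term_value h w x"
      proof -
        have "min Infty (Fin c * lookup g x) \<le> lookup h x"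
          using h(4)[rule_format, of x] not_in_keys_trop[OF xf] by (simp only:)
        then have "Fin c * lookup g x \<le> lookup h x"
          by (simp only: min_absorb2 trop_le_Infty)
        then show ?thesis unfolding tg term_value_def by (simp only: times_Fin_le_iff)
      qed
      finally show False by simp
    qed
    have "b = u" if b: "b \<in> initial_support f w'" for b
    proof (rule ccontr)
      assume "b \<noteq> u"
      \<comment> \<open>From \<open>w\<close> to \<open>w'\<close> the value of \<open>b\<close>
        drops relative to that of \<open>u\<close>, from strictly above to at most equal. This
        contradicts \<open>R' u b\<close>, which forces \<open>w' - w\<close> to pair with
        \<open>b\<close> at least as much as with \<open>u\<close>.\<close>
      then have "R' u b" using leading_least[OF l' b] by blast
      then have c: "(w' - w) \<bullet> u \<le> (w' - w) \<bullet> b"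
        using R'(2)[of b u] asym[of u b] by (meson not_le)
      have bf: "b \<in> keys f" using b by (simp add: initial_support_def)
      obtain x y where xy: "lookup f u = Fin x" "lookup f b = Fin y"
        using f(2) bf by (cases "lookup f u"; cases "lookup f b") (auto simp: in_keys_trop)
      have "term_value f w' b \<le> term_value f w' u"
        using b f(2) by (auto simp: initial_support_def)
      then have 1: "y + b \<bullet> w' \<le> x + u \<bullet> w'" by (simp add: term_value_def xy)
      have "b \<notin> initial_support f w" using single \<open>b \<noteq> u\<close> by blast
      then obtain e where e: "e \<in> keys f" "term_value f w e < term_value f w b"
        using bf by (auto simp: initial_support_def not_le)
      have "term_value f w u \<le> term_value f w e"
        using leading_in_initial_support[OF l] e by (auto simp: initial_support_def)
      with e have "term_value f w u < term_value f w b" by simp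
      then have 2: "x + u \<bullet> w < y + b \<bullet> w" by (simp add: term_value_def xy)
      show False using 1 2 c unfolding inner_commute[of "w' - w"] by (simp add: inner_diff_right)
    qed
    moreover have "u \<in> initial_support f w'" using leading_in_initial_support[OF l'] .
    ultimately show ?thesis by blast
  qed
  then show ?thesis using M uM by blast
qed

theorem finite_tropical_basis:
  "\<exists>F. finite F \<and> tropical_basis J F"
proof -
  let ?S = initial_ideals_at
  \<comment> \<open>These are the weights to be detected. One witness is fixed for each of the
    finitely many values of \<open>?S\<close> on \<open>bad\<close>.\<close>
  define bad where "bad = {w. \<exists>g\<in>J. \<exists>u. initial_support g w = {u}}"
  have fin: "finite (?S ` bad)"
  proof (rule finite_subset)
    show "?S ` bad \<subseteq> Pow initial_ideals"
      by (auto simp: initial_ideals_at_def initial_ideals_def)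
    show "finite (Pow initial_ideals)" using finite_initial_ideals by simp
  qed
  have "\<forall>T\<in>?S ` bad. \<exists>w g u d. ?S w = T \<and> g \<in> J \<and> initial_support g w = {u} \<and> keys g \<subseteq> generator_sums G d"
  proof
    fix T assume "T \<in> ?S ` bad"
    then obtain w g u where wgu: "T = ?S w" "g \<in> J" "initial_support g w = {u}" by (auto simp: bad_def)
    moreover obtain d where "keys g \<subseteq> generator_sums G d"
      using generator_sums_exhaust[OF zero_in_gens, of "keys g"] tropical_ideal_subset[OF tropical wgu(2)]
      unfolding generated by auto
    ultimately show "\<exists>w g u d. ?S w = T \<and> g \<in> J \<and> initial_support g w = {u} \<and> keys g \<subseteq> generator_sums G d"
      by blast
  qed
  then obtain w g u d where wgud: "\<And>T. T \<in> ?S ` bad \<Longrightarrow> ?S (w T) = T \<and> g T \<in> J \<and>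
      initial_support (g T) (w T) = {u T} \<and> keys (g T) \<subseteq> generator_sums G (d T)"
    by metis
  define rel where "rel M T f \<longleftrightarrow> f \<in> J \<and> u T \<in> keys f \<and> keys f \<subseteq> insert (u T) (generator_sums G (d T) - M (d T))"
    for M T f
  \<comment> \<open>The relation is chosen from the pair \<open>(M, T)\<close> alone and not from
    the weight at which it is used; this makes the basis finite.\<close>
  define F where "F = (\<lambda>(M, T). SOME f. rel M T f) ` {(M, T) \<in> initial_ideals \<times> ?S ` bad. \<exists>f. rel M T f}"
  have finF: "finite F"
    unfolding F_def using finite_initial_ideals fin
    by (intro finite_imageI) (auto intro: finite_subset[of _ "initial_ideals \<times> ?S ` bad"])
  have subF: "F \<subseteq> J - {0}"
  proof
    fix f assume "f \<in> F"
    then obtain M T where "f = (SOME f. rel M T f)" "\<exists>f. rel M T f" by (auto simp: F_def)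
    then have "rel M T f" by (metis someI_ex)
    then show "f \<in> J - {0}" by (auto simp: rel_def)
  qed
  have basis: "\<exists>f'\<in>F. \<not> min_attained_twice f' v"
    if f: "f \<in> J - {0}" "\<not> min_attained_twice f v" for v f
  proof -
    have "v \<in> bad" using f by (auto simp: bad_def not_min_attained_twice_iff)
    then have Tb: "?S v \<in> ?S ` bad" by blast
    define T where "T = ?S v"
    note wT = wgud[OF Tb, folded T_def]
    from initial_monomial_transfer[of v "w T" "g T" "d T" "u T"] wT
    obtain M where M: "M \<in> ?S v" "u T \<in> M (d T)" "\<And>f. rel M T f \<Longrightarrow> initial_support f v = {u T}"
      by (auto simp: T_def rel_def)
    then obtain R where R: "monomial_order R" "M = leading_terms v R" by (auto simp: initial_ideals_at_def)
    have ex: "\<exists>f. rel M T f"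
      using reduced_relation[OF R(1), of "u T" v "d T"] M(2) R(2) by (auto simp: rel_def leading_def)
    define f' where "f' = (SOME f. rel M T f)"
    have "rel M T f'" unfolding f'_def using ex by (rule someI_ex)
    then have "initial_support f' v = {u T}" "f' \<noteq> 0"
      using M(3) by (auto simp: rel_def)
    then have "\<not> min_attained_twice f' v" by (simp add: not_min_attained_twice_iff)
    moreover have "f' \<in> F"
      unfolding F_def using R Tb ex
      by (intro image_eqI[of _ _ "(M, T)"]) (auto simp: f'_def T_def initial_ideals_def)
    ultimately show ?thesis by blast
  qed
  show ?thesis
    unfolding tropical_basis_def by (rule exI[of _ F]) (intro conjI allI ballI impI finF subF basis)
qed

end

section \<open>Lattices and rational cones\<close>

definition additive_subgroup :: "'a::ab_group_add set \<Rightarrow> bool" where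
  "additive_subgroup L \<longleftrightarrow> 0 \<in> L \<and> (\<forall>x\<in>L. \<forall>y\<in>L. x + y \<in> L) \<and> (\<forall>x\<in>L. - x \<in> L)"

lemma additive_subgroup_of_nat:
  fixes L :: "'a::real_vector set"
  assumes "additive_subgroup L" "x \<in> L" shows "of_nat n *\<^sub>R x \<in> L"
  using assms by (induction n) (auto simp: additive_subgroup_def scaleR_add_left)

lemma additive_subgroup_of_int:
  fixes L :: "'a::real_vector set"
  assumes "additive_subgroup L" "x \<in> L" shows "of_int n *\<^sub>R x \<in> L"
proof (cases n)
  case (nonneg k)
  then show ?thesis using additive_subgroup_of_nat[OF assms, of k] by simp
next
  case (neg k)
  then show ?thesis
    using additive_subgroup_of_nat[OF assms, of "Suc k"] assms(1)
    by (simp add: additive_subgroup_def del: of_nat_Suc)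
qed

lemma additive_subgroup_sum:
  assumes "additive_subgroup L" "\<And>x. x \<in> A \<Longrightarrow> f x \<in> L" shows "(\<Sum>x\<in>A. f x) \<in> L"
  using assms(2) by (induction A rule: infinite_finite_induct) (use assms(1) in \<open>auto simp: additive_subgroup_def\<close>)

lemma additive_subgroup_dual_lattice: "additive_subgroup (dual_lattice N)"
  unfolding additive_subgroup_def dual_lattice_def
  by (auto simp: span_0 span_add span_neg inner_add_left)

lemma additive_subgroup_perp_lattice: "additive_subgroup (perp_lattice N \<sigma>)"
  using additive_subgroup_dual_lattice[of N]
  unfolding additive_subgroup_def perp_lattice_def by (auto simp: inner_add_left)

lemma perp_lattice_subset_dual: "perp_lattice N \<sigma> \<subseteq> dual_lattice N"
  by (auto simp: perp_lattice_def)

lemma lattice_basis_expand: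
  assumes "lattice_basis B N" "w \<in> N"
  shows "\<exists>c. w = (\<Sum>b\<in>B. of_int (c b) *\<^sub>R b)"
proof -
  have "N = {\<Sum>b\<in>B. of_int (c b) *\<^sub>R b |c. True}"
    using assms(1) by (simp only: lattice_basis_def)
  then show ?thesis using assms(2) by (simp only: mem_Collect_eq simp_thms)
qed

lemma lattice_basis_combination:
  assumes "lattice_basis B N" shows "(\<Sum>b\<in>B. of_int (c b) *\<^sub>R b) \<in> N"
proof -
  have N: "N = {\<Sum>b\<in>B. of_int (c b) *\<^sub>R b |c. True}"
    using assms by (simp only: lattice_basis_def)
  show ?thesis unfolding N by (rule CollectI, rule exI[of _ c]) simp
qed

lemma lattice_basis_mem:
  assumes "lattice_basis B N" "b \<in> B" shows "b \<in> N"
proof -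
  have fin: "finite B" using assms by (auto simp: lattice_basis_def independent_imp_finite)
  have "(\<Sum>x\<in>B. of_int (if x = b then 1 else 0) *\<^sub>R x) = b"
    using fin assms(2) by (simp add: if_distrib[of of_int] if_distrib[of "\<lambda>c. c *\<^sub>R _"] cong: if_cong)
  then show ?thesis using lattice_basis_combination[OF assms(1), of "\<lambda>x. if x = b then 1 else 0"] by metis
qed

lemma lattice_basis_span:
  assumes "lattice_basis B N" shows "span B = span N"
proof (rule antisym)
  show "span B \<subseteq> span N" using lattice_basis_mem[OF assms] by (intro span_mono) blast
  have "N \<subseteq> span B"
  proof
    fix w assume "w \<in> N"
    then obtain c where c: "w = (\<Sum>b\<in>B. of_int (c b) *\<^sub>R b)" using lattice_basis_expand[OF assms] by blast
    show "w \<in> span B" unfolding c by (rule span_sum, rule span_scale, rule span_base)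
  qed
  then show "span N \<subseteq> span B" by (rule span_minimal) (rule subspace_span)
qed

lemma additive_subgroup_lattice: "is_lattice N \<Longrightarrow> additive_subgroup N"
proof -
  assume "is_lattice N"
  then obtain B where N: "N = {\<Sum>b\<in>B. of_int (c b) *\<^sub>R b |c. True}"
    by (auto simp: is_lattice_def lattice_basis_def)
  show ?thesis
    unfolding additive_subgroup_def
  proof (intro conjI ballI)
    show "0 \<in> N" unfolding N by (rule CollectI, rule exI[of _ "\<lambda>_. 0"]) simp
    fix x assume "x \<in> N"
    then obtain c where c: "x = (\<Sum>b\<in>B. of_int (c b) *\<^sub>R b)" unfolding N by blast
    show "- x \<in> N" unfolding N c
      by (rule CollectI, rule exI[of _ "\<lambda>b. - c b"]) (simp add: sum_negf)
    fix y assume "y \<in> N"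
    then obtain d where d: "y = (\<Sum>b\<in>B. of_int (d b) *\<^sub>R b)" unfolding N by blast
    show "x + y \<in> N" unfolding N c d
      by (rule CollectI, rule exI[of _ "\<lambda>b. c b + d b"]) (simp add: sum.distrib scaleR_add_left)
  qed
qed

text \<open>The difference lies in \<open>span B\<close> and is orthogonal to all of it, hence to
  itself.\<close>

lemma orthogonal_span_eq:
  fixes u :: "'v::euclidean_space"
  assumes "u \<in> span B" "u' \<in> span B" "\<And>b. b \<in> B \<Longrightarrow> u \<bullet> b = u' \<bullet> b"
  shows "u = u'"
proof -
  have "span B \<subseteq> {x. (u - u') \<bullet> x = 0}"
    by (rule span_minimal[OF _ subspace_hyperplane]) (use assms(3) in \<open>auto simp: inner_diff_left\<close>)
  moreover have "u - u' \<in> span B" using assms by (simp add: span_diff)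
  ultimately have "(u - u') \<bullet> (u - u') = 0" by blast
  then show ?thesis by simp
qed

text \<open>The integer pairings with a lattice basis determine a dual vector, and the
  Cauchy-Schwarz inequality leaves finitely many values for each.\<close>

lemma finite_bounded_dual_lattice:
  assumes "is_lattice N"
  shows "finite {u \<in> dual_lattice N. norm u \<le> r}"
proof -
  obtain B where B: "lattice_basis B N" using assms by (auto simp: is_lattice_def)
  have fin: "finite B" using B by (auto simp: lattice_basis_def independent_imp_finite)
  let ?U = "{u \<in> dual_lattice N. norm u \<le> r}"
  define \<phi> where "\<phi> u = restrict (\<lambda>b. \<lfloor>u \<bullet> b\<rfloor>) B" for u :: 'a
  have int: "of_int \<lfloor>u \<bullet> b\<rfloor> = u \<bullet> b" if "u \<in> dual_lattice N" "b \<in> B" for u b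
    using that lattice_basis_mem[OF B] by (auto simp: dual_lattice_def)
  have "inj_on \<phi> ?U"
  proof (rule inj_onI)
    fix u u' assume u: "u \<in> ?U" and u': "u' \<in> ?U" and eq: "\<phi> u = \<phi> u'"
    have "u \<bullet> b = u' \<bullet> b" if b: "b \<in> B" for b
    proof -
      have "\<lfloor>u \<bullet> b\<rfloor> = \<lfloor>u' \<bullet> b\<rfloor>" using fun_cong[OF eq, of b] b by (simp add: \<phi>_def)
      moreover have "u \<in> dual_lattice N" "u' \<in> dual_lattice N" using u u' by auto
      ultimately show ?thesis using int[OF _ b, of u] int[OF _ b, of u'] by metis
    qed
    then show "u = u'"
      using u u' lattice_basis_span[OF B] by (intro orthogonal_span_eq[of u B u']) (auto simp: dual_lattice_def)
  qed
  moreover have "\<phi> ` ?U \<subseteq> (\<Pi>\<^sub>E b\<in>B. {- \<lceil>r * norm b\<rceil> .. \<lceil>r * norm b\<rceil>})"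
  proof
    fix f assume "f \<in> \<phi> ` ?U"
    then obtain u where u: "u \<in> dual_lattice N" "norm u \<le> r" "f = \<phi> u" by auto
    have "\<lfloor>u \<bullet> b\<rfloor> \<in> {- \<lceil>r * norm b\<rceil> .. \<lceil>r * norm b\<rceil>}" if b: "b \<in> B" for b
    proof -
      have "\<bar>u \<bullet> b\<bar> \<le> norm u * norm b" by (rule Cauchy_Schwarz_ineq2)
      also have "\<dots> \<le> r * norm b" using u(2) by (simp add: mult_right_mono)
      finally show ?thesis using int[OF u(1) b] by (simp add: abs_le_iff) linarith
    qed
    then show "f \<in> (\<Pi>\<^sub>E b\<in>B. {- \<lceil>r * norm b\<rceil> .. \<lceil>r * norm b\<rceil>})"
      unfolding u(3) \<phi>_def by auto
  qed
  moreover have "finite (\<Pi>\<^sub>E b\<in>B. {- \<lceil>r * norm b\<rceil> .. \<lceil>r * norm b\<rceil>})"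
    by (rule finite_PiE[OF fin]) simp
  ultimately show ?thesis by (meson finite_imageD finite_subset)
qed

lemma additive_subgroup_sum_mset:
  fixes L :: "'a::ab_group_add set"
  assumes "additive_subgroup L" "set_mset \<mu> \<subseteq> L" shows "\<Sum>\<^sub># \<mu> \<in> L"
  using assms(2) by (induction \<mu>) (use assms(1) in \<open>auto simp: additive_subgroup_def\<close>)

text \<open>Rounding down coordinates with respect to a maximal independent subset \<open>B\<close>
  splits a member of \<open>L\<close> into an integer combination of \<open>B\<close> and one of
  finitely many remainders. Negatives join the generators because only sums are allowed.\<close>

lemma finitely_generated_subgroup:
  assumes N: "is_lattice N" and L: "additive_subgroup L" "L \<subseteq> dual_lattice N"
  shows "\<exists>G. finite G \<and> 0 \<in> G \<and> L = {\<Sum>\<^sub># \<mu> |\<mu>. set_mset \<mu> \<subseteq> G}"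
proof -
  obtain B where B: "B \<subseteq> L" "independent B" "L \<subseteq> span B"
    using maximal_independent_subset[of L] by metis
  have fin: "finite B" using B(2) by (rule independent_imp_finite)
  \<comment> \<open>The remainders have coordinates of absolute value at most one, so this bounds
    their norms.\<close>
  define r where "r = (\<Sum>b\<in>B. norm b)"
  define G where "G = insert 0 (B \<union> uminus ` B \<union> {u \<in> L. norm u \<le> r})"
  let ?M = "{\<Sum>\<^sub># \<mu> |\<mu>. set_mset \<mu> \<subseteq> G}"
  have "finite {u \<in> L. norm u \<le> r}"
    by (rule finite_subset[OF _ finite_bounded_dual_lattice[OF N, of r]]) (use L(2) in auto)
  then have "finite G" using fin by (simp add: G_def)
  have GL: "G \<subseteq> L" using L(1) B(1) by (auto simp: G_def additive_subgroup_def)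
  have M0: "0 \<in> ?M" by (rule CollectI, rule exI[of _ "{#}"]) simp
  have Madd: "x + y \<in> ?M" if xy: "x \<in> ?M" "y \<in> ?M" for x y
  proof -
    obtain \<mu> \<nu> where "x = \<Sum>\<^sub># \<mu>" "y = \<Sum>\<^sub># \<nu>" "set_mset \<mu> \<subseteq> G" "set_mset \<nu> \<subseteq> G" using xy by blast
    then show ?thesis by (intro CollectI exI[of _ "\<mu> + \<nu>"]) auto
  qed
  have MG: "g \<in> ?M" if "g \<in> G" for g
    using that by (intro CollectI exI[of _ "{#g#}"]) auto
  have Mnat: "of_nat n *\<^sub>R g \<in> ?M" if "g \<in> G" for n g
  proof (induction n)
    case (Suc n)
    then have "g + of_nat n *\<^sub>R g \<in> ?M" using Madd MG[OF that] by blast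
    then show ?case by (simp add: scaleR_add_left)
  qed (use M0 in simp)
  have Mint: "of_int n *\<^sub>R b \<in> ?M" if b: "b \<in> B" for n b
  proof (cases n)
    case (nonneg k)
    then show ?thesis using Mnat[of b k] b by (simp add: G_def)
  next
    case (neg k)
    then show ?thesis using Mnat[of "- b" "Suc k"] b by (simp add: G_def del: of_nat_Suc)
  qed
  have Msum: "(\<Sum>b\<in>A. f b) \<in> ?M" if "finite A" "\<And>b. b \<in> A \<Longrightarrow> f b \<in> ?M" for A and f :: "'a \<Rightarrow> 'a"
    using that by (induction A rule: finite_induct) (use M0 Madd in auto)
  have "L \<subseteq> ?M"
  proof
    fix x assume x: "x \<in> L"
    then have "x \<in> span B" using B(3) by blast
    then obtain c where c: "x = (\<Sum>b\<in>B. c b *\<^sub>R b)"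
      unfolding span_finite[OF fin] by blast
    define y where "y = (\<Sum>b\<in>B. of_int \<lfloor>c b\<rfloor> *\<^sub>R b)"
    have yM: "y \<in> ?M" unfolding y_def by (rule Msum[OF fin]) (rule Mint)
    have yL: "y \<in> L" unfolding y_def
      by (rule additive_subgroup_sum[OF L(1)], rule additive_subgroup_of_int[OF L(1)]) (use B in blast)
    have "x - y \<in> L" using x yL L(1) unfolding additive_subgroup_def by (metis diff_conv_add_uminus)
    moreover have "norm (x - y) \<le> r"
    proof -
      have "x - y = (\<Sum>b\<in>B. (c b - of_int \<lfloor>c b\<rfloor>) *\<^sub>R b)"
        by (simp add: c y_def sum_subtractf scaleR_diff_left)
      also have "norm \<dots> \<le> (\<Sum>b\<in>B. norm ((c b - of_int \<lfloor>c b\<rfloor>) *\<^sub>R b))" by (rule norm_sum)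
      also have "\<dots> \<le> r" unfolding r_def
      proof (rule sum_mono)
        fix b
        have "\<bar>c b - of_int \<lfloor>c b\<rfloor>\<bar> \<le> 1" by linarith
        then show "norm ((c b - of_int \<lfloor>c b\<rfloor>) *\<^sub>R b) \<le> norm b"
          by (simp add: mult_left_le_one_le)
      qed
      finally show ?thesis .
    qed
    ultimately have "x - y \<in> ?M" by (intro MG) (simp add: G_def)
    from Madd[OF this yM] show "x \<in> ?M" by simp
  qed
  moreover have "?M \<subseteq> L" using additive_subgroup_sum_mset[OF L(1)] GL by blast
  ultimately show ?thesis
    using \<open>finite G\<close> by (intro exI[of _ G] conjI) (auto simp: G_def)
qed

section \<open>Real spans of lattices and rational approximation\<close>

lemma dual_vector_exists:
  fixes B :: "'v::euclidean_space set"
  assumes "independent B" "b \<in> B"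
  shows "\<exists>d\<in>span B. \<forall>b'\<in>B. d \<bullet> b' = (if b' = b then 1 else 0)"
proof -
  obtain f where f: "linear f" "\<forall>x\<in>B. f x = (if x = b then 1 else 0 :: real)"
    using linear_independent_extend[OF assms(1), of "\<lambda>x. if x = b then 1 else 0"] by blast
  define a where "a = adjoint f 1"
  have a: "a \<bullet> x = f x" for x
    using adjoint_works[OF f(1), of x 1] by (simp add: a_def inner_commute)
  \<comment> \<open>The vector \<open>a\<close> represents the coordinate functional; discarding its
    part orthogonal to \<open>span B\<close> changes no pairing with \<open>B\<close>.\<close>
  obtain y z where yz: "y \<in> span B" "\<And>w. w \<in> span B \<Longrightarrow> orthogonal z w" "a = y + z"
    using orthogonal_subspace_decomp_exists[of B a] by metis
  have "y \<bullet> b' = a \<bullet> b'" if "b' \<in> B" for b'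
    using yz(2)[OF span_base[OF that]] by (simp add: yz(3) inner_add_left orthogonal_def)
  then show ?thesis using yz(1) a f(2) by (intro bexI[of _ y]) auto
qed

text \<open>The vectors dual to a lattice basis lie in the dual lattice, and every vector of the
  span expands in them.\<close>

lemma span_dual_lattice:
  assumes "is_lattice N" shows "span (dual_lattice N) = span N"
proof (rule antisym)
  show "span (dual_lattice N) \<subseteq> span N"
    by (rule span_minimal) (auto simp: dual_lattice_def)
  obtain B where B: "lattice_basis B N" using assms by (auto simp: is_lattice_def)
  have ind: "independent B" and fin: "finite B"
    using B by (auto simp: lattice_basis_def independent_imp_finite)
  have "\<forall>b\<in>B. \<exists>d\<in>span B. \<forall>b'\<in>B. d \<bullet> b' = (if b' = b then 1 else 0)"
    using dual_vector_exists[OF ind] by blast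
  then obtain d where d: "\<And>b. b \<in> B \<Longrightarrow> d b \<in> span B"
     "\<And>b b'. b \<in> B \<Longrightarrow> b' \<in> B \<Longrightarrow> d b \<bullet> b' = (if b' = b then 1 else 0)"
    by metis
  have dM: "d b \<in> dual_lattice N" if b: "b \<in> B" for b
  proof -
    have "d b \<bullet> w \<in> \<int>" if "w \<in> N" for w
    proof -
      obtain c where c: "w = (\<Sum>b\<in>B. of_int (c b) *\<^sub>R b)" using lattice_basis_expand[OF B \<open>w \<in> N\<close>] by blast
      have "d b \<bullet> w = (\<Sum>b'\<in>B. of_int (c b') * (if b' = b then 1 else 0))"
        unfolding c inner_sum_right by (rule sum.cong) (simp_all add: d(2)[OF b])
      also have "\<dots> = of_int (\<Sum>b'\<in>B. c b' * (if b' = b then 1 else 0))"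
        unfolding of_int_sum of_int_mult by (rule sum.cong) auto
      finally show ?thesis by (simp only: Ints_of_int)
    qed
    then show ?thesis using d(1)[OF b] lattice_basis_span[OF B] by (auto simp: dual_lattice_def)
  qed
  show "span N \<subseteq> span (dual_lattice N)"
  proof
    fix u assume "u \<in> span N"
    then have u: "u \<in> span B" using lattice_basis_span[OF B] by simp
    have "u = (\<Sum>b\<in>B. (u \<bullet> b) *\<^sub>R d b)"
    proof (rule orthogonal_span_eq[OF u])
      show "(\<Sum>b\<in>B. (u \<bullet> b) *\<^sub>R d b) \<in> span B" by (intro span_sum span_scale d(1))
      fix b assume b: "b \<in> B"
      have "(\<Sum>b'\<in>B. (u \<bullet> b') *\<^sub>R d b') \<bullet> b = (\<Sum>b'\<in>B. if b = b' then u \<bullet> b' else 0)"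
        unfolding inner_sum_left by (rule sum.cong) (simp_all add: d(2)[OF _ b])
      also have "\<dots> = u \<bullet> b" using b sum.delta'[OF fin, of b "\<lambda>b'. u \<bullet> b'"] by simp
      finally show "u \<bullet> b = (\<Sum>b'\<in>B. (u \<bullet> b') *\<^sub>R d b') \<bullet> b" by simp
    qed
    also have "\<dots> \<in> span (dual_lattice N)" by (intro span_sum span_scale span_base dM)
    finally show "u \<in> span (dual_lattice N)" .
  qed
qed

text \<open>Rational linear equations have a rational basis of solutions. If a lattice vector
  \<open>k\<close> pairs nontrivially with the new \<open>s\<close>, the map taking \<open>x\<close>
  to \<open>(k \<bullet> s) *\<^sub>R x - (x \<bullet> s) *\<^sub>R k\<close> makes the pairing with
  \<open>s\<close> vanish, preserves the lattice, and multiplies \<open>u\<close> by a nonzero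
  scalar.\<close>

lemma span_perp_lattice:
  assumes N: "is_lattice N" and S: "finite S" "S \<subseteq> N"
    and u: "u \<in> span N" "\<And>s. s \<in> S \<Longrightarrow> u \<bullet> s = 0"
  shows "u \<in> span (perp_lattice N S)"
  using S u(2)
proof (induction S rule: finite_induct)
  case empty
  then show ?case using u(1) span_dual_lattice[OF N] by (simp add: perp_lattice_def)
next
  case (insert s S)
  let ?L = "perp_lattice N S"
  have mem: "l \<in> perp_lattice N (insert s S)" if "l \<in> ?L" "l \<bullet> s = 0" for l
    using that by (auto simp: perp_lattice_def)
  have uL: "u \<in> span ?L" using insert by auto
  show ?case
  proof (cases "\<forall>l\<in>?L. l \<bullet> s = 0")
    case True
    then have "?L \<subseteq> perp_lattice N (insert s S)" using mem by blast
    then show ?thesis using uL span_mono by blast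
  next
    case False
    then obtain k where k: "k \<in> ?L" "k \<bullet> s \<noteq> 0" by blast
    have int: "l \<bullet> s \<in> \<int>" if "l \<in> ?L" for l
      using that insert.prems by (auto simp: perp_lattice_def dual_lattice_def)
    have base: "(k \<bullet> s) *\<^sub>R l - (l \<bullet> s) *\<^sub>R k \<in> span (perp_lattice N (insert s S))" if l: "l \<in> ?L" for l
    proof -
      obtain a b where ab: "k \<bullet> s = of_int a" "l \<bullet> s = of_int b"
        using int[OF k(1)] int[OF l] by (auto elim!: Ints_cases)
      have "of_int a *\<^sub>R l \<in> ?L" "of_int b *\<^sub>R k \<in> ?L"
        using additive_subgroup_of_int[OF additive_subgroup_perp_lattice] l k by auto
      then have "of_int a *\<^sub>R l - of_int b *\<^sub>R k \<in> ?L"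
        using additive_subgroup_perp_lattice[of N S] unfolding additive_subgroup_def
        by (metis diff_conv_add_uminus)
      then have "(k \<bullet> s) *\<^sub>R l - (l \<bullet> s) *\<^sub>R k \<in> ?L" by (simp only: ab)
      then show ?thesis by (intro span_base mem) (auto simp: inner_diff_left)
    qed
    let ?K = "{x. (k \<bullet> s) *\<^sub>R x - (x \<bullet> s) *\<^sub>R k \<in> span (perp_lattice N (insert s S))}"
    have "span ?L \<subseteq> ?K"
    proof (rule span_minimal)
      show "subspace ?K"
      proof (rule subspaceI)
        fix x y c
        assume x: "x \<in> ?K"
        show "c *\<^sub>R x \<in> ?K"
        proof -
          have "(k \<bullet> s) *\<^sub>R (c *\<^sub>R x) - ((c *\<^sub>R x) \<bullet> s) *\<^sub>R k = c *\<^sub>R ((k \<bullet> s) *\<^sub>R x - (x \<bullet> s) *\<^sub>R k)"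
            by (simp add: scaleR_diff_right mult.commute)
          then show ?thesis using x span_scale by (metis (mono_tags, lifting) mem_Collect_eq)
        qed
        assume y: "y \<in> ?K"
        have "(k \<bullet> s) *\<^sub>R (x + y) - ((x + y) \<bullet> s) *\<^sub>R k =
            ((k \<bullet> s) *\<^sub>R x - (x \<bullet> s) *\<^sub>R k) + ((k \<bullet> s) *\<^sub>R y - (y \<bullet> s) *\<^sub>R k)"
          by (simp add: algebra_simps inner_add_left)
        then show "x + y \<in> ?K"
          using x y span_add by (metis (mono_tags, lifting) mem_Collect_eq)
      qed (simp add: span_0)
    qed (use base in auto)
    with uL have "(k \<bullet> s) *\<^sub>R u - (u \<bullet> s) *\<^sub>R k \<in> span (perp_lattice N (insert s S))" by blast
    then have "(k \<bullet> s) *\<^sub>R u \<in> span (perp_lattice N (insert s S))" using insert.prems by simp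
    from span_scale[OF this, of "1 / (k \<bullet> s)"] show ?thesis using k(2) by simp
  qed
qed

text \<open>Supplies the perturbation of a real supporting vector to a rational one. The limits of
  rational multiples of members of \<open>L\<close> form a subspace.\<close>

lemma span_subgroup_approx:
  fixes L :: "'v::real_normed_vector set"
  assumes L: "additive_subgroup L" and u: "u \<in> span L" and e: "e > 0"
  shows "\<exists>l\<in>L. \<exists>k>0. norm (u - l /\<^sub>R of_nat k) < e"
proof -
  let ?T = "{x. \<forall>e>0. \<exists>l\<in>L. \<exists>k>(0::nat). norm (x - l /\<^sub>R of_nat k) < e}"
  have add: "x + y \<in> ?T" if x: "x \<in> ?T" and y: "y \<in> ?T" for x y
  proof (intro CollectI allI impI)
    fix e :: real assume e: "e > 0"
    obtain l k where l: "l \<in> L" "k > 0" "norm (x - l /\<^sub>R of_nat k) < e / 2"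
      using x e by (auto dest!: spec[of _ "e / 2"])
    obtain l' k' where l': "l' \<in> L" "k' > 0" "norm (y - l' /\<^sub>R of_nat k') < e / 2"
      using y e by (auto dest!: spec[of _ "e / 2"])
    define m where "m = of_nat k' *\<^sub>R l + of_nat k *\<^sub>R l'"
    have mL: "m \<in> L"
      using additive_subgroup_of_nat[OF L l(1), of k'] additive_subgroup_of_nat[OF L l'(1), of k] L
      by (simp add: m_def additive_subgroup_def)
    have "m /\<^sub>R of_nat (k * k') = l /\<^sub>R of_nat k + l' /\<^sub>R of_nat k'"
      using l(2) l'(2) by (simp add: m_def scaleR_add_right field_simps)
    then have "x + y - m /\<^sub>R of_nat (k * k') = (x - l /\<^sub>R of_nat k) + (y - l' /\<^sub>R of_nat k')"
      by (simp only: add_diff_add)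
    then have "norm (x + y - m /\<^sub>R of_nat (k * k')) \<le>
        norm (x - l /\<^sub>R of_nat k) + norm (y - l' /\<^sub>R of_nat k')"
      by (simp only: norm_triangle_ineq)
    then have "norm (x + y - m /\<^sub>R of_nat (k * k')) < e" using l(3) l'(3) by linarith
    then show "\<exists>l\<in>L. \<exists>k>(0::nat). norm (x + y - l /\<^sub>R of_nat k) < e"
      using mL l(2) l'(2) by (intro bexI[of _ m] exI[of _ "k * k'"]) auto
  qed
  have scale: "c *\<^sub>R x \<in> ?T" if x: "x \<in> ?T" for c x
  proof (intro CollectI allI impI)
    fix e :: real assume e: "e > 0"
    \<comment> \<open>Half of the error \<open>e\<close> is reserved for approximating
      \<open>x\<close>, the other half for replacing the scalar by a rational one. The added ones
      keep the denominators positive.\<close>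
    define d where "d = e / (2 * (\<bar>c\<bar> + 1))"
    have d: "d > 0" using e by (simp add: d_def add_nonneg_pos)
    obtain l k where l: "l \<in> L" "k > 0" "norm (x - l /\<^sub>R of_nat k) < d"
      using x d by blast
    define y where "y = l /\<^sub>R of_nat k"
    define e' where "e' = e / (2 * (norm y + 1))"
    have ny: "norm y + 1 > 0" by (simp add: add_nonneg_pos)
    have e': "e' > 0" using e ny by (simp add: e'_def)
    obtain q where q: "q \<in> \<rat>" "c < q" "q < c + e'" using Rats_dense_in_real[of c "c + e'"] e' by auto
    then obtain a b where ab: "b > 0" "q = of_int a / of_int b" by (auto elim: Rats_cases')
    define m where "m = of_int a *\<^sub>R l"
    have mL: "m \<in> L" unfolding m_def by (rule additive_subgroup_of_int[OF L l(1)])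
    have "q *\<^sub>R y = m /\<^sub>R of_nat (nat b * k)"
      using ab l(2) by (simp add: y_def m_def field_simps)
    moreover have "norm (c *\<^sub>R x - q *\<^sub>R y) < e"
    proof -
      have "c *\<^sub>R x - q *\<^sub>R y = c *\<^sub>R (x - y) + (c - q) *\<^sub>R y" by (simp add: algebra_simps)
      then have "norm (c *\<^sub>R x - q *\<^sub>R y) \<le> \<bar>c\<bar> * norm (x - y) + \<bar>c - q\<bar> * norm y"
        using norm_triangle_ineq[of "c *\<^sub>R (x - y)" "(c - q) *\<^sub>R y"] by simp
      also have "\<bar>c\<bar> * norm (x - y) \<le> \<bar>c\<bar> * d"
        using l(3) by (intro mult_left_mono) (auto simp: y_def)
      also have "\<bar>c\<bar> * d < (\<bar>c\<bar> + 1) * d" using d by simp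
      also have "(\<bar>c\<bar> + 1) * d = e / 2" by (simp add: d_def field_simps)
      also have "\<bar>c - q\<bar> * norm y \<le> e' * (norm y + 1)"
        using q e' by (intro mult_mono) auto
      also have "e' * (norm y + 1) = e / 2" using ny by (simp add: e'_def field_simps)
      finally show ?thesis by simp
    qed
    ultimately show "\<exists>l\<in>L. \<exists>k>(0::nat). norm (c *\<^sub>R x - l /\<^sub>R of_nat k) < e"
      using mL ab l(2) by (intro bexI[of _ m] exI[of _ "nat b * k"]) auto
  qed
  have base: "L \<subseteq> ?T"
  proof (intro subsetI CollectI allI impI)
    fix x and e :: real assume "x \<in> L" "e > 0"
    then show "\<exists>l\<in>L. \<exists>k>(0::nat). norm (x - l /\<^sub>R of_nat k) < e"
      by (intro bexI[of _ x] exI[of _ 1]) auto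
  qed
  have "0 \<in> ?T" using base L by (auto simp: additive_subgroup_def)
  then have "subspace ?T" using add scale by (intro subspaceI)
  then have "span L \<subseteq> ?T" by (rule span_minimal[OF base])
  then show ?thesis using u e by blast
qed

section \<open>Rational cones, their faces and their extremal rays\<close>

lemma convex_cone_hull_nonneg:
  assumes "x \<in> convex_cone hull S" "\<And>s. s \<in> S \<Longrightarrow> 0 \<le> a \<bullet> s" shows "0 \<le> a \<bullet> x"
proof -
  have "convex_cone hull S \<subseteq> {x. a \<bullet> x \<ge> 0}"
    by (rule hull_minimal) (use assms(2) in \<open>auto simp: convex_cone_halfspace_ge\<close>)
  then show ?thesis using assms(1) by auto
qed

lemma polyhedron_convex_cone_hull_finite:
  fixes S :: "'v::euclidean_space set"
  assumes "finite S" shows "polyhedron (convex_cone hull S)"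
proof -
  have "convex_cone hull (convex hull S) = convex_cone hull S"
    by (metis convex_hull_subset_convex_cone_hull hull_mono hull_hull hull_subset subset_antisym)
  then show ?thesis
    using polyhedron_convex_cone_hull_polytope[of "convex hull S"] assms by (simp add: polytope_convex_hull)
qed

text \<open>A nonzero point \<open>x\<close> of the face is the midpoint of \<open>0\<close> and
  \<open>2 *\<^sub>R x\<close>.\<close>

lemma face_of_cone_contains_0:
  assumes "F face_of C" "convex_cone C" "F \<noteq> {}" shows "0 \<in> F"
proof -
  obtain x where x: "x \<in> F" using assms(3) by blast
  then have xC: "x \<in> C" using assms(1) face_of_imp_subset by blast
  show ?thesis
  proof (cases "x = 0")
    case False
    have "x \<in> open_segment 0 (2 *\<^sub>R x)"
      using False by (auto simp: in_segment intro!: exI[of _ "1/2"])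
    moreover have "0 \<in> C" "2 *\<^sub>R x \<in> C"
      using assms(2) xC by (auto simp: convex_cone_contains_0 convex_cone_scaleR)
    ultimately show ?thesis using assms(1) x unfolding face_of_def by blast
  qed (use x in simp)
qed

text \<open>A real vector exposing the face is perturbed to a lattice vector. Staying in the real
  span of \<open>perp_lattice N S0\<close> keeps it zero on the generators in the face, and a small
  error keeps it positive on the finitely many others.\<close>

lemma rational_supporting_vector:
  assumes N: "is_lattice N" and S: "finite S" "S \<subseteq> N" and C: "C = convex_cone hull S"
    and F: "F face_of C" "F \<noteq> {}"
  shows "\<exists>u\<in>dual_monoid N C. F = {x\<in>C. u \<bullet> x = 0}"
proof -
  have "F exposed_face_of C"
    using exposed_face_of_polyhedron polyhedron_convex_cone_hull_finite[OF S(1)] F(1) C by blast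
  then obtain a b where ab: "C \<subseteq> {x. a \<bullet> x \<le> b}" "F = C \<inter> {x. a \<bullet> x = b}"
    by (auto simp: exposed_face_of_def)
  have "0 \<in> F" using face_of_cone_contains_0[OF F(1) _ F(2)] C convex_cone_convex_cone_hull by blast
  then have b: "b = 0" using ab by auto
  \<comment> \<open>The exposing functional is at most \<open>b = 0\<close> on the cone, so its
    negative is taken and projected to \<open>span N\<close>.\<close>
  obtain y z where yz: "y \<in> span N" "\<And>w. w \<in> span N \<Longrightarrow> orthogonal z w" "- a = y + z"
    using orthogonal_subspace_decomp_exists[of N "- a"] by metis
  have CN: "x \<in> span N" if "x \<in> C" for x
  proof -
    have "C \<subseteq> span N" unfolding C
      by (rule hull_minimal) (use S(2) in \<open>auto intro: span_base convex_cone_span\<close>)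
    then show ?thesis using that by blast
  qed
  have y: "y \<bullet> x = - (a \<bullet> x)" if "x \<in> C" for x
    using yz(2)[OF CN[OF that]] arg_cong[OF yz(3), of "\<lambda>v. v \<bullet> x"]
    by (simp add: inner_add_left orthogonal_def)
  have SC: "S \<subseteq> C" unfolding C by (rule hull_subset)
  have y_ge: "0 \<le> y \<bullet> x" if "x \<in> C" for x using ab(1) y[OF that] b that by auto
  have Fy: "F = {x\<in>C. y \<bullet> x = 0}" using ab(2) y b by auto
  define S0 where "S0 = {s\<in>S. y \<bullet> s = 0}"
  define S1 where "S1 = {s\<in>S. y \<bullet> s > 0}"
  have S01: "S = S0 \<union> S1" using y_ge SC by (force simp: S0_def S1_def)
  have ysp: "y \<in> span (perp_lattice N S0)"
    by (rule span_perp_lattice[OF N]) (use S yz in \<open>auto simp: S0_def\<close>)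
  have "\<exists>e>0. \<forall>s\<in>S1. e * norm s < y \<bullet> s"
  proof -
    have fin: "finite S1" using S(1) by (simp add: S1_def)
    have pos: "\<forall>s\<in>S1. y \<bullet> s > 0" by (simp add: S1_def)
    from fin pos show ?thesis
    proof (induction S1 rule: finite_induct)
      case (insert s T)
      then obtain e where e: "e > 0" "\<forall>s\<in>T. e * norm s < y \<bullet> s" by auto
      define e' where "e' = min e (y \<bullet> s / (norm s + 1))"
      have ns: "norm s + 1 > 0" by (simp add: add_nonneg_pos)
      have "y \<bullet> s > 0" using insert.prems by simp
      then have e'0: "e' > 0" using e(1) ns by (simp add: e'_def)
      have "e' * norm s < e' * (norm s + 1)" using e'0 by simp
      also have "\<dots> \<le> y \<bullet> s / (norm s + 1) * (norm s + 1)"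
        using ns by (intro mult_right_mono) (auto simp: e'_def)
      also have "\<dots> = y \<bullet> s" using ns by simp
      finally have "e' * norm s < y \<bullet> s" .
      moreover have "e' * norm t < y \<bullet> t" if "t \<in> T" for t
      proof -
        have "e' * norm t \<le> e * norm t" by (intro mult_right_mono) (auto simp: e'_def)
        then show ?thesis using e(2) that by force
      qed
      ultimately show ?case using e'0 by blast
    qed (auto intro: exI[of _ 1])
  qed
  then obtain e where e: "e > 0" "\<And>s. s \<in> S1 \<Longrightarrow> e * norm s < y \<bullet> s" by blast
  obtain l k where l: "l \<in> perp_lattice N S0" "k > 0" "norm (y - l /\<^sub>R of_nat k) < e"
    using span_subgroup_approx[OF additive_subgroup_perp_lattice ysp e(1)] by blast
  have l0: "l \<bullet> s = 0" if "s \<in> S0" for s using l(1) that by (auto simp: perp_lattice_def)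
  have l1: "l \<bullet> s > 0" if "s \<in> S1" for s
  proof -
    have "\<bar>(y - l /\<^sub>R of_nat k) \<bullet> s\<bar> \<le> norm (y - l /\<^sub>R of_nat k) * norm s" by (rule Cauchy_Schwarz_ineq2)
    also have "\<dots> \<le> e * norm s" using l(3) by (intro mult_right_mono) auto
    also have "\<dots> < y \<bullet> s" by (rule e(2)[OF that])
    finally have "0 < (l /\<^sub>R of_nat k) \<bullet> s" by (simp add: inner_diff_left)
    then show ?thesis using l(2) by (simp add: zero_less_mult_iff)
  qed
  \<comment> \<open>A multiple of each functional bounds the other on the generators, hence on the
    cone, so both vanish on the same points of it.\<close>
  have comparable: "\<exists>K. \<forall>s\<in>S. f s \<le> K * g s"
    if "\<And>s. s \<in> S0 \<Longrightarrow> f s = 0" "\<And>s. s \<in> S0 \<Longrightarrow> g s = 0" "\<And>s. s \<in> S1 \<Longrightarrow> g s > 0" "\<And>s. s \<in> S1 \<Longrightarrow> f s > 0"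
    for f g :: "'a \<Rightarrow> real"
  proof (intro exI ballI)
    fix s assume s: "s \<in> S"
    have fin: "finite S1" using S(1) by (simp add: S1_def)
    show "f s \<le> (\<Sum>s\<in>S1. f s / g s) * g s"
    proof (cases "s \<in> S0")
      case False
      then have s1: "s \<in> S1" using s S01 by blast
      have "f s / g s \<le> (\<Sum>s\<in>S1. f s / g s)"
        by (rule member_le_sum[OF s1 _ fin]) (use that in \<open>auto simp: less_imp_le\<close>)
      then show ?thesis using that(3)[OF s1] by (simp add: divide_le_eq)
    qed (use that in simp)
  qed
  have lC: "0 \<le> l \<bullet> x" if "x \<in> C" for x
    using that unfolding C by (rule convex_cone_hull_nonneg) (use S01 l0 l1 in force)
  have y0: "y \<bullet> s = 0" if "s \<in> S0" for s using that by (simp add: S0_def)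
  have y1: "y \<bullet> s > 0" if "s \<in> S1" for s using that by (simp add: S1_def)
  obtain K where K: "\<forall>s\<in>S. l \<bullet> s \<le> K * (y \<bullet> s)"
    using comparable[of "\<lambda>s. l \<bullet> s" "\<lambda>s. y \<bullet> s", OF l0 y0 y1 l1] by blast
  obtain K' where K': "\<forall>s\<in>S. y \<bullet> s \<le> K' * (l \<bullet> s)"
    using comparable[of "\<lambda>s. y \<bullet> s" "\<lambda>s. l \<bullet> s", OF y0 l0 l1 y1] by blast
  have KC: "l \<bullet> x \<le> K * (y \<bullet> x)" if "x \<in> C" for x
    using convex_cone_hull_nonneg[of x S "K *\<^sub>R y - l"] that K by (simp add: C inner_diff_left)
  have KC': "y \<bullet> x \<le> K' * (l \<bullet> x)" if "x \<in> C" for x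
    using convex_cone_hull_nonneg[of x S "K' *\<^sub>R l - y"] that K' by (simp add: C inner_diff_left)
  have "F = {x\<in>C. l \<bullet> x = 0}"
    unfolding Fy using KC KC' lC y_ge by (auto intro!: antisym) (metis mult_zero_right)+
  moreover have "l \<in> dual_monoid N C"
    using l(1) lC by (auto simp: dual_monoid_def perp_lattice_def)
  ultimately show ?thesis by blast
qed

text \<open>On generators off the face \<open>u0\<close> takes positive integer values, hence values
  of at least one, and a large multiple of it outweighs \<open>u\<close>. On the face
  \<open>u\<close> is nonnegative already.\<close>

lemma dual_monoid_shift:
  assumes C: "C = convex_cone hull S" "finite S" "S \<subseteq> N"
    and u0: "u0 \<in> dual_monoid N C" and F: "F = {x\<in>C. u0 \<bullet> x = 0}" and u: "u \<in> dual_monoid N F"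
  shows "\<exists>k::nat. u + of_nat k *\<^sub>R u0 \<in> dual_monoid N C"
proof -
  define k where "k = (\<Sum>s\<in>S. nat \<lceil>\<bar>u \<bullet> s\<bar>\<rceil>)"
  have SC: "S \<subseteq> C" unfolding C by (rule hull_subset)
  have "0 \<le> (u + of_nat k *\<^sub>R u0) \<bullet> s" if s: "s \<in> S" for s
  proof (cases "u0 \<bullet> s = 0")
    case True
    then have "s \<in> F" using F s SC by blast
    then show ?thesis using u True by (simp add: dual_monoid_def inner_add_left)
  next
    case False
    have "u0 \<bullet> s \<in> \<int>" "0 \<le> u0 \<bullet> s"
      using u0 s SC C by (auto simp: dual_monoid_def dual_lattice_def)
    then have one: "1 \<le> u0 \<bullet> s" using False by (auto elim!: Ints_cases)
    have "nat \<lceil>\<bar>u \<bullet> s\<bar>\<rceil> \<le> k" unfolding k_def by (rule member_le_sum[OF s _ C(2)]) simp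
    then have "\<bar>u \<bullet> s\<bar> \<le> of_nat k" by linarith
    also have "\<dots> \<le> of_nat k * (u0 \<bullet> s)" using mult_left_mono[OF one, of "of_nat k"] by simp
    finally show ?thesis by (simp add: inner_add_left abs_le_iff)
  qed
  then have "0 \<le> (u + of_nat k *\<^sub>R u0) \<bullet> x" if "x \<in> C" for x
    using that unfolding C by (intro convex_cone_hull_nonneg[of x S])
  moreover have "u + of_nat k *\<^sub>R u0 \<in> dual_lattice N"
    using u u0 additive_subgroup_of_nat[OF additive_subgroup_dual_lattice, of u0 N k]
      additive_subgroup_dual_lattice[of N]
    by (simp add: dual_monoid_def additive_subgroup_def)
  ultimately show ?thesis by (auto simp: dual_monoid_def)
qed

lemma convex_cone_hull_singleton: "convex_cone hull {s} = {c *\<^sub>R s |c. 0 \<le> c}"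
proof (rule antisym)
  have "convex_cone {c *\<^sub>R s |c. 0 \<le> c}"
    unfolding convex_cone_iff
  proof (intro conjI ballI allI impI)
    show "0 \<in> {c *\<^sub>R s |c. 0 \<le> c}" by (rule CollectI, rule exI[of _ 0]) simp
    fix x assume "x \<in> {c *\<^sub>R s |c. 0 \<le> c}"
    then obtain c where c: "x = c *\<^sub>R s" "0 \<le> c" by blast
    show "d *\<^sub>R x \<in> {c *\<^sub>R s |c. 0 \<le> c}" if "0 \<le> d" for d
      using c that by (intro CollectI exI[of _ "d * c"]) simp
    fix y assume "y \<in> {c *\<^sub>R s |c. 0 \<le> c}"
    then obtain d where d: "y = d *\<^sub>R s" "0 \<le> d" by blast
    show "x + y \<in> {c *\<^sub>R s |c. 0 \<le> c}"
      using c d by (intro CollectI exI[of _ "c + d"]) (simp add: scaleR_add_left)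
  qed
  moreover have "s \<in> {c *\<^sub>R s |c. 0 \<le> c}" by (rule CollectI, rule exI[of _ 1]) simp
  ultimately show "convex_cone hull {s} \<subseteq> {c *\<^sub>R s |c. 0 \<le> c}"
    by (intro hull_minimal) auto
  show "{c *\<^sub>R s |c. 0 \<le> c} \<subseteq> convex_cone hull {s}"
    using convex_cone_hull_mul[of s "{s}"] hull_inc[of s "{s}" convex_cone] by blast
qed

text \<open>The sums of this form make up a convex cone containing \<open>s\<close> and
  \<open>T\<close>.\<close>

lemma convex_cone_hull_insert:
  assumes "x \<in> convex_cone hull (insert s T)"
  shows "\<exists>\<alpha>\<ge>0. \<exists>y\<in>convex_cone hull T. x = \<alpha> *\<^sub>R s + y"
proof -
  let ?K = "{x. \<exists>\<alpha>\<ge>0. \<exists>y\<in>convex_cone hull T. x = \<alpha> *\<^sub>R s + y}"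
  have "convex_cone ?K"
  proof (rule convex_cone_iff[THEN iffD2], intro conjI ballI allI impI)
    show "0 \<in> ?K" using convex_cone_hull_contains_0[of T] by (intro CollectI exI[of _ 0] conjI bexI[of _ 0]) auto
    fix x assume "x \<in> ?K"
    then obtain \<alpha> y where 1: "0 \<le> \<alpha>" "y \<in> convex_cone hull T" "x = \<alpha> *\<^sub>R s + y" by blast
    show "c *\<^sub>R x \<in> ?K" if "0 \<le> c" for c
      using 1 that convex_cone_hull_mul[of y T c]
      by (intro CollectI exI[of _ "c * \<alpha>"] conjI bexI[of _ "c *\<^sub>R y"]) (auto simp: scaleR_add_right)
    fix x' assume "x' \<in> ?K"
    then obtain \<beta> z where 2: "0 \<le> \<beta>" "z \<in> convex_cone hull T" "x' = \<beta> *\<^sub>R s + z" by blast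
    show "x + x' \<in> ?K"
      using 1 2 convex_cone_hull_add[of y T z]
      by (intro CollectI exI[of _ "\<alpha> + \<beta>"] conjI bexI[of _ "y + z"]) (auto simp: scaleR_add_left)
  qed
  moreover have "s \<in> ?K"
    using convex_cone_hull_contains_0[of T] by (intro CollectI exI[of _ 1] conjI bexI[of _ 0]) auto
  moreover have "t \<in> ?K" if "t \<in> T" for t
    using hull_inc[OF that, of convex_cone] by (intro CollectI exI[of _ 0] conjI bexI[of _ t]) auto
  then have "T \<subseteq> ?K" by (rule subsetI)
  ultimately have "convex_cone hull (insert s T) \<subseteq> ?K" by (intro hull_minimal) (simp_all only: insert_subset)
  then show ?thesis using assms by blast
qed

text \<open>In a generating set of least size, \<open>s\<close> lies outside the cone of the other
  generators. If an open segment in \<open>C\<close> meets the ray of \<open>s\<close>, the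
  contributions of the others to its ends must cancel, and pointedness makes them zero.\<close>

lemma extremal_generators:
  fixes S :: "'v::real_vector set"
  assumes S: "finite S" and C: "C = convex_cone hull S"
    and pointed: "\<And>x. x \<in> C \<Longrightarrow> - x \<in> C \<Longrightarrow> x = 0"
  shows "\<exists>S'\<subseteq>S. C = convex_cone hull S' \<and> (\<forall>s\<in>S'. s \<noteq> 0 \<and> (convex_cone hull {s}) face_of C)"
proof -
  define P where "P T \<longleftrightarrow> T \<subseteq> S \<and> C = convex_cone hull T" for T
  have "P S" using C by (simp add: P_def)
  then obtain S' where "P S'" and least': "\<forall>T. P T \<longrightarrow> card S' \<le> card T"
    using ex_has_least_nat[of P S card] by blast
  then have S': "S' \<subseteq> S" "C = convex_cone hull S'" by (auto simp: P_def)
  have least: "card S' \<le> card T" if "T \<subseteq> S" "C = convex_cone hull T" for T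
    using least' that by (simp add: P_def)
  have "s \<noteq> 0 \<and> (convex_cone hull {s}) face_of C" if s: "s \<in> S'" for s
  proof -
    define T where "T = S' - {s}"
    have S'T: "S' = insert s T" using s by (auto simp: T_def)
    have TC: "convex_cone hull T \<subseteq> C" unfolding S' by (rule hull_mono) (auto simp: T_def)
    have cone: "convex_cone C" unfolding C by (rule convex_cone_convex_cone_hull)
    have sC: "s \<in> C" unfolding S'(2) by (rule hull_inc[OF s])
    have notin: "s \<notin> convex_cone hull T"
    proof
      assume sT: "s \<in> convex_cone hull T"
      have "C \<subseteq> convex_cone hull T"
        unfolding S'(2) using sT hull_subset[of T convex_cone] S'T
        by (intro hull_minimal convex_cone_convex_cone_hull) auto
      then have "C = convex_cone hull T" using TC by blast
      then have "card S' \<le> card T" using least[of T] S'(1) by (auto simp: T_def)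
      moreover have "card T < card S'"
        unfolding T_def using s S'(1) S by (intro card_Diff1_less) (auto intro: finite_subset)
      ultimately show False by simp
    qed
    then have s0: "s \<noteq> 0" using convex_cone_hull_contains_0[of T] by blast
    have "(convex_cone hull {s}) face_of C"
      unfolding face_of_def
    proof (intro conjI ballI impI)
      show "convex_cone hull {s} \<subseteq> C" unfolding S'(2) by (rule hull_mono) (use s in blast)
      show "convex (convex_cone hull {s})" by (rule convex_convex_cone_hull)
      fix a b x assume a: "a \<in> C" and b: "b \<in> C" and x: "x \<in> convex_cone hull {s}" and seg: "x \<in> open_segment a b"
      obtain c where c: "x = c *\<^sub>R s" using x by (auto simp: convex_cone_hull_singleton)
      obtain t where t: "0 < t" "t < 1" "x = (1 - t) *\<^sub>R a + t *\<^sub>R b" using seg unfolding in_segment by blast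
      obtain \<alpha> a' where a': "0 \<le> \<alpha>" "a' \<in> convex_cone hull T" "a = \<alpha> *\<^sub>R s + a'"
        using convex_cone_hull_insert[of a s T] a[unfolded S'(2) S'T] by blast
      obtain \<beta> b' where b': "0 \<le> \<beta>" "b' \<in> convex_cone hull T" "b = \<beta> *\<^sub>R s + b'"
        using convex_cone_hull_insert[of b s T] b[unfolded S'(2) S'T] by blast
      define y where "y = (1 - t) *\<^sub>R a' + t *\<^sub>R b'"
      \<comment> \<open>Comparing both expressions of \<open>x\<close> gives
        \<open>\<mu> *\<^sub>R s = y\<close>. A positive \<open>\<mu>\<close> would place
        \<open>s\<close> in the cone of \<open>T\<close>; a negative one would place
        \<open>y\<close> and \<open>- y\<close> in \<open>C\<close>.\<close>
      define \<mu> where "\<mu> = c - (1 - t) * \<alpha> - t * \<beta>"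
      have ta: "(1 - t) *\<^sub>R a' \<in> convex_cone hull T" and tb: "t *\<^sub>R b' \<in> convex_cone hull T"
        using t a' b' by (auto intro: convex_cone_hull_mul)
      then have yT: "y \<in> convex_cone hull T" unfolding y_def by (rule convex_cone_hull_add)
      have mu: "\<mu> *\<^sub>R s = y"
        using t(3) unfolding c a'(3) b'(3) \<mu>_def y_def by (simp add: algebra_simps)
      have "\<mu> = 0"
      proof (rule ccontr)
        assume "\<mu> \<noteq> 0"
        then consider "\<mu> > 0" | "\<mu> < 0" by linarith
        then show False
        proof cases
          case 1
          then have "s = (1 / \<mu>) *\<^sub>R y" by (simp flip: mu)
          then have "s \<in> convex_cone hull T" using 1 yT convex_cone_hull_mul[of y T "1 / \<mu>"] by simp
          then show False using notin by blast
        next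
          case 2
          have "- y = (- \<mu>) *\<^sub>R s" by (simp flip: mu)
          then have "- y \<in> C" using 2 sC convex_cone_scaleR[OF cone, of "- \<mu>" s] by simp
          moreover have "y \<in> C" using yT TC by blast
          ultimately have "y = 0" using pointed by blast
          then show False using mu s0 2 by simp
        qed
      qed
      then have y0: "y = 0" using mu by simp
      have neg: "t *\<^sub>R b' = - ((1 - t) *\<^sub>R a')"
        using y0 unfolding y_def by (simp only: add_eq_0_iff)
      have "(1 - t) *\<^sub>R a' = 0"
        by (rule pointed) (use ta tb TC neg in auto)
      then have z: "a' = 0" "b' = 0" using t neg by auto
      show "a \<in> convex_cone hull {s}" "b \<in> convex_cone hull {s}"
        using a' b' z by (auto simp: convex_cone_hull_singleton)
    qed
    then show ?thesis using s0 by blast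
  qed
  then show ?thesis using S' by blast
qed

lemma dim_convex_cone_hull_singleton: "s \<noteq> 0 \<Longrightarrow> dim (convex_cone hull {s}) = 1"
proof -
  assume s: "s \<noteq> 0"
  have "span (convex_cone hull {s}) = span {s}"
  proof (rule antisym)
    show "span (convex_cone hull {s}) \<subseteq> span {s}"
      by (rule span_minimal) (auto simp: convex_cone_hull_singleton intro: span_scale span_base)
    show "span {s} \<subseteq> span (convex_cone hull {s})" by (rule span_mono) (rule hull_subset)
  qed
  then have "dim (convex_cone hull {s}) = dim {s}" by (metis dim_span)
  then show ?thesis using s dim_eq_card_independent[of "{s}"] by simp
qed

section \<open>Cones of a fan and their dual monoids\<close>

lemma fan_cone: "fan N \<Sigma> \<Longrightarrow> \<sigma> \<in> \<Sigma> \<Longrightarrow> strongly_convex_rational_cone N \<sigma>"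
  by (simp add: fan_def)

lemma fan_face: "fan N \<Sigma> \<Longrightarrow> \<sigma> \<in> \<Sigma> \<Longrightarrow> \<tau> face_of \<sigma> \<Longrightarrow> \<tau> \<noteq> {} \<Longrightarrow> \<tau> \<in> \<Sigma>"
  by (simp add: fan_def)

lemma fan_cone_generators:
  assumes "fan N \<Sigma>" "\<sigma> \<in> \<Sigma>"
  obtains S where "finite S" "S \<subseteq> N" "\<sigma> = convex_cone hull S"
  using fan_cone[OF assms] unfolding strongly_convex_rational_cone_def by blast

lemma fan_cone_zero: "fan N \<Sigma> \<Longrightarrow> \<sigma> \<in> \<Sigma> \<Longrightarrow> 0 \<in> \<sigma>"
  by (metis fan_cone_generators convex_cone_hull_contains_0)

lemma dual_monoid_antimono: "\<tau> \<subseteq> \<sigma> \<Longrightarrow> dual_monoid N \<sigma> \<subseteq> dual_monoid N \<tau>"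
  by (auto simp: dual_monoid_def)

lemma perp_lattice_antimono: "\<tau> \<subseteq> \<sigma> \<Longrightarrow> perp_lattice N \<sigma> \<subseteq> perp_lattice N \<tau>"
  by (auto simp: perp_lattice_def)

lemma perp_lattice_subset_dual_monoid: "perp_lattice N \<sigma> \<subseteq> dual_monoid N \<sigma>"
  by (auto simp: dual_monoid_def perp_lattice_def)

lemma dual_monoid_add: "a \<in> dual_monoid N \<sigma> \<Longrightarrow> b \<in> dual_monoid N \<sigma> \<Longrightarrow> a + b \<in> dual_monoid N \<sigma>"
  using additive_subgroup_dual_lattice[of N]
  by (auto simp: dual_monoid_def additive_subgroup_def inner_add_left)

text \<open>Both pairings with a point of \<open>\<tau>\<close> are nonnegative, so their sum
  vanishes only if both do. This makes points at infinity monoid homomorphisms and lets truncation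
  respect products.\<close>

lemma perp_lattice_add_iff:
  assumes "a \<in> dual_monoid N \<sigma>" "b \<in> dual_monoid N \<sigma>" "\<tau> \<subseteq> \<sigma>"
  shows "a + b \<in> perp_lattice N \<tau> \<longleftrightarrow> a \<in> perp_lattice N \<tau> \<and> b \<in> perp_lattice N \<tau>"
proof -
  have "a + b \<in> dual_lattice N" "a \<in> dual_lattice N" "b \<in> dual_lattice N"
    using assms dual_monoid_add[OF assms(1,2)] by (auto simp: dual_monoid_def)
  moreover have "(a + b) \<bullet> w = 0 \<longleftrightarrow> a \<bullet> w = 0 \<and> b \<bullet> w = 0" if "w \<in> \<tau>" for w
  proof -
    have "0 \<le> a \<bullet> w" "0 \<le> b \<bullet> w" using assms that by (auto simp: dual_monoid_def)
    then show ?thesis by (auto simp: inner_add_left)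
  qed
  ultimately show ?thesis by (auto simp: perp_lattice_def)
qed

section \<open>The strata of an ideal of the Cox semiring\<close>

lemma lookup_filter_terms: "lookup (filter_terms P f) e = (if P e then lookup f e else 0)"
  by (cases "e \<in> keys f") (auto simp: filter_terms_def lookup_mapp in_keys_iff)

lemma keys_filter_terms: "keys (filter_terms P f) = {e\<in>keys f. P e}"
  by (auto simp: in_keys_iff lookup_filter_terms split: if_splits)

lemma filter_terms_add: "filter_terms P (f + g) = filter_terms P f + filter_terms P g"
  by (rule poly_mapping_eqI) (simp add: lookup_filter_terms lookup_add)

lemma filter_terms_id: "(\<And>e. e \<in> keys f \<Longrightarrow> P e) \<Longrightarrow> filter_terms P f = f"
  by (rule poly_mapping_eqI) (auto simp: lookup_filter_terms in_keys_iff)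

lemma filter_terms_zero: "(\<And>e. e \<in> keys f \<Longrightarrow> \<not> P e) \<Longrightarrow> filter_terms P f = 0"
  by (rule poly_mapping_eqI) (auto simp: lookup_filter_terms in_keys_iff)

lemma poly_over_add: "f \<in> poly_over A \<Longrightarrow> g \<in> poly_over A \<Longrightarrow> f + g \<in> poly_over A"
  by (auto simp: poly_over_def keys_add_trop)

lemma poly_over_mult:
  assumes "\<And>a b. a \<in> A \<Longrightarrow> b \<in> A \<Longrightarrow> a + b \<in> A" "f \<in> poly_over A" "g \<in> poly_over A"
  shows "f * g \<in> poly_over A"
  using keys_mult[of f g] assms unfolding poly_over_def by blast

text \<open>A factor with exponents in \<open>perp_lattice N \<sigma>\<close> moves no term into or
  out of it, so discarded terms stay discarded.\<close>

lemma perp_truncation_mult: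
  assumes r: "keys r \<subseteq> perp_lattice N \<sigma>" and f: "keys f \<subseteq> dual_monoid N \<sigma>"
  shows "filter_terms (\<lambda>u. u \<in> perp_lattice N \<sigma>) (r * f) = r * filter_terms (\<lambda>u. u \<in> perp_lattice N \<sigma>) f"
proof -
  let ?P = "\<lambda>u. u \<in> perp_lattice N \<sigma>"
  have split: "f = filter_terms ?P f + filter_terms (\<lambda>u. \<not> ?P u) f"
    by (rule poly_mapping_eqI) (simp add: lookup_filter_terms lookup_add)
  have "filter_terms ?P (r * filter_terms ?P f) = r * filter_terms ?P f"
  proof (rule filter_terms_id)
    fix e assume "e \<in> keys (r * filter_terms ?P f)"
    then obtain a b where "e = a + b" "a \<in> keys r" "b \<in> keys (filter_terms ?P f)"
      using keys_mult[of r "filter_terms ?P f"] by auto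
    then show "?P e"
      using r additive_subgroup_perp_lattice[of N \<sigma>] by (auto simp: additive_subgroup_def keys_filter_terms)
  qed
  moreover have "filter_terms ?P (r * filter_terms (\<lambda>u. \<not> ?P u) f) = 0"
  proof (rule filter_terms_zero)
    fix e assume "e \<in> keys (r * filter_terms (\<lambda>u. \<not> ?P u) f)"
    then obtain a b where ab: "e = a + b" "a \<in> keys r" "b \<in> keys (filter_terms (\<lambda>u. \<not> ?P u) f)"
      using keys_mult[of r "filter_terms (\<lambda>u. \<not> ?P u) f"] by auto
    then have "a \<in> dual_monoid N \<sigma>" "b \<in> dual_monoid N \<sigma>" "\<not> ?P b"
      using r f perp_lattice_subset_dual_monoid[of N \<sigma>] by (auto simp: keys_filter_terms)
    then show "\<not> ?P e" using perp_lattice_add_iff[of a N \<sigma> b \<sigma>] ab by auto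
  qed
  moreover have "r * f = r * filter_terms ?P f + r * filter_terms (\<lambda>u. \<not> ?P u) f"
    using arg_cong[OF split, of "\<lambda>x. r * x"] by (simp only: distrib_left)
  ultimately show ?thesis by (simp add: filter_terms_add)
qed

text \<open>Elimination is carried out on lifts in \<open>J\<close> and then truncated. Truncation
  alters no coefficient at an exponent in \<open>perp_lattice N \<sigma>\<close>, where all of
  \<open>E\<close> lies.\<close>

lemma tropical_ideal_truncation:
  assumes J: "tropical_ideal (dual_monoid N \<sigma>) J"
  shows "tropical_ideal (perp_lattice N \<sigma>) (filter_terms (\<lambda>u. u \<in> perp_lattice N \<sigma>) ` J)"
proof -
  let ?P = "\<lambda>u. u \<in> perp_lattice N \<sigma>"
  let ?t = "filter_terms ?P"
  have ideal: "semiring_ideal (poly_over (dual_monoid N \<sigma>)) J"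
    using J by (simp add: tropical_ideal_def)
  have "semiring_ideal (poly_over (perp_lattice N \<sigma>)) (?t ` J)"
    unfolding semiring_ideal_def
  proof (intro conjI ballI)
    show "?t ` J \<subseteq> poly_over (perp_lattice N \<sigma>)" by (auto simp: poly_over_def keys_filter_terms)
    show "?t ` J \<noteq> {}" using ideal by (auto simp: semiring_ideal_def)
    fix f' assume "f' \<in> ?t ` J"
    then obtain f where f: "f \<in> J" "f' = ?t f" by blast
    show "r * f' \<in> ?t ` J" if r: "r \<in> poly_over (perp_lattice N \<sigma>)" for r
    proof -
      have rk: "keys r \<subseteq> perp_lattice N \<sigma>" using r by (simp add: poly_over_def)
      have "r * f \<in> J"
        by (rule tropical_ideal_mult[OF J f(1)]) (use rk perp_lattice_subset_dual_monoid in blast)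
      moreover have "?t (r * f) = r * f'"
        unfolding f(2) by (rule perp_truncation_mult[OF rk tropical_ideal_subset[OF J f(1)]])
      ultimately show ?thesis by (metis imageI)
    qed
    fix g' assume "g' \<in> ?t ` J"
    then obtain g where g: "g \<in> J" "g' = ?t g" by blast
    have "f + g \<in> J" using ideal f g by (simp add: semiring_ideal_def)
    then show "f' + g' \<in> ?t ` J" unfolding f g by (metis filter_terms_add imageI)
  qed
  moreover have "\<exists>h \<in> ?t ` J \<inter> poly_over E. lookup h e = Infty \<and>
      (\<forall>e'\<in>E. min (lookup f e') (lookup g e') \<le> lookup h e' \<and>
        (lookup f e' \<noteq> lookup g e' \<longrightarrow> lookup h e' = min (lookup f e') (lookup g e')))"
    if E: "finite E" "E \<subseteq> perp_lattice N \<sigma>" and f: "f \<in> ?t ` J \<inter> poly_over E" and g: "g \<in> ?t ` J \<inter> poly_over E"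
      and e: "e \<in> E" "lookup f e = lookup g e" "lookup f e \<noteq> Infty" for E f g e
  proof -
    obtain F where F: "F \<in> J" "f = ?t F" using f by blast
    obtain G where G: "G \<in> J" "g = ?t G" using g by blast
    have lf: "lookup f x = lookup F x" and lg: "lookup g x = lookup G x" if "?P x" for x
      using that by (simp_all add: F G lookup_filter_terms)
    have eP: "?P e" using e E by blast
    have eF: "e \<in> keys F" and eG: "e \<in> keys G"
      using e lf[OF eP] lg[OF eP] by (auto simp: in_keys_trop)
    have "0 \<in> dual_monoid N \<sigma>"
      using additive_subgroup_dual_lattice[of N] by (simp add: dual_monoid_def additive_subgroup_def)
    from tropical_ideal_eliminate[OF J this F(1) G(1) eF eG]
    obtain H c where H: "H \<in> J" "lookup F e = Fin c * lookup G e" "e \<notin> keys H"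
      "\<forall>e. min (lookup F e) (Fin c * lookup G e) \<le> lookup H e"
      "\<forall>e. lookup F e \<noteq> Fin c * lookup G e \<longrightarrow> lookup H e = min (lookup F e) (Fin c * lookup G e)"
      "keys H \<subseteq> keys F \<union> keys G"
      by (elim bexE exE conjE) simp
    \<comment> \<open>The coefficients at \<open>e\<close> agree already, so the scaling is trivial
      and the bounds hold for \<open>f\<close> and \<open>g\<close> themselves.\<close>
    have "c = 0"
      using H(2) e lf[OF eP] lg[OF eP] by (cases "lookup G e") auto
    then have c: "Fin c * x = x" for x by (cases x) auto
    have lh: "lookup (?t H) x = lookup H x" if "?P x" for x
      using that by (simp add: lookup_filter_terms)
    have keysE: "keys f \<subseteq> E" "keys g \<subseteq> E" using f g by (auto simp: poly_over_def)
    have "keys (?t H) \<subseteq> E"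
    proof
      fix x assume "x \<in> keys (?t H)"
      then have x: "?P x" "x \<in> keys F \<or> x \<in> keys G" using H(6) by (auto simp: keys_filter_terms)
      then have "x \<in> keys f \<or> x \<in> keys g" by (auto simp: F G keys_filter_terms)
      then show "x \<in> E" using keysE by blast
    qed
    then have mem: "?t H \<in> ?t ` J \<inter> poly_over E" using H(1) by (simp add: poly_over_def)
    show ?thesis
    proof (intro bexI[OF _ mem] conjI ballI impI)
      show "lookup (?t H) e = Infty" using H(3) lh[OF eP] by (simp add: in_keys_trop)
      fix x assume "x \<in> E"
      then have xP: "?P x" using E by blast
      show "min (lookup f x) (lookup g x) \<le> lookup (?t H) x"
        using H(4)[rule_format, of x] unfolding lf[OF xP] lg[OF xP] lh[OF xP] c .
      assume "lookup f x \<noteq> lookup g x"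
      then show "lookup (?t H) x = min (lookup f x) (lookup g x)"
        using H(5)[rule_format, of x] unfolding lf[OF xP] lg[OF xP] lh[OF xP] c by blast
    qed
  qed
  ultimately show ?thesis unfolding tropical_ideal_def by blast
qed

section \<open>Localizations of the Cox semiring\<close>

lemma cox_semiring_one: "1 \<in> cox_semiring m"
  by (auto simp: cox_semiring_def poly_over_def)

lemma cox_semiring_add: "f \<in> cox_semiring m \<Longrightarrow> g \<in> cox_semiring m \<Longrightarrow> f + g \<in> cox_semiring m"
  unfolding cox_semiring_def by (rule poly_over_add)

lemma cox_semiring_mult: "f \<in> cox_semiring m \<Longrightarrow> g \<in> cox_semiring m \<Longrightarrow> f * g \<in> cox_semiring m"
  unfolding cox_semiring_def
proof (rule poly_over_mult)
  fix a b :: exponent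
  assume a: "a \<in> {e. keys e \<subseteq> {1..m} \<and> (\<forall>i. 0 \<le> lookup e i)}" and b: "b \<in> {e. keys e \<subseteq> {1..m} \<and> (\<forall>i. 0 \<le> lookup e i)}"
  have "keys (a + b) \<subseteq> {1..m}" using keys_add[of a b] a b by blast
  then show "a + b \<in> {e. keys e \<subseteq> {1..m} \<and> (\<forall>i. 0 \<le> lookup e i)}" using a b by (simp add: lookup_add)
qed

lemma cox_semiring_power: "f \<in> cox_semiring m \<Longrightarrow> f ^ k \<in> cox_semiring m"
  by (induction k) (auto simp: cox_semiring_one cox_semiring_mult)

lemma cox_semiring_prod_var: "C \<subseteq> {1..m} \<Longrightarrow> (\<Prod>i\<in>C. var i) \<in> cox_semiring m"
proof (induction C rule: infinite_finite_induct)
  case (insert i C)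
  have "var i \<in> cox_semiring m"
    using insert.prems by (auto simp: var_def cox_semiring_def poly_over_def lookup_single when_def)
  then show ?case using insert by (auto simp: cox_semiring_mult)
qed (auto simp: cox_semiring_one)

text \<open>Makes the localization itself an ideal above \<open>I\<close>, so that the ideal
  generated by \<open>I\<close> cannot leave it.\<close>

lemma localization_ideal:
  assumes "x \<in> cox_semiring m"
  shows "semiring_ideal (localization (cox_semiring m) x) (localization (cox_semiring m) x)"
  unfolding semiring_ideal_def
proof (intro conjI ballI order.refl)
  let ?R = "localization (cox_semiring m) x"
  have "1 \<in> ?R" unfolding localization_def by (rule CollectI, rule exI[of _ 0]) (simp add: cox_semiring_one)
  then show "?R \<noteq> {}" by blast
  fix f g assume "f \<in> ?R" "g \<in> ?R"
  then obtain k l where k: "x ^ k * f \<in> cox_semiring m" and l: "x ^ l * g \<in> cox_semiring m"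
    by (auto simp: localization_def)
  have "x ^ (k + l) * (f + g) = x ^ l * (x ^ k * f) + x ^ k * (x ^ l * g)"
    by (simp add: power_add algebra_simps)
  then have "x ^ (k + l) * (f + g) \<in> cox_semiring m"
    using k l assms by (simp add: cox_semiring_add cox_semiring_mult cox_semiring_power)
  then show "f + g \<in> ?R" unfolding localization_def by blast
next
  let ?R = "localization (cox_semiring m) x"
  fix f g assume "f \<in> ?R" "g \<in> ?R"
  then obtain k l where k: "x ^ k * f \<in> cox_semiring m" and l: "x ^ l * g \<in> cox_semiring m"
    by (auto simp: localization_def)
  have "x ^ (k + l) * (f * g) = (x ^ k * f) * (x ^ l * g)"
    by (simp add: power_add algebra_simps)
  then have "x ^ (k + l) * (f * g) \<in> cox_semiring m"
    using k l by (simp add: cox_semiring_mult)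
  then show "f * g \<in> ?R" unfolding localization_def by blast
qed

lemma subset_localization: "cox_semiring m \<subseteq> localization (cox_semiring m) x"
  unfolding localization_def by (auto intro: exI[of _ 0])

lemma prod_var_power_eq_single:
  assumes "finite C"
  shows "\<exists>a. (\<Prod>j\<in>C. var j) ^ k = Poly_Mapping.single a (Fin 0) \<and> (\<forall>i. i \<notin> C \<longrightarrow> lookup a i = 0)"
proof -
  have one: "(1 :: trop) = Fin 0" by (rule one_trop_def)
  have "\<exists>a. (\<Prod>j\<in>C. var j) = Poly_Mapping.single a 1 \<and> (\<forall>i. i \<notin> C \<longrightarrow> lookup a i = 0)"
    using assms
  proof (induction C rule: finite_induct)
    case empty
    show ?case by (intro exI[of _ 0]) simp
  next
    case (insert j C)
    then obtain a where "(\<Prod>j\<in>C. var j) = Poly_Mapping.single a 1" "\<forall>i. i \<notin> C \<longrightarrow> lookup a i = 0" by blast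
    then show ?case using insert
      by (intro exI[of _ "Poly_Mapping.single j 1 + a"]) (auto simp: var_def mult_single lookup_add lookup_single when_def)
  qed
  then obtain a where a: "(\<Prod>j\<in>C. var j) = Poly_Mapping.single a 1" "\<forall>i. i \<notin> C \<longrightarrow> lookup a i = 0" by blast
  have "\<exists>b. (Poly_Mapping.single a 1 :: laurent) ^ k = Poly_Mapping.single b 1 \<and> (\<forall>i. i \<notin> C \<longrightarrow> lookup b i = 0)"
  proof (induction k)
    case 0
    show ?case by (intro exI[of _ 0]) simp
  next
    case (Suc k)
    then obtain b where b: "(Poly_Mapping.single a 1 :: laurent) ^ k = Poly_Mapping.single b 1"
      "\<forall>i. i \<notin> C \<longrightarrow> lookup b i = 0" by blast
    have "(Poly_Mapping.single a 1 :: laurent) ^ Suc k = Poly_Mapping.single (a + b) 1"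
      by (simp add: b(1) mult_single)
    moreover have "\<forall>i. i \<notin> C \<longrightarrow> lookup (a + b) i = 0" using a(2) b(2) by (simp add: lookup_add)
    ultimately show ?case by blast
  qed
  then show ?thesis by (simp only: a(1) one)
qed

text \<open>The monomial that clears denominators has exponent zero at \<open>i\<close>, so
  exponents at \<open>i\<close> are those of a polynomial.\<close>

lemma localization_nonneg:
  assumes f: "f \<in> localization (cox_semiring m) (\<Prod>j\<in>{1..m} - C. var j)" and e: "e \<in> keys f" and i: "i \<in> C"
  shows "0 \<le> lookup e i"
proof -
  obtain k where k: "(\<Prod>j\<in>{1..m} - C. var j) ^ k * f \<in> cox_semiring m"
    using f by (auto simp: localization_def)
  obtain a where a: "(\<Prod>j\<in>{1..m} - C. var j) ^ k = Poly_Mapping.single a (Fin 0)" "\<forall>i. i \<notin> {1..m} - C \<longrightarrow> lookup a i = 0"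
    using prod_var_power_eq_single[of "{1..m} - C" k] by auto
  have "a + e \<in> keys (Poly_Mapping.single a (Fin 0) * f)" using e by (simp add: keys_single_times)
  then have "0 \<le> lookup (a + e) i" using k unfolding a(1) cox_semiring_def poly_over_def by blast
  then show ?thesis using a(2) i by (simp add: lookup_add)
qed

text \<open>The smaller set \<open>C\<close> inverts more variables, and the additional factor lies
  in the Cox semiring.\<close>

lemma localization_mono:
  assumes C: "C \<subseteq> D"
  shows "localization (cox_semiring m) (\<Prod>j\<in>{1..m} - D. var j) \<subseteq>
    localization (cox_semiring m) (\<Prod>j\<in>{1..m} - C. var j)"
proof
  fix f assume "f \<in> localization (cox_semiring m) (\<Prod>j\<in>{1..m} - D. var j)"
  then obtain k where k: "(\<Prod>j\<in>{1..m} - D. var j) ^ k * f \<in> cox_semiring m" by (auto simp: localization_def)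
  let ?E = "({1..m} - C) - ({1..m} - D)"
  have "(\<Prod>j\<in>{1..m} - C. var j) = (\<Prod>j\<in>?E. var j) * (\<Prod>j\<in>{1..m} - D. var j)"
    using C by (intro prod.subset_diff) auto
  then have "(\<Prod>j\<in>{1..m} - C. var j) ^ k * f = (\<Prod>j\<in>?E. var j) ^ k * ((\<Prod>j\<in>{1..m} - D. var j) ^ k * f)"
    by (simp add: power_mult_distrib mult.assoc)
  moreover have "(\<Prod>j\<in>?E. var j) ^ k \<in> cox_semiring m"
    by (intro cox_semiring_power cox_semiring_prod_var) auto
  ultimately have "(\<Prod>j\<in>{1..m} - C. var j) ^ k * f \<in> cox_semiring m"
    using k by (simp add: cox_semiring_mult)
  then show "f \<in> localization (cox_semiring m) (\<Prod>j\<in>{1..m} - C. var j)" by (auto simp: localization_def)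
qed

section \<open>Exponents and the rows of the Cox matrix\<close>

locale cox_fan =
  fixes N :: "'v::euclidean_space set" and \<Sigma> :: "'v set set" and v :: "nat \<Rightarrow> 'v"
  assumes lattice: "is_lattice N" and fan: "fan N \<Sigma>" and cox: "cox_matrix N \<Sigma> v"
begin

abbreviation "m \<equiv> num_vars N \<Sigma>"

lemma num_rays_le: "num_rays \<Sigma> \<le> m"
  by (simp add: num_vars_def)

lemma ray_index:
  assumes "\<rho> \<in> fan_rays \<Sigma>"
  shows "\<exists>i\<in>{1..num_rays \<Sigma>}. v i \<in> \<rho> \<and> v i \<in> N \<and> v i \<noteq> 0"
proof -
  obtain r where r: "bij_betw r {1..num_rays \<Sigma>} (fan_rays \<Sigma>)"
    "\<forall>i\<in>{1..num_rays \<Sigma>}. first_lattice_point N (r i) (v i)"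
    using cox unfolding cox_matrix_def by blast
  then obtain i where i: "i \<in> {1..num_rays \<Sigma>}" "\<rho> = r i"
    using assms unfolding bij_betw_def by blast
  then show ?thesis using r(2) by (intro bexI[of _ i]) (auto simp: first_lattice_point_def)
qed

lemma row_mem_lattice:
  assumes i: "i \<in> {1..m}" shows "v i \<in> N"
proof (cases "i \<le> num_rays \<Sigma>")
  case True
  then show ?thesis using cox i unfolding cox_matrix_def first_lattice_point_def by auto
next
  case False
  then have i': "i \<in> {num_rays \<Sigma> + 1..m}" using i by auto
  obtain N' N'' where N': "is_lattice N'" "lattice_basis (v ` {num_rays \<Sigma> + 1..m}) N''"
    "N = {a + b |a b. a \<in> N' \<and> b \<in> N''}"
    using cox unfolding cox_matrix_def by blast
  have "v i \<in> N''" by (rule lattice_basis_mem[OF N'(2)]) (use i' in blast)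
  moreover have "0 \<in> N'" using additive_subgroup_lattice[OF N'(1)] by (simp add: additive_subgroup_def)
  ultimately show ?thesis unfolding N'(3) by force
qed

text \<open>A ray has dimension one and is spanned by its row, and the last rows form a basis of
  \<open>N''\<close>. Pairings with the rows thus determine a dual vector, which makes
  \<open>Q_map\<close> injective.\<close>

lemma rows_span: "span N \<subseteq> span (v ` {1..m})"
proof -
  obtain N' N'' where N': "is_lattice N'" "span N' = span (\<Union>(fan_rays \<Sigma>))"
    "lattice_basis (v ` {num_rays \<Sigma> + 1..m}) N''" "N = {a + b |a b. a \<in> N' \<and> b \<in> N''}"
    using cox unfolding cox_matrix_def by blast
  have ray: "\<rho> \<subseteq> span (v ` {1..m})" if "\<rho> \<in> fan_rays \<Sigma>" for \<rho>
  proof -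
    obtain i where i: "i \<in> {1..num_rays \<Sigma>}" "v i \<in> \<rho>" "v i \<noteq> 0" using ray_index[OF \<open>\<rho> \<in> fan_rays \<Sigma>\<close>] by blast
    have "dim \<rho> = 1" using that by (simp add: fan_rays_def)
    then have "dim (span {v i}) = dim (span \<rho>)" using i(3) dim_eq_card_independent[of "{v i}"] by simp
    moreover have "span {v i} \<subseteq> span \<rho>" by (rule span_mono) (use i in simp)
    ultimately have "span {v i} = span \<rho>" by (intro subspace_dim_equal) auto
    moreover have "span {v i} \<subseteq> span (v ` {1..m})"
      by (rule span_mono) (use i num_rays_le in auto)
    ultimately show ?thesis using span_superset[of \<rho>] by blast
  qed
  have "span N' \<subseteq> span (v ` {1..m})"
    unfolding N'(2) by (rule span_minimal) (use ray in auto)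
  then have 1: "N' \<subseteq> span (v ` {1..m})" using span_superset[of N'] by blast
  have "span N'' \<subseteq> span (v ` {1..m})"
    unfolding lattice_basis_span[OF N'(3), symmetric] by (rule span_mono) auto
  then have 2: "N'' \<subseteq> span (v ` {1..m})" using span_superset[of N''] by blast
  have "N \<subseteq> span (v ` {1..m})"
  proof
    fix x assume "x \<in> N"
    then obtain a b where "x = a + b" "a \<in> N'" "b \<in> N''" using N'(4) by blast
    then show "x \<in> span (v ` {1..m})" using 1 2 by (auto intro: span_add)
  qed
  then show ?thesis by (rule span_minimal) simp
qed

text \<open>An extremal generator spans a ray of the fan, and the row of that ray is a positive
  multiple of the generator.\<close>

lemma cone_generated_by_rays:
  assumes \<sigma>: "\<sigma> \<in> \<Sigma>"
  shows "\<sigma> \<subseteq> convex_cone hull (v ` cone_indices \<Sigma> v \<sigma>)"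
proof -
  obtain S where S: "finite S" "S \<subseteq> N" "\<sigma> = convex_cone hull S"
    and pointed: "\<And>x. x \<in> \<sigma> \<Longrightarrow> - x \<in> \<sigma> \<Longrightarrow> x = 0"
    using fan_cone[OF fan \<sigma>] unfolding strongly_convex_rational_cone_def by blast
  obtain S' where S': "S' \<subseteq> S" "\<sigma> = convex_cone hull S'"
    "\<And>s. s \<in> S' \<Longrightarrow> s \<noteq> 0 \<and> (convex_cone hull {s}) face_of \<sigma>"
    using extremal_generators[OF S(1,3) pointed] by blast
  have "s \<in> convex_cone hull (v ` cone_indices \<Sigma> v \<sigma>)" if s: "s \<in> S'" for s
  proof -
    let ?\<rho> = "convex_cone hull {s}"
    have \<rho>: "s \<noteq> 0" "?\<rho> face_of \<sigma>" using S'(3)[OF s] by auto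
    have "?\<rho> \<in> \<Sigma>" by (rule fan_face[OF fan \<sigma> \<rho>(2)]) (rule convex_cone_hull_nonempty)
    then have "?\<rho> \<in> fan_rays \<Sigma>" using dim_convex_cone_hull_singleton[OF \<rho>(1)] by (simp add: fan_rays_def)
    then obtain i where i: "i \<in> {1..num_rays \<Sigma>}" "v i \<in> ?\<rho>" "v i \<noteq> 0" using ray_index by blast
    then obtain c where c: "v i = c *\<^sub>R s" "c \<ge> 0" by (auto simp: convex_cone_hull_singleton)
    then have c0: "c > 0" using i(3) by (cases "c = 0") auto
    then have "s = (1 / c) *\<^sub>R v i" using c by simp
    then have s_in: "s \<in> convex_cone hull {v i}"
      using c0 by (auto simp: convex_cone_hull_singleton intro!: exI[of _ "1 / c"])
    have "convex_cone hull {v i} = ?\<rho>"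
    proof (rule antisym)
      show "convex_cone hull {v i} \<subseteq> ?\<rho>"
        using i(2) by (intro hull_minimal convex_cone_convex_cone_hull) auto
      show "?\<rho> \<subseteq> convex_cone hull {v i}"
        using s_in by (intro hull_minimal convex_cone_convex_cone_hull) auto
    qed
    then have "i \<in> cone_indices \<Sigma> v \<sigma>" using \<rho>(2) i(1) by (simp add: cone_indices_def)
    then have "convex_cone hull {v i} \<subseteq> convex_cone hull (v ` cone_indices \<Sigma> v \<sigma>)"
      by (intro hull_mono) auto
    then show ?thesis using s_in by blast
  qed
  then show ?thesis
    unfolding S'(2) by (intro hull_minimal convex_cone_convex_cone_hull) auto
qed

lemma cone_indices_subset: "cone_indices \<Sigma> v \<sigma> \<subseteq> {1..m}"
  using num_rays_le by (auto simp: cone_indices_def)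

lemma cone_index_mem:
  assumes "i \<in> cone_indices \<Sigma> v \<sigma>" shows "v i \<in> \<sigma>"
proof -
  have "v i \<in> convex_cone hull {v i}" by (rule hull_inc) simp
  then show ?thesis using assms face_of_imp_subset by (auto simp: cone_indices_def)
qed

lemma dual_monoid_iff_rows:
  assumes "\<sigma> \<in> \<Sigma>" "u \<in> dual_lattice N"
  shows "u \<in> dual_monoid N \<sigma> \<longleftrightarrow> (\<forall>i\<in>cone_indices \<Sigma> v \<sigma>. 0 \<le> u \<bullet> v i)"
proof
  assume R: "\<forall>i\<in>cone_indices \<Sigma> v \<sigma>. 0 \<le> u \<bullet> v i"
  have "0 \<le> u \<bullet> x" if "x \<in> \<sigma>" for x
    using that cone_generated_by_rays[OF assms(1)] R
    by (intro convex_cone_hull_nonneg[of x "v ` cone_indices \<Sigma> v \<sigma>"]) auto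
  then show "u \<in> dual_monoid N \<sigma>" using assms(2) by (simp add: dual_monoid_def)
qed (auto simp: dual_monoid_def dest: cone_index_mem)

lemma perp_lattice_iff_rows:
  assumes "\<sigma> \<in> \<Sigma>" "u \<in> dual_monoid N \<sigma>"
  shows "u \<in> perp_lattice N \<sigma> \<longleftrightarrow> (\<forall>i\<in>cone_indices \<Sigma> v \<sigma>. \<not> 0 < u \<bullet> v i)"
proof
  assume R: "\<forall>i\<in>cone_indices \<Sigma> v \<sigma>. \<not> 0 < u \<bullet> v i"
  have "0 \<le> (- u) \<bullet> x" if "x \<in> \<sigma>" for x
    using that cone_generated_by_rays[OF assms(1)] R
    by (intro convex_cone_hull_nonneg[of x "v ` cone_indices \<Sigma> v \<sigma>"]) (auto simp: not_less)
  then show "u \<in> perp_lattice N \<sigma>" using assms(2) by (force simp: dual_monoid_def perp_lattice_def)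
qed (auto simp: perp_lattice_def dest: cone_index_mem)

lemma lookup_Q_map: "lookup (Q_map N \<Sigma> v u) i = (if i \<in> {1..m} then \<lfloor>v i \<bullet> u\<rfloor> else 0)"
proof -
  have "lookup (Q_map N \<Sigma> v u) i = (\<Sum>j\<in>{1..m}. if i = j then \<lfloor>v j \<bullet> u\<rfloor> else 0)"
    unfolding Q_map_def lookup_sum by (rule sum.cong) (auto simp: lookup_single when_def)
  then show ?thesis by (simp add: sum.delta')
qed

lemma lookup_Q_map_exact:
  assumes "u \<in> dual_lattice N" "i \<in> {1..m}"
  shows "of_int (lookup (Q_map N \<Sigma> v u) i) = u \<bullet> v i"
proof -
  have "u \<bullet> v i \<in> \<int>" using assms row_mem_lattice by (auto simp: dual_lattice_def)
  then show ?thesis using assms(2) by (auto simp: lookup_Q_map inner_commute)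
qed

lemma inj_on_Q_map: "inj_on (Q_map N \<Sigma> v) (dual_lattice N)"
proof (rule inj_onI)
  fix u u' assume u: "u \<in> dual_lattice N" and u': "u' \<in> dual_lattice N" and eq: "Q_map N \<Sigma> v u = Q_map N \<Sigma> v u'"
  have "u \<in> span (v ` {1..m})" "u' \<in> span (v ` {1..m})"
    using u u' rows_span by (auto simp: dual_lattice_def)
  moreover have "u \<bullet> b = u' \<bullet> b" if "b \<in> v ` {1..m}" for b
    using that lookup_Q_map_exact[OF u] lookup_Q_map_exact[OF u'] eq by fastforce
  ultimately show "u = u'" by (rule orthogonal_span_eq)
qed

lemma Q_map_zero: "Q_map N \<Sigma> v 0 = 0"
  by (rule poly_mapping_eqI) (simp add: lookup_Q_map)

lemma degree_zero_exponent:
  assumes "cox_degree N \<Sigma> v e = cox_degree N \<Sigma> v 0"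
  shows "e \<in> Q_map N \<Sigma> v ` dual_lattice N"
proof -
  have "0 \<in> dual_lattice N" using additive_subgroup_dual_lattice[of N] by (simp add: additive_subgroup_def)
  then have "e \<in> cox_degree N \<Sigma> v e"
    unfolding cox_degree_def by (intro CollectI exI[of _ 0]) (simp add: Q_map_zero)
  then show ?thesis unfolding assms by (auto simp: cox_degree_def)
qed

lemma lookup_cox_poly:
  assumes g: "keys g \<subseteq> dual_lattice N" and u: "u \<in> dual_lattice N"
  shows "lookup (cox_poly N \<Sigma> v g) (Q_map N \<Sigma> v u) = lookup g u"
proof -
  have "lookup (cox_poly N \<Sigma> v g) (Q_map N \<Sigma> v u) = (\<Sum>x\<in>keys g. if u = x then lookup g x else 0)"
    unfolding cox_poly_def lookup_sum
    by (rule sum.cong) (use g u inj_onD[OF inj_on_Q_map] in \<open>auto simp: lookup_single when_def\<close>)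
  then show ?thesis by (auto simp: sum.delta' in_keys_iff)
qed

lemma lookup_cox_poly_outside:
  assumes "keys g \<subseteq> dual_lattice N" "e \<notin> Q_map N \<Sigma> v ` dual_lattice N"
  shows "lookup (cox_poly N \<Sigma> v g) e = 0"
  unfolding cox_poly_def lookup_sum
  by (rule sum.neutral) (use assms in \<open>auto simp: lookup_single when_def\<close>)

lemma cox_poly_eqI:
  assumes g: "keys g \<subseteq> dual_lattice N" and F: "keys F \<subseteq> Q_map N \<Sigma> v ` dual_lattice N"
    and eq: "\<And>u. u \<in> dual_lattice N \<Longrightarrow> lookup g u = lookup F (Q_map N \<Sigma> v u)"
  shows "cox_poly N \<Sigma> v g = F"
proof (rule poly_mapping_eqI)
  fix e
  show "lookup (cox_poly N \<Sigma> v g) e = lookup F e"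
  proof (cases "e \<in> Q_map N \<Sigma> v ` dual_lattice N")
    case True
    then show ?thesis using lookup_cox_poly[OF g] eq by auto
  next
    case False
    then show ?thesis using lookup_cox_poly_outside[OF g] F by (metis in_keys_iff subsetD)
  qed
qed

lemma cox_poly_exists:
  assumes F: "keys F \<subseteq> Q_map N \<Sigma> v ` dual_lattice N"
  shows "\<exists>g. keys g \<subseteq> dual_lattice N \<and> cox_poly N \<Sigma> v g = F"
proof -
  define q where "q = inv_into (dual_lattice N) (Q_map N \<Sigma> v)"
  define g where "g = (\<Sum>e\<in>keys F. Poly_Mapping.single (q e) (lookup F e))"
  have q: "q e \<in> dual_lattice N" "Q_map N \<Sigma> v (q e) = e" if "e \<in> keys F" for e
    using that F unfolding q_def by (auto intro: inv_into_into f_inv_into_f)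
  have lg: "lookup g u = lookup F (Q_map N \<Sigma> v u)" if u: "u \<in> dual_lattice N" for u
  proof -
    have "lookup g u = (\<Sum>e\<in>keys F. if Q_map N \<Sigma> v u = e then lookup F e else 0)"
      unfolding g_def lookup_sum
      by (rule sum.cong) (use q u inj_onD[OF inj_on_Q_map] in \<open>auto simp: lookup_single when_def\<close>)
    then show ?thesis by (auto simp: sum.delta' in_keys_iff)
  qed
  have "keys g \<subseteq> dual_lattice N"
  proof
    fix u assume u: "u \<in> keys g"
    show "u \<in> dual_lattice N"
    proof (rule ccontr)
      assume "u \<notin> dual_lattice N"
      then have "lookup g u = 0"
        unfolding g_def lookup_sum by (intro sum.neutral) (use q in \<open>auto simp: lookup_single when_def\<close>)
      then show False using u by (simp add: in_keys_iff)
    qed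
  qed
  then show ?thesis using cox_poly_eqI[OF _ F lg] by blast
qed

end

section \<open>Local ideals and the ideals of the strata\<close>

locale cox_ideal = cox_fan +
  fixes I :: "laurent set"
  assumes loc: "locally_tropical N \<Sigma> v I"
begin

definition local_ideal :: "'a set \<Rightarrow> ('a \<Rightarrow>\<^sub>0 trop) set" where
  "local_ideal \<sigma> = {g \<in> poly_over (dual_monoid N \<sigma>). cox_poly N \<Sigma> v g \<in> local_degree_zero N \<Sigma> v I \<sigma>}"

lemma ideal_subset: "I \<subseteq> cox_semiring m"
  using loc by (auto simp: locally_tropical_def homogeneous_ideal_def semiring_ideal_def)

lemma tropical_local_ideal: "\<sigma> \<in> \<Sigma> \<Longrightarrow> tropical_ideal (dual_monoid N \<sigma>) (local_ideal \<sigma>)"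
  using loc unfolding locally_tropical_def local_ideal_def by blast

lemma local_hull_subset:
  "semiring_ideal (cox_localization N \<Sigma> v \<sigma>) hull I \<subseteq> cox_localization N \<Sigma> v \<sigma>"
proof (rule hull_minimal)
  show "I \<subseteq> cox_localization N \<Sigma> v \<sigma>"
    unfolding cox_localization_def using ideal_subset subset_localization by blast
  show "semiring_ideal (cox_localization N \<Sigma> v \<sigma>) (cox_localization N \<Sigma> v \<sigma>)"
    unfolding cox_localization_def by (rule localization_ideal, rule cox_semiring_prod_var) auto
qed

lemma local_degree_zero_exponent:
  assumes \<sigma>: "\<sigma> \<in> \<Sigma>" and F: "F \<in> local_degree_zero N \<Sigma> v I \<sigma>" and e: "e \<in> keys F"
  shows "e \<in> Q_map N \<Sigma> v ` dual_monoid N \<sigma>"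
proof -
  have deg: "cox_degree N \<Sigma> v e = cox_degree N \<Sigma> v 0" and FR: "F \<in> cox_localization N \<Sigma> v \<sigma>"
    using F e local_hull_subset by (auto simp: local_degree_zero_def degree_zero_part_def)
  obtain u where u: "u \<in> dual_lattice N" "e = Q_map N \<Sigma> v u" using degree_zero_exponent[OF deg] by blast
  have "0 \<le> u \<bullet> v i" if i: "i \<in> cone_indices \<Sigma> v \<sigma>" for i
  proof -
    have "0 \<le> lookup e i" by (rule localization_nonneg[OF FR[unfolded cox_localization_def] e i])
    then have "0 \<le> (of_int (lookup e i) :: real)" by simp
    also have "\<dots> = u \<bullet> v i" unfolding u(2) by (rule lookup_Q_map_exact[OF u(1)]) (use i cone_indices_subset in blast)
    finally show ?thesis .
  qed
  then have "u \<in> dual_monoid N \<sigma>" using dual_monoid_iff_rows[OF \<sigma> u(1)] by blast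
  then show ?thesis using u(2) by blast
qed

lemma cone_indices_face:
  assumes "\<tau> face_of \<sigma>" shows "cone_indices \<Sigma> v \<tau> \<subseteq> cone_indices \<Sigma> v \<sigma>"
  using assms face_of_trans by (auto simp: cone_indices_def)

text \<open>More variables are inverted for \<open>\<tau>\<close>. Every ideal of the larger
  localization contracts to an ideal of the smaller one, so the ideal generated for
  \<open>\<sigma>\<close> lies below each ideal that competes in the hull for
  \<open>\<tau>\<close>.\<close>

lemma local_ideal_face:
  assumes face: "\<tau> face_of \<sigma>"
  shows "local_ideal \<sigma> \<subseteq> local_ideal \<tau>"
proof -
  let ?R = "\<lambda>\<sigma>. cox_localization N \<Sigma> v \<sigma>"
  have R: "?R \<sigma> \<subseteq> ?R \<tau>"
    unfolding cox_localization_def by (rule localization_mono[OF cone_indices_face[OF face]])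
  have "semiring_ideal (?R \<sigma>) hull I \<subseteq> semiring_ideal (?R \<tau>) hull I"
  proof
    fix x assume x: "x \<in> semiring_ideal (?R \<sigma>) hull I"
    show "x \<in> semiring_ideal (?R \<tau>) hull I"
      unfolding hull_def
    proof (intro InterI, elim CollectE conjE)
      fix K assume K: "semiring_ideal (?R \<tau>) K" "I \<subseteq> K"
      have IR: "I \<subseteq> ?R \<sigma>"
        unfolding cox_localization_def using ideal_subset subset_localization by blast
      have ideal: "semiring_ideal (?R \<sigma>) (?R \<sigma>)"
        unfolding cox_localization_def by (rule localization_ideal, rule cox_semiring_prod_var) auto
      have ne: "I \<noteq> {}"
        using loc by (auto simp: locally_tropical_def homogeneous_ideal_def semiring_ideal_def)
      have "semiring_ideal (?R \<sigma>) (K \<inter> ?R \<sigma>)"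
        unfolding semiring_ideal_def
      proof (intro conjI ballI)
        show "K \<inter> ?R \<sigma> \<subseteq> ?R \<sigma>" by simp
        show "K \<inter> ?R \<sigma> \<noteq> {}" using ne K(2) IR by auto
        fix f assume f: "f \<in> K \<inter> ?R \<sigma>"
        show "f + g \<in> K \<inter> ?R \<sigma>" if "g \<in> K \<inter> ?R \<sigma>" for g
          using K(1) ideal f that by (simp add: semiring_ideal_def)
        show "r * f \<in> K \<inter> ?R \<sigma>" if "r \<in> ?R \<sigma>" for r
          using K(1) ideal f that R by (auto simp: semiring_ideal_def)
      qed
      then have "semiring_ideal (?R \<sigma>) hull I \<subseteq> K \<inter> ?R \<sigma>"
        using K(2) IR by (intro hull_minimal) auto
      then show "x \<in> K" using x by blast
    qed
  qed
  then have "local_degree_zero N \<Sigma> v I \<sigma> \<subseteq> local_degree_zero N \<Sigma> v I \<tau>"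
    by (auto simp: local_degree_zero_def degree_zero_part_def)
  then show ?thesis
    using dual_monoid_antimono[OF face_of_imp_subset[OF face], of N] by (auto simp: local_ideal_def poly_over_def)
qed

text \<open>For \<open>u\<close> in the dual monoid, the monomial with exponent
  \<open>Q_map N \<Sigma> v u\<close> is divisible by a variable of the cone exactly when
  \<open>u\<close> is positive on some ray of it, that is, outside
  \<open>perp_lattice N \<sigma>\<close>. Deleting such terms is therefore truncation.\<close>

lemma stratum_ideal_eq:
  assumes \<sigma>: "\<sigma> \<in> \<Sigma>"
  shows "stratum_ideal N \<Sigma> v I \<sigma> = filter_terms (\<lambda>u. u \<in> perp_lattice N \<sigma>) ` local_ideal \<sigma>"
proof -
  let ?P = "\<lambda>e :: exponent. \<forall>i\<in>cone_indices \<Sigma> v \<sigma>. \<not> 0 < lookup e i"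
  let ?T = "\<lambda>u. u \<in> perp_lattice N \<sigma>"
  have P: "?P (Q_map N \<Sigma> v u) \<longleftrightarrow> ?T u" if u: "u \<in> dual_monoid N \<sigma>" for u
  proof -
    have "0 < lookup (Q_map N \<Sigma> v u) i \<longleftrightarrow> 0 < u \<bullet> v i" if "i \<in> cone_indices \<Sigma> v \<sigma>" for i
      using lookup_Q_map_exact[of u i] u that cone_indices_subset[of \<sigma>]
      by (auto simp: dual_monoid_def simp flip: of_int_0_less_iff)
    then show ?thesis unfolding perp_lattice_iff_rows[OF \<sigma> u] by blast
  qed
  have main: "filter_terms ?P (cox_poly N \<Sigma> v G) = cox_poly N \<Sigma> v (filter_terms ?T G)"
    if G: "keys G \<subseteq> dual_monoid N \<sigma>" for G
  proof -
    have Gd: "keys G \<subseteq> dual_lattice N" using G by (auto simp: dual_monoid_def)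
    show ?thesis
    proof (rule cox_poly_eqI[symmetric])
      show "keys (filter_terms ?T G) \<subseteq> dual_lattice N" using Gd by (auto simp: keys_filter_terms)
      show "keys (filter_terms ?P (cox_poly N \<Sigma> v G)) \<subseteq> Q_map N \<Sigma> v ` dual_lattice N"
        using lookup_cox_poly_outside[OF Gd] by (auto simp: keys_filter_terms in_keys_iff)
      fix u assume u: "u \<in> dual_lattice N"
      show "lookup (filter_terms ?T G) u = lookup (filter_terms ?P (cox_poly N \<Sigma> v G)) (Q_map N \<Sigma> v u)"
      proof (cases "u \<in> keys G")
        case True
        then have "u \<in> dual_monoid N \<sigma>" using G by blast
        from P[OF this] show ?thesis by (simp only: lookup_filter_terms lookup_cox_poly[OF Gd u])
      next
        case False
        then have "lookup G u = 0" by (simp add: in_keys_iff)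
        then show ?thesis by (simp only: lookup_filter_terms lookup_cox_poly[OF Gd u] if_cancel)
      qed
    qed
  qed
  show ?thesis
  proof (intro antisym subsetI)
    fix g assume "g \<in> stratum_ideal N \<Sigma> v I \<sigma>"
    then obtain F where g: "keys g \<subseteq> perp_lattice N \<sigma>" and F: "F \<in> local_degree_zero N \<Sigma> v I \<sigma>"
      "cox_poly N \<Sigma> v g = filter_terms ?P F"
      by (auto simp: stratum_ideal_def poly_over_def)
    have keysF: "keys F \<subseteq> Q_map N \<Sigma> v ` dual_monoid N \<sigma>" using local_degree_zero_exponent[OF \<sigma> F(1)] by blast
    then have "keys F \<subseteq> Q_map N \<Sigma> v ` dual_lattice N" by (auto simp: dual_monoid_def)
    then obtain G where G: "keys G \<subseteq> dual_lattice N" "cox_poly N \<Sigma> v G = F" using cox_poly_exists by blast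
    \<comment> \<open>The local ideal restricts the exponents of \<open>F\<close>, and injectivity
      of \<open>Q_map\<close> carries this over to \<open>G\<close>.\<close>
    have Gm: "keys G \<subseteq> dual_monoid N \<sigma>"
    proof
      fix u assume u: "u \<in> keys G"
      then have ud: "u \<in> dual_lattice N" using G by blast
      then have "Q_map N \<Sigma> v u \<in> keys F" using u lookup_cox_poly[OF G(1) ud] G(2) by (simp add: in_keys_iff)
      then obtain u' where "u' \<in> dual_monoid N \<sigma>" "Q_map N \<Sigma> v u = Q_map N \<Sigma> v u'" using keysF by blast
      then show "u \<in> dual_monoid N \<sigma>" using inj_onD[OF inj_on_Q_map _ ud] by (auto simp: dual_monoid_def)
    qed
    have gd: "keys g \<subseteq> dual_lattice N" using g perp_lattice_subset_dual by blast
    have td: "keys (filter_terms ?T G) \<subseteq> dual_lattice N" using G(1) by (auto simp: keys_filter_terms)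
    have eq: "cox_poly N \<Sigma> v g = cox_poly N \<Sigma> v (filter_terms ?T G)" using F(2) main[OF Gm] G(2) by simp
    have "g = filter_terms ?T G"
    proof (rule poly_mapping_eqI)
      fix u show "lookup g u = lookup (filter_terms ?T G) u"
      proof (cases "u \<in> dual_lattice N")
        case True
        then show ?thesis using lookup_cox_poly[OF gd True] lookup_cox_poly[OF td True] eq by simp
      next
        case False
        then show ?thesis using gd td by (metis in_keys_iff subsetD)
      qed
    qed
    moreover have "G \<in> local_ideal \<sigma>" using Gm G(2) F(1) by (simp add: local_ideal_def poly_over_def)
    ultimately show "g \<in> filter_terms ?T ` local_ideal \<sigma>" by blast
  next
    fix g assume "g \<in> filter_terms ?T ` local_ideal \<sigma>"
    then obtain G where G: "keys G \<subseteq> dual_monoid N \<sigma>" "cox_poly N \<Sigma> v G \<in> local_degree_zero N \<Sigma> v I \<sigma>" "g = filter_terms ?T G"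
      by (auto simp: local_ideal_def poly_over_def)
    then show "g \<in> stratum_ideal N \<Sigma> v I \<sigma>"
      unfolding stratum_ideal_def using main[OF G(1), symmetric] by (auto simp: poly_over_def keys_filter_terms)
  qed
qed

lemma stratum_ideal_finite_basis:
  assumes \<sigma>: "\<sigma> \<in> \<Sigma>"
  shows "\<exists>F. finite F \<and> tropical_basis (stratum_ideal N \<Sigma> v I \<sigma>) F"
proof -
  obtain G where G: "finite G" "0 \<in> G" "perp_lattice N \<sigma> = {\<Sum>\<^sub># \<mu> |\<mu>. set_mset \<mu> \<subseteq> G}"
    using finitely_generated_subgroup[OF lattice additive_subgroup_perp_lattice perp_lattice_subset_dual] by blast
  interpret fg_tropical_ideal "perp_lattice N \<sigma>" "stratum_ideal N \<Sigma> v I \<sigma>" G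
  proof
    show "tropical_ideal (perp_lattice N \<sigma>) (stratum_ideal N \<Sigma> v I \<sigma>)"
      unfolding stratum_ideal_eq[OF \<sigma>] by (rule tropical_ideal_truncation[OF tropical_local_ideal[OF \<sigma>]])
  qed (use G in auto)
  show ?thesis by (rule finite_tropical_basis)
qed

end

section \<open>Neighbourhoods in the tropical toric variety\<close>

text \<open>One parameter serves finite values and neighbourhoods of \<open>\<infinity>\<close> alike.\<close>

fun trop_near :: "real \<Rightarrow> trop \<Rightarrow> trop \<Rightarrow> bool" where
  "trop_near e (Fin a) (Fin b) \<longleftrightarrow> \<bar>b - a\<bar> < e"
| "trop_near e (Fin a) Infty \<longleftrightarrow> False"
| "trop_near e Infty (Fin b) \<longleftrightarrow> 1 / e < b"
| "trop_near e Infty Infty \<longleftrightarrow> True"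

lemma trop_near_refl: "0 < e \<Longrightarrow> trop_near e a a"
  by (cases a) auto

lemma trop_near_mono: "trop_near d a b \<Longrightarrow> 0 < d \<Longrightarrow> d \<le> e \<Longrightarrow> trop_near e a b"
proof (cases a; cases b)
  fix x assume h: "trop_near d a b" "0 < d" "d \<le> e" "a = Infty" "b = Fin x"
  then have "1 / e \<le> 1 / d" by (simp add: frac_le)
  then show ?thesis using h by simp
qed auto

text \<open>Takes the place of a triangle inequality. The radius depends on \<open>b\<close>,
  because nearness to \<open>Infty\<close> is a lower bound and not a distance.\<close>

lemma trop_near_open:
  assumes "trop_near e a b" "0 < e"
  shows "\<exists>d>0. \<forall>c. trop_near d b c \<longrightarrow> trop_near e a c"
proof (cases a)
  case (Fin x)
  then obtain y where y: "b = Fin y" using assms by (cases b) auto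
  have "trop_near e a c" if "trop_near (e - \<bar>y - x\<bar>) b c" for c
    using that Fin y by (cases c) auto
  then show ?thesis using assms Fin y by (intro exI[of _ "e - \<bar>y - x\<bar>"]) auto
next
  case Infty
  show ?thesis
  proof (cases b)
    case (Fin y)
    have "trop_near e a c" if "trop_near (y - 1 / e) b c" for c
      using that Fin Infty by (cases c) auto
    then show ?thesis using assms Fin Infty by (intro exI[of _ "y - 1 / e"]) auto
  qed (use Infty assms in blast)
qed

lemma openin_trop_topology_near:
  assumes "openin trop_topology U" "a \<in> U"
  shows "\<exists>e>0. \<forall>b. trop_near e a b \<longrightarrow> b \<in> U"
proof -
  have "generate_topology_on
     ({{Fin r |r. a < r \<and> r < b} |a b. True} \<union> {{x. Fin a < x} |a. True}) U"
    using assms(1) unfolding trop_topology_def by (rule openin_topology_generated_by)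
  then show ?thesis using assms(2)
  proof (induction rule: generate_topology_on.induct)
    case Empty
    then show ?case by simp
  next
    case (Int A B)
    then obtain d e where d: "d > 0" "\<And>b. trop_near d a b \<Longrightarrow> b \<in> A"
      and e: "e > 0" "\<And>b. trop_near e a b \<Longrightarrow> b \<in> B" by auto
    have "b \<in> A \<inter> B" if "trop_near (min d e) a b" for b
      using d e trop_near_mono[OF that, of d] trop_near_mono[OF that, of e] by auto
    then show ?case using d e by (intro exI[of _ "min d e"]) auto
  next
    case (UN K)
    then obtain k where k: "k \<in> K" "a \<in> k" by blast
    then obtain e where "e > 0" "\<forall>b. trop_near e a b \<longrightarrow> b \<in> k" using UN.IH by blast
    then show ?case using k by blast
  next
    case (Basis S)
    then consider p q where "S = {Fin r |r. p < r \<and> r < q}" | p where "S = {x. Fin p < x}" by blast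
    then show ?case
    proof cases
      case 1
      then obtain r where r: "a = Fin r" "p < r" "r < q" using Basis by blast
      have "b \<in> S" if "trop_near (min (r - p) (q - r)) a b" for b
        using that r 1 by (cases b) auto
      then show ?thesis using r by (intro exI[of _ "min (r - p) (q - r)"]) auto
    next
      case 2
      show ?thesis
      proof (cases a)
        case (Fin r)
        then have r: "p < r" using 2 Basis by simp
        have "b \<in> S" if "trop_near (r - p) a b" for b
          using that Fin 2 by (cases b) auto
        then show ?thesis using r by (intro exI[of _ "r - p"]) auto
      next
        case Infty
        \<comment> \<open>Chosen so that \<open>1 / e\<close> exceeds \<open>p\<close>; the added
          one keeps the denominator positive.\<close>
        define e where "e = 1 / (\<bar>p\<bar> + 1)"
        have e: "e > 0" "1 / e > p" by (auto simp: e_def)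
        have "b \<in> S" if "trop_near e a b" for b
          using that Infty 2 e by (cases b) auto
        then show ?thesis using e by blast
      qed
    qed
  qed
qed

lemma openin_trop_near: 
  assumes "0 < e" shows "openin trop_topology {b. trop_near e a b}"
proof -
  let ?B = "{{Fin r |r. a < r \<and> r < b} |a b. True} \<union> {{x. Fin a < x} |a. True}"
  have "{b. trop_near e a b} \<in> ?B"
  proof (cases a)
    case (Fin x)
    have "{b. trop_near e a b} = {Fin r |r. x - e < r \<and> r < x + e}"
    proof (rule set_eqI)
      fix b show "b \<in> {b. trop_near e a b} \<longleftrightarrow> b \<in> {Fin r |r. x - e < r \<and> r < x + e}"
        unfolding Fin by (cases b) auto
    qed
    then show ?thesis by blast
  next
    case Infty
    have "{b. trop_near e a b} = {x. Fin (1 / e) < x}"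
    proof (rule set_eqI)
      fix b show "b \<in> {b. trop_near e a b} \<longleftrightarrow> b \<in> {x. Fin (1 / e) < x}"
        unfolding Infty by (cases b) auto
    qed
    then show ?thesis by blast
  qed
  then show ?thesis
    unfolding trop_topology_def openin_topology_generated_by_iff by (rule generate_topology_on.Basis)
qed

lemma topspace_trop_topology: "topspace trop_topology = UNIV"
proof -
  have "x \<in> topspace trop_topology" for x
    using openin_subset[OF openin_trop_near[of 1 x]] trop_near_refl[of 1 x] by auto
  then show ?thesis by blast
qed

lemma topspace_hom_topology: "topspace (hom_topology A) = monoid_homs A"
  by (auto simp: hom_topology_def topspace_trop_topology monoid_homs_def PiE_def)

section \<open>Neighbourhoods of monoid homomorphisms and of chart points\<close>

definition hom_near :: "'e set \<Rightarrow> real \<Rightarrow> ('e \<Rightarrow> trop) \<Rightarrow> ('e \<Rightarrow> trop) \<Rightarrow> bool" where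
  "hom_near H e \<phi> \<psi> \<longleftrightarrow> (\<forall>u\<in>H. trop_near e (\<phi> u) (\<psi> u))"

lemma openin_hom_near:
  assumes H: "finite H" "H \<subseteq> A" and e: "0 < e"
  shows "openin (hom_topology A) {\<psi>\<in>monoid_homs A. hom_near H e \<phi> \<psi>}"
proof -
  let ?X = "product_topology (\<lambda>_. trop_topology) A"
  have "openin ?X {\<psi>\<in>topspace ?X. \<psi> u \<in> {b. trop_near e (\<phi> u) b}}" if "u \<in> A" for u
    by (rule openin_continuous_map_preimage[OF continuous_map_product_projection[OF that] openin_trop_near[OF e]])
  then have "openin (hom_topology A) {\<psi>\<in>monoid_homs A. trop_near e (\<phi> u) (\<psi> u)}" if "u \<in> A" for u
    unfolding hom_topology_def openin_subtopology using that
    by (intro exI[of _ "{\<psi>\<in>topspace ?X. \<psi> u \<in> {b. trop_near e (\<phi> u) b}}"])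
      (auto simp: topspace_trop_topology monoid_homs_def PiE_def)
  then have 1: "openin (hom_topology A) (\<Inter>u\<in>H. {\<psi>\<in>monoid_homs A. trop_near e (\<phi> u) (\<psi> u)})" if "H \<noteq> {}"
    using H that by (intro openin_Inter) auto
  show ?thesis
  proof (cases "H = {}")
    case True
    then show ?thesis using openin_topspace[of "hom_topology A"] by (simp add: hom_near_def topspace_hom_topology)
  next
    case False
    have "{\<psi>\<in>monoid_homs A. hom_near H e \<phi> \<psi>} = (\<Inter>u\<in>H. {\<psi>\<in>monoid_homs A. trop_near e (\<phi> u) (\<psi> u)})"
      using False by (auto simp: hom_near_def)
    then show ?thesis using 1[OF False] by simp
  qed
qed

text \<open>A basic open set of the product constrains finitely many coordinates, and the smallest
  of their radii serves for all.\<close>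

lemma hom_near_of_openin:
  assumes W: "openin (hom_topology A) W" and \<phi>: "\<phi> \<in> W"
  shows "\<exists>H e. finite H \<and> H \<subseteq> A \<and> 0 < e \<and> (\<forall>\<psi>\<in>monoid_homs A. hom_near H e \<phi> \<psi> \<longrightarrow> \<psi> \<in> W)"
proof -
  let ?X = "product_topology (\<lambda>_. trop_topology) A"
  obtain T where T: "openin ?X T" "W = T \<inter> monoid_homs A"
    using W by (auto simp: hom_topology_def openin_subtopology)
  then obtain U where U: "finite {i\<in>A. U i \<noteq> topspace trop_topology}"
     "\<forall>i\<in>A. openin trop_topology (U i)" "\<phi> \<in> Pi\<^sub>E A U" "Pi\<^sub>E A U \<subseteq> T"
    using \<phi> unfolding openin_product_topology_alt by blast
  define H where "H = {i\<in>A. U i \<noteq> UNIV}"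
  have finH: "finite H" using U(1) by (simp add: H_def topspace_trop_topology)
  have "\<forall>i\<in>H. \<exists>e>0. \<forall>b. trop_near e (\<phi> i) b \<longrightarrow> b \<in> U i"
    using openin_trop_topology_near U(2,3) by (auto simp: H_def PiE_iff)
  then obtain r where r: "\<And>i. i \<in> H \<Longrightarrow> r i > 0" "\<And>i b. i \<in> H \<Longrightarrow> trop_near (r i) (\<phi> i) b \<Longrightarrow> b \<in> U i"
    by metis
  define e where "e = Min (insert 1 (r ` H))"
  have e: "e > 0" using finH r(1) by (simp add: e_def)
  have le: "e \<le> r i" if "i \<in> H" for i using finH that by (simp add: e_def)
  have "\<psi> \<in> W" if \<psi>: "\<psi> \<in> monoid_homs A" "hom_near H e \<phi> \<psi>" for \<psi>
  proof -
    have "\<psi> i \<in> U i" if i: "i \<in> A" for i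
    proof (cases "i \<in> H")
      case True
      then have "trop_near (r i) (\<phi> i) (\<psi> i)"
        using \<psi>(2) trop_near_mono[OF _ e le] by (auto simp: hom_near_def)
      then show ?thesis using r(2) True by blast
    qed (use i in \<open>auto simp: H_def\<close>)
    then have "\<psi> \<in> Pi\<^sub>E A U" using \<psi>(1) by (auto simp: monoid_homs_def PiE_iff)
    then show ?thesis using U(4) \<psi>(1) T(2) by blast
  qed
  then show ?thesis using finH e by (intro exI[of _ H] exI[of _ e]) (auto simp: H_def)
qed

lemma hom_of_point_apply:
  "u \<in> dual_monoid N \<sigma> \<Longrightarrow> hom_of_point N \<sigma> (\<tau>, w) u = (if u \<in> perp_lattice N \<tau> then Fin (u \<bullet> w) else Infty)"
  by (simp add: hom_of_point_def)

lemma hom_of_point_mem: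
  assumes "p \<in> chart_points N \<Sigma> \<sigma>" shows "hom_of_point N \<sigma> p \<in> monoid_homs (dual_monoid N \<sigma>)"
proof -
  obtain \<tau> w where p: "p = (\<tau>, w)" "\<tau> face_of \<sigma>" using assms by (auto simp: chart_points_def)
  have sub: "\<tau> \<subseteq> \<sigma>" using p(2) by (rule face_of_imp_subset)
  have zero: "0 \<in> dual_monoid N \<sigma>" "0 \<in> perp_lattice N \<tau>"
    using additive_subgroup_perp_lattice[of N \<tau>] additive_subgroup_dual_lattice[of N]
    by (auto simp: dual_monoid_def additive_subgroup_def)
  show ?thesis
    unfolding monoid_homs_def
  proof (intro CollectI conjI ballI)
    show "hom_of_point N \<sigma> p \<in> extensional (dual_monoid N \<sigma>)" by (simp add: p(1) hom_of_point_def)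
    show "hom_of_point N \<sigma> p 0 = 1" using zero by (simp add: p(1) hom_of_point_apply one_trop_def)
    fix a b assume a: "a \<in> dual_monoid N \<sigma>" and b: "b \<in> dual_monoid N \<sigma>"
    show "hom_of_point N \<sigma> p (a + b) = hom_of_point N \<sigma> p a * hom_of_point N \<sigma> p b"
      using dual_monoid_add[OF a b] a b perp_lattice_add_iff[OF a b sub]
      by (auto simp: p(1) hom_of_point_apply inner_add_left)
  qed
qed

text \<open>Expresses the pullback topology by finitely many exponents and one radius, the form in
  which the later estimates are made.\<close>

lemma openin_chart_topology_iff:
  "openin (chart_topology N \<Sigma> \<sigma>) U \<longleftrightarrow> U \<subseteq> chart_points N \<Sigma> \<sigma> \<and>
     (\<forall>p\<in>U. \<exists>H e. finite H \<and> H \<subseteq> dual_monoid N \<sigma> \<and> 0 < e \<and>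
        (\<forall>q\<in>chart_points N \<Sigma> \<sigma>. hom_near H e (hom_of_point N \<sigma> p) (hom_of_point N \<sigma> q) \<longrightarrow> q \<in> U))"
    (is "?l \<longleftrightarrow> ?r")
proof
  let ?A = "dual_monoid N \<sigma>" and ?h = "hom_of_point N \<sigma>"
  assume ?l
  then obtain W where W: "openin (hom_topology ?A) W" "U = ?h -` W \<inter> chart_points N \<Sigma> \<sigma>"
    by (auto simp: chart_topology_def openin_pullback_topology)
  show ?r
  proof (intro conjI ballI)
    show "U \<subseteq> chart_points N \<Sigma> \<sigma>" using W by blast
    fix p assume "p \<in> U"
    then have "?h p \<in> W" using W by blast
    from hom_near_of_openin[OF W(1) this] obtain H e where
      "finite H" "H \<subseteq> ?A" "0 < e" "\<forall>\<psi>\<in>monoid_homs ?A. hom_near H e (?h p) \<psi> \<longrightarrow> \<psi> \<in> W" by blast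
    then show "\<exists>H e. finite H \<and> H \<subseteq> ?A \<and> 0 < e \<and>
        (\<forall>q\<in>chart_points N \<Sigma> \<sigma>. hom_near H e (?h p) (?h q) \<longrightarrow> q \<in> U)"
      using W(2) hom_of_point_mem by (intro exI[of _ H] exI[of _ e]) blast
  qed
next
  let ?A = "dual_monoid N \<sigma>" and ?h = "hom_of_point N \<sigma>"
  assume R: ?r
  define nhd where "nhd p H e \<longleftrightarrow> finite H \<and> H \<subseteq> ?A \<and> 0 < e \<and>
      (\<forall>q\<in>chart_points N \<Sigma> \<sigma>. hom_near H e (?h p) (?h q) \<longrightarrow> q \<in> U)" for p H e
  have "\<forall>p\<in>U. \<exists>H e. nhd p H e" using R unfolding nhd_def by (rule conjunct2)
  then obtain H e where "\<And>p. p \<in> U \<Longrightarrow> nhd p (H p) (e p)" by metis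
  then have He: "finite (H p)" "H p \<subseteq> ?A" "0 < e p"
      "\<And>q. q \<in> chart_points N \<Sigma> \<sigma> \<Longrightarrow> hom_near (H p) (e p) (?h p) (?h q) \<Longrightarrow> q \<in> U" if "p \<in> U" for p
    using that by (auto simp: nhd_def)
  define W where "W = (\<Union>p\<in>U. {\<psi>\<in>monoid_homs ?A. hom_near (H p) (e p) (?h p) \<psi>})"
  have "openin (hom_topology ?A) W"
    unfolding W_def
  proof (rule openin_Union, elim imageE)
    fix V p assume "p \<in> U" "V = {\<psi>\<in>monoid_homs ?A. hom_near (H p) (e p) (?h p) \<psi>}"
    then show "openin (hom_topology ?A) V" using openin_hom_near[OF He(1-3)] by simp
  qed
  moreover have "U = ?h -` W \<inter> chart_points N \<Sigma> \<sigma>"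
  proof (intro antisym subsetI)
    fix p assume p: "p \<in> U"
    then have pc: "p \<in> chart_points N \<Sigma> \<sigma>" using R by blast
    have "hom_near (H p) (e p) (?h p) (?h p)" using He(3)[OF p] by (simp add: hom_near_def trop_near_refl)
    then show "p \<in> ?h -` W \<inter> chart_points N \<Sigma> \<sigma>"
      using p pc hom_of_point_mem[OF pc] by (auto simp: W_def)
  next
    fix q assume "q \<in> ?h -` W \<inter> chart_points N \<Sigma> \<sigma>"
    then obtain p where "p \<in> U" "hom_near (H p) (e p) (?h p) (?h q)" "q \<in> chart_points N \<Sigma> \<sigma>"
      by (auto simp: W_def)
    then show "q \<in> U" using He(4) by simp
  qed
  ultimately show ?l unfolding chart_topology_def openin_pullback_topology by blast
qed

section \<open>Gluing of charts and closures of strata\<close>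

context cox_fan
begin

lemma face_meets:
  assumes "\<sigma> \<in> \<Sigma>" "\<sigma>' \<in> \<Sigma>"
  obtains u0 where "u0 \<in> dual_monoid N \<sigma>'" "\<sigma> \<inter> \<sigma>' = {x\<in>\<sigma>'. u0 \<bullet> x = 0}"
proof -
  have face: "(\<sigma> \<inter> \<sigma>') face_of \<sigma>'" using fan assms by (auto simp: fan_def)
  have ne: "\<sigma> \<inter> \<sigma>' \<noteq> {}" using fan_cone_zero[OF fan] assms by blast
  obtain S where S: "finite S" "S \<subseteq> N" "\<sigma>' = convex_cone hull S" by (rule fan_cone_generators[OF fan assms(2)])
  from rational_supporting_vector[OF lattice S face ne] show ?thesis using that by blast
qed

text \<open>
  On the overlap with another chart, a form \<open>u\<close> of the first chart becomes regular in the second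
  after adding a multiple of a vector \<open>u0\<close> supporting the common face, and the overlap itself is
  the set where \<open>u0\<close> is finite.
\<close>

lemma chart_nhd_openin:
  assumes \<sigma>: "\<sigma> \<in> \<Sigma>" and G: "finite G" "G \<subseteq> dual_monoid N \<sigma>" and e: "0 < e"
  shows "openin (trop_toric_topology N \<Sigma>) {q\<in>chart_points N \<Sigma> \<sigma>. hom_near G e \<phi> (hom_of_point N \<sigma> q)}"
  unfolding openin_trop_toric_topology
proof (intro conjI ballI)
  let ?U = "{q\<in>chart_points N \<Sigma> \<sigma>. hom_near G e \<phi> (hom_of_point N \<sigma> q)}"
  show "?U \<subseteq> trop_toric N \<Sigma>" by (auto simp: chart_points_def trop_toric_def)
  fix \<sigma>' assume \<sigma>': "\<sigma>' \<in> \<Sigma>"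
  obtain u0 where u0: "u0 \<in> dual_monoid N \<sigma>'" "\<sigma> \<inter> \<sigma>' = {x\<in>\<sigma>'. u0 \<bullet> x = 0}" by (rule face_meets[OF \<sigma> \<sigma>'])
  have u0d: "u0 \<in> dual_lattice N" using u0(1) by (simp add: dual_monoid_def)
  \<comment> \<open>Among the strata of the second chart, those shared with the first are the ones
    on which \<open>u0\<close> is finite, which is an open condition.\<close>
  have overlap: "\<kappa> face_of \<sigma> \<longleftrightarrow> u0 \<in> perp_lattice N \<kappa>" if \<kappa>: "\<kappa> face_of \<sigma>'" for \<kappa>
  proof
    assume "\<kappa> face_of \<sigma>"
    then have "\<kappa> \<subseteq> \<sigma> \<inter> \<sigma>'" using \<kappa> face_of_imp_subset by blast
    then show "u0 \<in> perp_lattice N \<kappa>" using u0 u0d by (auto simp: perp_lattice_def)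
  next
    assume "u0 \<in> perp_lattice N \<kappa>"
    then have "\<kappa> \<subseteq> \<sigma> \<inter> \<sigma>'" using u0(2) face_of_imp_subset[OF \<kappa>] by (auto simp: perp_lattice_def)
    then have "\<kappa> face_of (\<sigma> \<inter> \<sigma>')" using \<kappa> by (auto intro: face_of_subset)
    moreover have "(\<sigma> \<inter> \<sigma>') face_of \<sigma>" using fan \<sigma> \<sigma>' by (auto simp: fan_def)
    ultimately show "\<kappa> face_of \<sigma>" by (rule face_of_trans)
  qed
  obtain S where S: "finite S" "S \<subseteq> N" "\<sigma>' = convex_cone hull S" by (rule fan_cone_generators[OF fan \<sigma>'])
  have "\<forall>u\<in>G. \<exists>k::nat. u + of_nat k *\<^sub>R u0 \<in> dual_monoid N \<sigma>'"
  proof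
    fix u assume "u \<in> G"
    then have "u \<in> dual_monoid N (\<sigma> \<inter> \<sigma>')" using G(2) dual_monoid_antimono[of "\<sigma> \<inter> \<sigma>'" \<sigma> N] by blast
    then show "\<exists>k::nat. u + of_nat k *\<^sub>R u0 \<in> dual_monoid N \<sigma>'"
      using dual_monoid_shift[OF S(3,1,2) u0(1) u0(2)] by blast
  qed
  then obtain k :: "'v \<Rightarrow> nat" where k: "\<And>u. u \<in> G \<Longrightarrow> u + of_nat (k u) *\<^sub>R u0 \<in> dual_monoid N \<sigma>'" by metis
  define t where "t u = u + of_nat (k u) *\<^sub>R u0" for u
  have t: "t u \<in> dual_monoid N \<sigma>'" if "u \<in> G" for u using k[OF that] by (simp add: t_def)
  have t_perp: "t u \<in> perp_lattice N \<kappa> \<longleftrightarrow> u \<in> perp_lattice N \<kappa>" if "u0 \<in> perp_lattice N \<kappa>" "u \<in> G" for u \<kappa>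
  proof -
    have ku: "of_nat (k u) *\<^sub>R u0 \<in> perp_lattice N \<kappa>"
      using that(1) by (rule additive_subgroup_of_nat[OF additive_subgroup_perp_lattice])
    have "u = t u + - (of_nat (k u) *\<^sub>R u0)" by (simp add: t_def)
    then show ?thesis using ku additive_subgroup_perp_lattice[of N \<kappa>]
      unfolding additive_subgroup_def t_def by metis
  qed
  show "openin (chart_topology N \<Sigma> \<sigma>') (?U \<inter> chart_points N \<Sigma> \<sigma>')"
    unfolding openin_chart_topology_iff
  proof (intro conjI ballI)
    fix p assume p: "p \<in> ?U \<inter> chart_points N \<Sigma> \<sigma>'"
    obtain \<kappa> y where \<kappa>y: "p = (\<kappa>, y)" by (cases p)
    have \<kappa>: "\<kappa> face_of \<sigma>" "\<kappa> face_of \<sigma>'" using p \<kappa>y by (auto simp: chart_points_def)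
    have u0\<kappa>: "u0 \<in> perp_lattice N \<kappa>" using overlap \<kappa> by blast
    define c where "c = u0 \<bullet> y"
    have loc: "\<exists>d>0. \<forall>\<nu> z. \<nu> face_of \<sigma> \<longrightarrow> \<nu> face_of \<sigma>' \<longrightarrow> \<bar>u0 \<bullet> z - c\<bar> < d \<longrightarrow>
        trop_near d (hom_of_point N \<sigma>' p (t u)) (hom_of_point N \<sigma>' (\<nu>, z) (t u)) \<longrightarrow>
        trop_near e (\<phi> u) (hom_of_point N \<sigma> (\<nu>, z) u)" if u: "u \<in> G" for u
    proof -
      have uM: "u \<in> dual_monoid N \<sigma>" using u G by blast
      have "trop_near e (\<phi> u) (hom_of_point N \<sigma> p u)" using p u by (auto simp: hom_near_def)
      then obtain r where r: "r > 0" "\<And>b. trop_near r (hom_of_point N \<sigma> p u) b \<Longrightarrow> trop_near e (\<phi> u) b"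
        using trop_near_open[OF _ e] by blast
      define K where "K = real (k u)"
      have K0: "K \<ge> 0" by (simp add: K_def)
      \<comment> \<open>Passing from \<open>t u\<close> back to \<open>u\<close> costs
        \<open>K\<close> times the error of \<open>u0\<close>. The radius \<open>r / (K + 2)\<close>
        absorbs this at finite values; near infinity \<open>t u\<close> has to exceed
        \<open>1 / r\<close> by the largest possible contribution of \<open>u0\<close>.\<close>
      define B where "B = 1 / r + K * (\<bar>c\<bar> + 1)"
      have B: "B > 0" using r(1) K0 by (simp add: B_def add_pos_nonneg)
      define d where "d = min (min 1 (r / (K + 2))) (1 / B)"
      have d: "d > 0" "d \<le> 1" "d \<le> r / (K + 2)" "d \<le> 1 / B" using r(1) K0 B by (auto simp: d_def)
      show ?thesis
      proof (intro exI conjI allI impI)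
        show "d > 0" by (rule d(1))
        fix \<nu> z assume \<nu>: "\<nu> face_of \<sigma>" "\<nu> face_of \<sigma>'" and z: "\<bar>u0 \<bullet> z - c\<bar> < d"
          and near: "trop_near d (hom_of_point N \<sigma>' p (t u)) (hom_of_point N \<sigma>' (\<nu>, z) (t u))"
        have u0\<nu>: "u0 \<in> perp_lattice N \<nu>" using overlap \<nu> by blast
        have tv: "t u \<bullet> z' = u \<bullet> z' + K * (u0 \<bullet> z')" for z' by (simp add: t_def K_def inner_add_left)
        have hp: "hom_of_point N \<sigma>' p (t u) = (if u \<in> perp_lattice N \<kappa> then Fin (u \<bullet> y + K * c) else Infty)"
          by (simp add: \<kappa>y hom_of_point_apply[OF t[OF u]] t_perp[OF u0\<kappa> u] tv c_def)
        have hq: "hom_of_point N \<sigma>' (\<nu>, z) (t u) = (if u \<in> perp_lattice N \<nu> then Fin (u \<bullet> z + K * (u0 \<bullet> z)) else Infty)"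
          by (simp add: hom_of_point_apply[OF t[OF u]] t_perp[OF u0\<nu> u] tv)
        have Kz: "\<bar>K * (u0 \<bullet> z) - K * c\<bar> \<le> K * d"
          using z K0 by (simp add: abs_mult mult_left_mono flip: right_diff_distrib)
        have "trop_near r (hom_of_point N \<sigma> p u) (hom_of_point N \<sigma> (\<nu>, z) u)"
        proof (cases "u \<in> perp_lattice N \<kappa>")
          case True
          then have u\<nu>: "u \<in> perp_lattice N \<nu>" using near hp hq by (auto split: if_splits)
          have "\<bar>(u \<bullet> z + K * (u0 \<bullet> z)) - (u \<bullet> y + K * c)\<bar> < d"
            using near hp hq True u\<nu> by simp
          then have "\<bar>u \<bullet> z - u \<bullet> y\<bar> < d + K * d" using Kz by linarith
          also have "d + K * d = (K + 1) * d" by (simp add: algebra_simps)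
          also have "(K + 1) * d \<le> (K + 1) * (r / (K + 2))" using d(3) K0 by (intro mult_left_mono) auto
          also have "\<dots> \<le> r" using r(1) K0 by (simp add: field_simps)
          finally show ?thesis using True u\<nu> by (simp add: \<kappa>y hom_of_point_apply[OF uM])
        next
          case False
          show ?thesis
          proof (cases "u \<in> perp_lattice N \<nu>")
            case True
            then have "1 / d < u \<bullet> z + K * (u0 \<bullet> z)" using near hp hq False by simp
            moreover have "B \<le> 1 / d" using d(1,4) B by (simp add: field_simps)
            moreover have "K * (u0 \<bullet> z) \<le> K * (\<bar>c\<bar> + 1)" using z d(2) K0 by (intro mult_left_mono) linarith+
            ultimately have "1 / r < u \<bullet> z" unfolding B_def by linarith
            then show ?thesis using True False by (simp add: \<kappa>y hom_of_point_apply[OF uM])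
          next
            case False': False
            then show ?thesis using False by (simp add: \<kappa>y hom_of_point_apply[OF uM])
          qed
        qed
        then show "trop_near e (\<phi> u) (hom_of_point N \<sigma> (\<nu>, z) u)" by (rule r(2))
      qed
    qed
    then obtain d where d: "\<And>u. u \<in> G \<Longrightarrow> d u > 0" "\<And>u \<nu> z. u \<in> G \<Longrightarrow> \<nu> face_of \<sigma> \<Longrightarrow> \<nu> face_of \<sigma>' \<Longrightarrow> \<bar>u0 \<bullet> z - c\<bar> < d u \<Longrightarrow>
        trop_near (d u) (hom_of_point N \<sigma>' p (t u)) (hom_of_point N \<sigma>' (\<nu>, z) (t u)) \<Longrightarrow>
        trop_near e (\<phi> u) (hom_of_point N \<sigma> (\<nu>, z) u)" by metis
    define \<delta> where "\<delta> = Min (insert 1 (d ` G))"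
    have \<delta>: "\<delta> > 0" using G(1) d(1) by (simp add: \<delta>_def)
    have \<delta>le: "\<delta> \<le> d u" if "u \<in> G" for u using G(1) that by (simp add: \<delta>_def)
    \<comment> \<open>Including \<open>u0\<close> confines \<open>q\<close> to the overlap of the
      charts and keeps the value of \<open>u0\<close> within \<open>\<delta>\<close> of
      \<open>c\<close>.\<close>
    let ?H = "insert u0 (t ` G)"
    show "\<exists>H \<epsilon>. finite H \<and> H \<subseteq> dual_monoid N \<sigma>' \<and> 0 < \<epsilon> \<and>
        (\<forall>q\<in>chart_points N \<Sigma> \<sigma>'. hom_near H \<epsilon> (hom_of_point N \<sigma>' p) (hom_of_point N \<sigma>' q) \<longrightarrow>
          q \<in> ?U \<inter> chart_points N \<Sigma> \<sigma>')"
    proof (intro exI[of _ ?H] exI[of _ \<delta>] conjI ballI impI)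
      show "finite ?H" using G by simp
      show "?H \<subseteq> dual_monoid N \<sigma>'" using t u0 by auto
      show "0 < \<delta>" by (rule \<delta>)
      fix q assume q: "q \<in> chart_points N \<Sigma> \<sigma>'" and near: "hom_near ?H \<delta> (hom_of_point N \<sigma>' p) (hom_of_point N \<sigma>' q)"
      obtain \<nu> z where \<nu>z: "q = (\<nu>, z)" by (cases q)
      have \<nu>: "\<nu> \<in> \<Sigma>" "\<nu> face_of \<sigma>'" "z \<in> stratum N \<nu>" using q \<nu>z by (auto simp: chart_points_def)
      have n0: "trop_near \<delta> (Fin c) (hom_of_point N \<sigma>' q u0)"
        using near u0\<kappa> by (auto simp: hom_near_def \<kappa>y hom_of_point_apply[OF u0(1)] c_def)
      then have u0\<nu>: "u0 \<in> perp_lattice N \<nu>"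
        by (auto simp: \<nu>z hom_of_point_apply[OF u0(1)] split: if_splits)
      then have face: "\<nu> face_of \<sigma>" using overlap[OF \<nu>(2)] by blast
      have zc: "\<bar>u0 \<bullet> z - c\<bar> < \<delta>" using n0 u0\<nu> by (simp add: \<nu>z hom_of_point_apply[OF u0(1)])
      have "trop_near e (\<phi> u) (hom_of_point N \<sigma> q u)" if u: "u \<in> G" for u
        unfolding \<nu>z
      proof (rule d(2)[OF u face \<nu>(2)])
        show "\<bar>u0 \<bullet> z - c\<bar> < d u" using zc \<delta>le[OF u] by linarith
        have "trop_near \<delta> (hom_of_point N \<sigma>' p (t u)) (hom_of_point N \<sigma>' (\<nu>, z) (t u))"
          using near u by (auto simp: hom_near_def \<nu>z)
        then show "trop_near (d u) (hom_of_point N \<sigma>' p (t u)) (hom_of_point N \<sigma>' (\<nu>, z) (t u))"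
          by (rule trop_near_mono[OF _ \<delta> \<delta>le[OF u]])
      qed
      then have "hom_near G e \<phi> (hom_of_point N \<sigma> q)" by (simp add: hom_near_def)
      moreover have "q \<in> chart_points N \<Sigma> \<sigma>" using \<nu> face by (auto simp: \<nu>z chart_points_def)
      ultimately show "q \<in> ?U \<inter> chart_points N \<Sigma> \<sigma>'" using q by blast
    qed
  qed auto
qed

text \<open>The chart of \<open>\<sigma>\<close> is open and contains both strata, so its own
  neighbourhoods decide about the closure.\<close>

lemma stratum_closure_iff:
  assumes \<sigma>: "\<sigma> \<in> \<Sigma>" and \<tau>: "\<tau> \<in> \<Sigma>" and face: "\<tau> face_of \<sigma>" and P: "P \<subseteq> stratum N \<tau>" and x: "x \<in> stratum N \<sigma>"
  shows "(\<sigma>, x) \<in> trop_toric_topology N \<Sigma> closure_of ({\<tau>} \<times> P) \<longleftrightarrow>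
    (\<forall>G e. finite G \<longrightarrow> G \<subseteq> dual_monoid N \<sigma> \<longrightarrow> 0 < e \<longrightarrow>
       (\<exists>y\<in>P. hom_near G e (hom_of_point N \<sigma> (\<sigma>, x)) (hom_of_point N \<sigma> (\<tau>, y))))"
    (is "?l \<longleftrightarrow> ?r")
proof -
  let ?h = "hom_of_point N \<sigma>" and ?X = "trop_toric_topology N \<Sigma>"
  have "convex \<sigma>" using fan_cone_generators[OF fan \<sigma>] convex_convex_cone_hull by metis
  then have self: "(\<sigma>, x) \<in> chart_points N \<Sigma> \<sigma>" using \<sigma> x by (simp add: chart_points_def face_of_refl)
  have inchart: "(\<tau>, y) \<in> chart_points N \<Sigma> \<sigma>" if "y \<in> P" for y
    using that P \<tau> face by (auto simp: chart_points_def)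
  show ?thesis
  proof
    assume L: ?l
    show ?r
    proof (intro allI impI)
      fix G e assume G: "finite G" "G \<subseteq> dual_monoid N \<sigma>" and e: "0 < (e::real)"
      let ?U = "{q\<in>chart_points N \<Sigma> \<sigma>. hom_near G e (?h (\<sigma>, x)) (?h q)}"
      have "openin ?X ?U" by (rule chart_nhd_openin[OF \<sigma> G e])
      moreover have "(\<sigma>, x) \<in> ?U" using self e by (simp add: hom_near_def trop_near_refl)
      ultimately have "\<exists>q. q \<in> {\<tau>} \<times> P \<and> q \<in> ?U"
        using L unfolding in_closure_of by (elim conjE allE[of _ ?U]) simp
      then show "\<exists>y\<in>P. hom_near G e (?h (\<sigma>, x)) (?h (\<tau>, y))" by auto
    qed
  next
    assume R: ?r
    have top: "(\<sigma>, x) \<in> topspace ?X"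
      using openin_subset[OF chart_nhd_openin[OF \<sigma>, of "{}" 1 "?h (\<sigma>, x)"]] self by (auto simp: hom_near_def)
    have "\<exists>q\<in>{\<tau>} \<times> P. q \<in> U" if U: "(\<sigma>, x) \<in> U" "openin ?X U" for U
    proof -
      have "openin (chart_topology N \<Sigma> \<sigma>) (U \<inter> chart_points N \<Sigma> \<sigma>)"
        using U(2) \<sigma> unfolding openin_trop_toric_topology by blast
      then obtain H e where H: "finite H" "H \<subseteq> dual_monoid N \<sigma>" "0 < e"
         "\<And>q. q \<in> chart_points N \<Sigma> \<sigma> \<Longrightarrow> hom_near H e (?h (\<sigma>, x)) (?h q) \<Longrightarrow> q \<in> U"
        using U(1) self unfolding openin_chart_topology_iff by (metis IntD1 IntI)
      then obtain y where "y \<in> P" "hom_near H e (?h (\<sigma>, x)) (?h (\<tau>, y))" using R by blast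
      then show ?thesis using H(4) inchart by blast
    qed
    then show ?l unfolding in_closure_of using top by blast
  qed
qed

end

section \<open>The complex of cells\<close>

text \<open>Only inequalities that hold at \<open>w\<close> are imposed. When \<open>A\<close> is
  closed under negation of pairs, a hyperplane through \<open>w\<close> contributes both of its
  inequalities, and this is the closure of the relatively open arrangement cell containing
  \<open>w\<close>.\<close>

definition cell :: "('v::euclidean_space \<times> real) set \<Rightarrow> 'v set \<Rightarrow> 'v \<Rightarrow> 'v set" where
  "cell A T w = {x\<in>T. \<forall>(a, b)\<in>A. a \<bullet> w \<le> b \<longrightarrow> a \<bullet> x \<le> b}"

lemma cell_le: "x \<in> cell A T w \<Longrightarrow> (a, b) \<in> A \<Longrightarrow> a \<bullet> w \<le> b \<Longrightarrow> a \<bullet> x \<le> b"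
  by (auto simp: cell_def)

lemma cell_self: "w \<in> T \<Longrightarrow> w \<in> cell A T w"
  by (auto simp: cell_def)

lemma cell_subset: "cell A T w \<subseteq> T"
  by (auto simp: cell_def)

lemma cell_antimono: "z \<in> cell A T w \<Longrightarrow> cell A T z \<subseteq> cell A T w"
  unfolding cell_def by blast

lemma cell_eq_Int:
  "cell A T w = T \<inter> (\<Inter>(a, b)\<in>{(a, b)\<in>A. a \<bullet> w \<le> b}. {x. a \<bullet> x \<le> b})"
  by (auto simp: cell_def)

lemma polyhedron_cell:
  assumes "finite A" "polyhedron T" shows "polyhedron (cell A T w)"
proof -
  have "finite {(a, b)\<in>A. a \<bullet> w \<le> b}" using assms(1) by (rule rev_finite_subset) auto
  then show ?thesis unfolding cell_eq_Int
    using assms(2) by (intro polyhedron_Int polyhedron_Inter finite_imageI) (auto simp: polyhedron_halfspace_le)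
qed

lemma convex_midpoint:
  "convex P \<Longrightarrow> x \<in> P \<Longrightarrow> y \<in> P \<Longrightarrow> (1 / 2) *\<^sub>R (x + y) \<in> P"
  using convexD[of P x y "1 / 2" "1 / 2"] by (simp add: scaleR_add_right)

text \<open>Let \<open>z\<close> lie on the fewest hyperplanes. If \<open>x\<close> were beyond a
  hyperplane through \<open>z\<close>, their midpoint would leave that hyperplane. It would meet no
  new one, because \<open>X\<close> stays on one side of each, so that the midpoint lies on a
  hyperplane only if both ends do.\<close>

lemma exists_generic_point:
  assumes A: "finite A" and X: "X \<noteq> {}" "X \<subseteq> T"
    and mid: "\<And>x y. x \<in> X \<Longrightarrow> y \<in> X \<Longrightarrow> (1 / 2) *\<^sub>R (x + y) \<in> X"
    and side: "\<And>a b. (a, b) \<in> A \<Longrightarrow> (\<forall>x\<in>X. a \<bullet> x \<le> b) \<or> (\<forall>x\<in>X. b \<le> a \<bullet> x)"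
  shows "\<exists>z\<in>X. X \<subseteq> cell A T z"
proof -
  define tight where "tight z = {(a, b)\<in>A. a \<bullet> z = b}" for z
  have fin: "finite (tight z)" for z using A unfolding tight_def by (rule rev_finite_subset) auto
  obtain x0 where "x0 \<in> X" using X(1) by blast
  then obtain z where z: "z \<in> X" and least: "\<forall>y. y \<in> X \<longrightarrow> card (tight z) \<le> card (tight y)"
    using ex_has_least_nat[of "\<lambda>x. x \<in> X" x0 "\<lambda>x. card (tight x)"] by blast
  have "a \<bullet> x \<le> b" if x: "x \<in> X" and ab: "(a, b) \<in> A" "a \<bullet> z \<le> b" for x a b
  proof (rule ccontr)
    assume not: "\<not> a \<bullet> x \<le> b"
    then have "b \<le> a \<bullet> z" using side[OF ab(1)] x z by blast
    then have az: "a \<bullet> z = b" using ab by simp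
    define y where "y = (1 / 2) *\<^sub>R (z + x)"
    have y: "y \<in> X" unfolding y_def by (rule mid[OF z x])
    have inner_y: "c \<bullet> y = (c \<bullet> z + c \<bullet> x) / 2" for c by (simp add: y_def inner_add_right)
    have "tight y \<subseteq> tight z"
    proof (clarify)
      fix c d assume "(c, d) \<in> tight y"
      then have cd: "(c, d) \<in> A" "(c \<bullet> z + c \<bullet> x) / 2 = d" by (auto simp: tight_def inner_y)
      moreover have "(c \<bullet> z \<le> d \<and> c \<bullet> x \<le> d) \<or> (d \<le> c \<bullet> z \<and> d \<le> c \<bullet> x)"
        using side[OF cd(1)] x z by blast
      ultimately have "c \<bullet> z = d" by auto
      then show "(c, d) \<in> tight z" using cd by (simp add: tight_def)
    qed
    moreover have "(a, b) \<in> tight z" "(a, b) \<notin> tight y"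
      using ab az not by (auto simp: tight_def inner_y)
    ultimately have "tight y \<subset> tight z" by blast
    then have "card (tight y) < card (tight z)" by (rule psubset_card_mono[OF fin])
    then show False using least y by (meson not_le)
  qed
  then have "X \<subseteq> cell A T z" using X(2) by (auto simp: cell_def)
  then show ?thesis using z by blast
qed

lemma cell_ge:
  assumes sym: "\<And>a b. (a, b) \<in> A \<Longrightarrow> (- a, - b) \<in> A"
    and "x \<in> cell A T w" "(a, b) \<in> A" "b \<le> a \<bullet> w"
  shows "b \<le> a \<bullet> x"
  using cell_le[OF assms(2) sym[OF assms(3)]] assms(4) by simp

lemma cell_side:
  assumes sym: "\<And>a b. (a, b) \<in> A \<Longrightarrow> (- a, - b) \<in> A" and ab: "(a, b) \<in> A"
  shows "(\<forall>x\<in>cell A T w. a \<bullet> x \<le> b) \<or> (\<forall>x\<in>cell A T w. b \<le> a \<bullet> x)"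
  using cell_le[OF _ ab] cell_ge[OF sym _ ab] by (meson linear)

text \<open>An inequality that holds at \<open>z\<close> but fails at \<open>w\<close> is reversed
  on the whole cell of \<open>w\<close>. At a point of the cell of \<open>z\<close> inside a segment
  it is thus an equality, and then it is one at both ends.\<close>

lemma cell_face_of:
  assumes sym: "\<And>a b. (a, b) \<in> A \<Longrightarrow> (- a, - b) \<in> A" and conv: "convex (cell A T z)"
    and z: "z \<in> cell A T w"
  shows "cell A T z face_of cell A T w"
  unfolding face_of_def
proof (intro conjI ballI impI)
  show "cell A T z \<subseteq> cell A T w" by (rule cell_antimono[OF z])
  show "convex (cell A T z)" by (rule conv)
  fix x y p assume x: "x \<in> cell A T w" and y: "y \<in> cell A T w" and p: "p \<in> cell A T z" and seg: "p \<in> open_segment x y"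
  have "\<exists>t>0. t < 1 \<and> p = (1 - t) *\<^sub>R x + t *\<^sub>R y" using seg unfolding in_segment by (rule conjunct2)
  then obtain t where t: "0 < t" "t < 1" "p = (1 - t) *\<^sub>R x + t *\<^sub>R y" by (elim exE conjE)
  have "a \<bullet> x \<le> b \<and> a \<bullet> y \<le> b" if ab: "(a, b) \<in> A" "a \<bullet> z \<le> b" for a b
  proof (cases "a \<bullet> w \<le> b")
    case True
    then show ?thesis using cell_le[OF x ab(1)] cell_le[OF y ab(1)] by blast
  next
    case False
    then have xy: "b \<le> a \<bullet> x" "b \<le> a \<bullet> y" using cell_ge[OF sym x ab(1)] cell_ge[OF sym y ab(1)] by auto
    have "(1 - t) * (a \<bullet> x) + t * (a \<bullet> y) \<le> b"
      using cell_le[OF p ab] by (simp add: t(3) inner_add_right)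
    then have le: "(1 - t) * (a \<bullet> x - b) + t * (a \<bullet> y - b) \<le> 0" by (simp add: algebra_simps)
    have "0 \<le> (1 - t) * (a \<bullet> x - b)" "0 \<le> t * (a \<bullet> y - b)" using t xy by auto
    then have "(1 - t) * (a \<bullet> x - b) = 0" "t * (a \<bullet> y - b) = 0" using le by linarith+
    then show ?thesis using t by auto
  qed
  then show "x \<in> cell A T z" "y \<in> cell A T z"
    using x y by (auto simp: cell_def)
qed

text \<open>A generic point \<open>z\<close> of the face gives one inclusion. For the other, the
  segment from a point of the cell of \<open>z\<close> to \<open>z\<close> extends a little beyond
  \<open>z\<close> within that cell; the face contains the inner point \<open>z\<close>, hence both
  ends.\<close>

lemma face_of_cell:
  assumes A: "finite A" and sym: "\<And>a b. (a, b) \<in> A \<Longrightarrow> (- a, - b) \<in> A" and T: "subspace T"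
    and F: "F face_of cell A T w" "F \<noteq> {}"
  shows "\<exists>z\<in>F. F = cell A T z"
proof -
  have Fsub: "F \<subseteq> cell A T w" using F(1) by (rule face_of_imp_subset)
  have "\<exists>z\<in>F. F \<subseteq> cell A T z"
  proof (rule exists_generic_point[OF A F(2)])
    show "F \<subseteq> T" using Fsub cell_subset by blast
    show "(1 / 2) *\<^sub>R (x + y) \<in> F" if "x \<in> F" "y \<in> F" for x y
      using convex_midpoint[OF face_of_imp_convex[OF F(1)] that] .
    show "(\<forall>x\<in>F. a \<bullet> x \<le> b) \<or> (\<forall>x\<in>F. b \<le> a \<bullet> x)" if "(a, b) \<in> A" for a b
      using cell_side[OF sym that, of T w] Fsub by blast
  qed
  then obtain z where z: "z \<in> F" "F \<subseteq> cell A T z" by blast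
  have zw: "z \<in> cell A T w" using z Fsub by blast
  have zT: "z \<in> T" using zw cell_subset by blast
  have "x \<in> F" if x: "x \<in> cell A T z" for x
  proof (cases "x = z")
    case False
    have xT: "x \<in> T" using x cell_subset by blast
    have ev: "\<forall>\<^sub>F e in at_right (0::real). \<forall>(a, b)\<in>A. a \<bullet> z \<le> b \<longrightarrow> a \<bullet> z + e * (a \<bullet> z - a \<bullet> x) \<le> b"
    proof (rule eventually_ball_finite[OF A], clarify)
      fix a b assume ab: "(a, b) \<in> A"
      show "\<forall>\<^sub>F e in at_right (0::real). a \<bullet> z \<le> b \<longrightarrow> a \<bullet> z + e * (a \<bullet> z - a \<bullet> x) \<le> b"
      proof (cases "a \<bullet> z < b")
        case True
        have "((\<lambda>e. a \<bullet> z + e * (a \<bullet> z - a \<bullet> x)) \<longlongrightarrow> a \<bullet> z + 0 * (a \<bullet> z - a \<bullet> x)) (at_right 0)"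
          by (intro tendsto_intros)
        then have "\<forall>\<^sub>F e in at_right (0::real). a \<bullet> z + e * (a \<bullet> z - a \<bullet> x) < b"
          using True by (intro order_tendstoD(2)) auto
        then show ?thesis by (rule eventually_mono) auto
      next
        case False
        \<comment> \<open>At a tight inequality the reversed one holds at \<open>x\<close>, so
          moving away from \<open>x\<close> does not increase the form.\<close>
        have "a \<bullet> z + e * (a \<bullet> z - a \<bullet> x) \<le> b" if "0 < e" "a \<bullet> z \<le> b" for e
        proof -
          have "b \<le> a \<bullet> z" using False by simp
          then have "b \<le> a \<bullet> x" using cell_ge[OF sym x ab] by blast
          then have "a \<bullet> z - a \<bullet> x \<le> 0" using that(2) by simp
          then have "e * (a \<bullet> z - a \<bullet> x) \<le> 0" using that(1) by (simp add: mult_nonneg_nonpos)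
          then show ?thesis using that(2) by simp
        qed
        then show ?thesis using eventually_at_right_less[of "0::real"] by (auto elim!: eventually_mono)
      qed
    qed
    have "\<forall>\<^sub>F e in at_right (0::real). 0 < e \<and> (\<forall>(a, b)\<in>A. a \<bullet> z \<le> b \<longrightarrow> a \<bullet> z + e * (a \<bullet> z - a \<bullet> x) \<le> b)"
      using eventually_at_right_less[of "0::real"] ev by (rule eventually_conj)
    then obtain e where e: "0 < e" "\<forall>(a, b)\<in>A. a \<bullet> z \<le> b \<longrightarrow> a \<bullet> z + e * (a \<bullet> z - a \<bullet> x) \<le> b"
      using eventually_happens'[OF trivial_limit_at_right_real] by blast
    define y where "y = z + e *\<^sub>R (z - x)"
    have "y \<in> T" unfolding y_def using T zT xT by (simp add: subspace_add subspace_scale subspace_diff)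
    then have "y \<in> cell A T z"
      using e(2) by (auto simp: cell_def y_def inner_add_right inner_diff_right)
    then have xy: "x \<in> cell A T w" "y \<in> cell A T w" using x cell_antimono[OF zw] by auto
    have "z \<in> open_segment x y"
      unfolding in_segment
    proof (intro conjI exI)
      \<comment> \<open>The weight solves
        \<open>y + e *\<^sub>R x = (1 + e) *\<^sub>R z\<close>.\<close>
      show "0 < 1 / (1 + e)" "1 / (1 + e) < 1" using e(1) by auto
      have "(1 - s) *\<^sub>R x + s *\<^sub>R y = (1 - s * (1 + e)) *\<^sub>R x + (s * (1 + e)) *\<^sub>R z" for s
        by (simp add: y_def algebra_simps)
      from this[of "1 / (1 + e)"] show "z = (1 - 1 / (1 + e)) *\<^sub>R x + (1 / (1 + e)) *\<^sub>R y"
        using e(1) by simp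
      have "e *\<^sub>R (z - x) + (z - x) \<noteq> 0" 
      proof
        assume "e *\<^sub>R (z - x) + (z - x) = 0"
        then have "(e + 1) *\<^sub>R (z - x) = 0" by (simp add: scaleR_add_left)
        then show False using e(1) False by simp
      qed
      then show "x \<noteq> y" by (auto simp: y_def algebra_simps)
    qed
    then show ?thesis using F(1) z(1) xy unfolding face_of_def by blast
  qed (use z in simp)
  then show ?thesis using z by blast
qed

text \<open>A nonempty intersection of two cells is the cell of a generic point in it, hence a face
  of both. Nonempty faces are cells of points of \<open>V\<close>, as \<open>V\<close> contains the
  cells of its points.\<close>

lemma polyhedral_complex_cells:
  assumes A: "finite A" and sym: "\<And>a b. (a, b) \<in> A \<Longrightarrow> (- a, - b) \<in> A" and T: "subspace T"
    and V: "V \<subseteq> T" "\<And>w. w \<in> V \<Longrightarrow> cell A T w \<subseteq> V"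
  shows "polyhedral_complex (insert {} (cell A T ` V))"
proof -
  have poly: "polyhedron (cell A T w)" for w
    using A T by (simp add: polyhedron_cell affine_imp_polyhedron subspace_imp_affine)
  have conv: "convex (cell A T w)" for w using poly polyhedron_imp_convex by blast
  have meet: "(cell A T w \<inter> cell A T w') face_of cell A T w" if "w \<in> V" "w' \<in> V" for w w'
  proof (cases "cell A T w \<inter> cell A T w' = {}")
    case False
    let ?X = "cell A T w \<inter> cell A T w'"
    have "\<exists>z\<in>?X. ?X \<subseteq> cell A T z"
    proof (rule exists_generic_point[OF A False])
      show "?X \<subseteq> T" using cell_subset by blast
      show "(1 / 2) *\<^sub>R (x + y) \<in> ?X" if "x \<in> ?X" "y \<in> ?X" for x y
        by (rule convex_midpoint[OF convex_Int[OF conv conv] that])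
      show "(\<forall>x\<in>?X. a \<bullet> x \<le> b) \<or> (\<forall>x\<in>?X. b \<le> a \<bullet> x)" if "(a, b) \<in> A" for a b
        using cell_side[OF sym that, of T w] by blast
    qed
    then obtain z where z: "z \<in> ?X" "?X \<subseteq> cell A T z" by blast
    then have "?X = cell A T z" using cell_antimono[of z A T w] cell_antimono[of z A T w'] by blast
    moreover have "cell A T z face_of cell A T w"
      by (rule cell_face_of[OF sym conv]) (use z in auto)
    ultimately show ?thesis by simp
  qed (simp add: empty_face_of)
  show ?thesis
    unfolding polyhedral_complex_def
  proof (intro conjI ballI allI impI)
    show "polyhedron P" if "P \<in> insert {} (cell A T ` V)" for P using that poly by auto
    show "F \<in> insert {} (cell A T ` V)"
      if P: "P \<in> insert {} (cell A T ` V)" and F: "F face_of P \<and> F \<noteq> {}" for P F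
    proof -
      have "P \<noteq> {}" using F face_of_imp_subset by blast
      then obtain w where w: "w \<in> V" "P = cell A T w" using P by blast
      obtain z where z: "z \<in> F" "F = cell A T z"
        using face_of_cell[OF A sym T, of F w] F w by auto
      have "z \<in> V" using z(1) F w V(2)[OF w(1)] face_of_imp_subset by blast
      then show ?thesis using z by blast
    qed
    fix P P' assume P: "P \<in> insert {} (cell A T ` V)" "P' \<in> insert {} (cell A T ` V)"
    show "(P \<inter> P') face_of P" using P meet by (auto simp: empty_face_of)
    show "(P \<inter> P') face_of P'" using P meet by (auto simp: empty_face_of Int_commute)
  qed
qed

section \<open>Walls between the terms of a polynomial\<close>

lemma initial_support_singleton_iff:
  "initial_support f w = {u} \<longleftrightarrow> u \<in> keys f \<and> (\<forall>e\<in>keys f. e \<noteq> u \<longrightarrow> term_value f w u < term_value f w e)"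
proof
  assume "initial_support f w = {u}"
  from leading_of_singleton[OF this, of "\<lambda>_ _. False"]
  show "u \<in> keys f \<and> (\<forall>e\<in>keys f. e \<noteq> u \<longrightarrow> term_value f w u < term_value f w e)"
    by (auto simp: leading_def)
next
  assume R: "u \<in> keys f \<and> (\<forall>e\<in>keys f. e \<noteq> u \<longrightarrow> term_value f w u < term_value f w e)"
  show "initial_support f w = {u}"
    unfolding initial_support_def
  proof (intro antisym subsetI)
    fix x assume x: "x \<in> {u \<in> keys f. \<forall>u'\<in>keys f. term_value f w u \<le> term_value f w u'}"
    then have "x \<in> keys f" "term_value f w x \<le> term_value f w u" using R by auto
    then show "x \<in> {u}" using R by (metis not_le singletonI)
  next
    fix x assume "x \<in> {u}"
    then show "x \<in> {u \<in> keys f. \<forall>u'\<in>keys f. term_value f w u \<le> term_value f w u'}"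
      using R by (auto intro: less_imp_le)
  qed
qed

fun trop_real :: "trop \<Rightarrow> real" where
  "trop_real (Fin a) = a"
| "trop_real Infty = 0"

lemma Fin_trop_real: "u \<in> keys f \<Longrightarrow> lookup f u = Fin (trop_real (lookup f u))"
  by (cases "lookup f u") (auto simp: in_keys_trop)

lemma term_value_less_iff:
  assumes "u \<in> keys f" "e \<in> keys f"
  shows "term_value f w u < term_value f w e \<longleftrightarrow>
    trop_real (lookup f u) + u \<bullet> w < trop_real (lookup f e) + e \<bullet> w"
  unfolding term_value_def using Fin_trop_real[OF assms(1)] Fin_trop_real[OF assms(2)]
  by (metis times_trop.simps(1) trop_less_iff(1))

text \<open>Read as a linear inequality, the pair states that the value of the term \<open>u\<close>
  is at most that of the term \<open>u'\<close>.\<close>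

definition wall :: "('v::euclidean_space \<Rightarrow>\<^sub>0 trop) \<Rightarrow> 'v \<Rightarrow> 'v \<Rightarrow> 'v \<times> real" where
  "wall f u u' = (u - u', trop_real (lookup f u') - trop_real (lookup f u))"

definition walls :: "('v::euclidean_space \<Rightarrow>\<^sub>0 trop) set \<Rightarrow> ('v \<times> real) set" where
  "walls F = (\<Union>f\<in>F. \<Union>u\<in>keys f. \<Union>u'\<in>keys f. {wall f u u'})"

lemma finite_walls: "finite F \<Longrightarrow> finite (walls F)"
  by (simp add: walls_def)

lemma walls_symmetric: "(a, b) \<in> walls F \<Longrightarrow> (- a, - b) \<in> walls F"
proof -
  assume "(a, b) \<in> walls F"
  then obtain f u u' where "f \<in> F" "u \<in> keys f" "u' \<in> keys f" "(a, b) = wall f u u'"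
    unfolding walls_def by blast
  then have "wall f u' u \<in> walls F" "wall f u' u = (- a, - b)"
    unfolding walls_def by (blast, simp add: wall_def)
  then show ?thesis by simp
qed

lemma subspace_stratum: "subspace (stratum N \<sigma>)"
  unfolding subspace_def stratum_def
  by (auto simp: span_0 span_add span_scale inner_add_left)

section \<open>The complex supported on the variety\<close>

context cox_ideal
begin

definition basis where
  "basis \<sigma> = (SOME F. finite F \<and> tropical_basis (stratum_ideal N \<Sigma> v I \<sigma>) F)"

lemma basis:
  assumes "\<sigma> \<in> \<Sigma>"
  shows "finite (basis \<sigma>)" "tropical_basis (stratum_ideal N \<Sigma> v I \<sigma>) (basis \<sigma>)"
  using someI_ex[OF stratum_ideal_finite_basis[OF assms]] by (simp_all only: basis_def)

lemma basis_subset: "\<sigma> \<in> \<Sigma> \<Longrightarrow> basis \<sigma> \<subseteq> stratum_ideal N \<Sigma> v I \<sigma> - {0}"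
  using basis(2) by (simp add: tropical_basis_def)

text \<open>
  Including the walls of all larger cones makes each cell of \<open>N(\<tau>)\<close> project into a single cell
  of \<open>N(\<sigma>)\<close> whenever \<open>\<tau>\<close> is a face of \<open>\<sigma>\<close>.
\<close>

definition arrangement where
  "arrangement \<tau> = (\<Union>\<sigma>\<in>{\<sigma>\<in>\<Sigma>. \<tau> face_of \<sigma>}. walls (basis \<sigma>))"

lemma finite_arrangement: "finite (arrangement \<tau>)"
proof -
  have "finite \<Sigma>" using fan by (simp add: fan_def)
  then show ?thesis unfolding arrangement_def using basis(1) by (auto intro!: finite_walls)
qed

lemma arrangement_symmetric: "(a, b) \<in> arrangement \<tau> \<Longrightarrow> (- a, - b) \<in> arrangement \<tau>"
  unfolding arrangement_def using walls_symmetric by blast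

text \<open>The exponents lie in the perpendicular lattice of a cone having \<open>\<tau>\<close> as
  a face, hence in that of \<open>\<tau>\<close>. All walls are thus given by rational forms on the
  stratum of \<open>\<tau>\<close>.\<close>

lemma arrangement_perp:
  assumes "(a, b) \<in> arrangement \<tau>" shows "a \<in> perp_lattice N \<tau>"
proof -
  obtain \<sigma> f u u' where h: "\<sigma> \<in> \<Sigma>" "\<tau> face_of \<sigma>" "f \<in> basis \<sigma>" "u \<in> keys f" "u' \<in> keys f" "a = u - u'"
    using assms by (auto simp: arrangement_def walls_def wall_def)
  have "keys f \<subseteq> perp_lattice N \<sigma>" using h basis_subset by (auto simp: stratum_ideal_def poly_over_def)
  then have "keys f \<subseteq> perp_lattice N \<tau>" using perp_lattice_antimono[OF face_of_imp_subset[OF h(2)]] by blast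
  then show ?thesis using h additive_subgroup_perp_lattice[of N \<tau>]
    unfolding additive_subgroup_def by (metis diff_conv_add_uminus subsetD)
qed

lemma arrangement_face: "\<tau> face_of \<sigma> \<Longrightarrow> arrangement \<sigma> \<subseteq> arrangement \<tau>"
  unfolding arrangement_def using face_of_trans by blast

lemma cone_face_self: "\<sigma> \<in> \<Sigma> \<Longrightarrow> \<sigma> face_of \<sigma>"
proof -
  assume "\<sigma> \<in> \<Sigma>"
  then obtain S where "\<sigma> = convex_cone hull S" by (rule fan_cone_generators[OF fan])
  then show ?thesis by (simp add: face_of_refl convex_convex_cone_hull)
qed

abbreviation "variety \<equiv> stratum_variety N \<Sigma> v I"
abbreviation "face_cell \<sigma> \<equiv> cell (arrangement \<sigma>) (stratum N \<sigma>)"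

lemma variety_subset: "variety \<sigma> \<subseteq> stratum N \<sigma>"
  by (auto simp: stratum_variety_def)

text \<open>Outside the variety some basis element has a unique minimum, which amounts to the
  failure of certain wall inequalities. Points of the cell satisfy all wall inequalities that hold
  at \<open>w\<close>, so the same ones fail at \<open>w\<close>.\<close>

lemma cell_subset_variety:
  assumes \<sigma>: "\<sigma> \<in> \<Sigma>" and w: "w \<in> variety \<sigma>"
  shows "face_cell \<sigma> w \<subseteq> variety \<sigma>"
proof
  fix x assume x: "x \<in> face_cell \<sigma> w"
  have xs: "x \<in> stratum N \<sigma>" using x cell_subset by blast
  show "x \<in> variety \<sigma>"
  proof (rule ccontr)
    assume "x \<notin> variety \<sigma>"
    then obtain f' where "f' \<in> stratum_ideal N \<Sigma> v I \<sigma>" "f' \<noteq> 0" "\<not> min_attained_twice f' x"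
      using xs by (auto simp: stratum_variety_def)
    then obtain f where f: "f \<in> basis \<sigma>" "\<not> min_attained_twice f x" using basis(2)[OF \<sigma>] unfolding tropical_basis_def by blast
    have f0: "f \<noteq> 0" "f \<in> stratum_ideal N \<Sigma> v I \<sigma>" using f(1) basis_subset[OF \<sigma>] by auto
    obtain u where u: "initial_support f x = {u}" using f(2) not_min_attained_twice_iff[OF f0(1)] by blast
    then have uf: "u \<in> keys f" and lt: "\<And>e. e \<in> keys f \<Longrightarrow> e \<noteq> u \<Longrightarrow> term_value f x u < term_value f x e"
      by (auto simp: initial_support_singleton_iff)
    have "term_value f w u < term_value f w e" if e: "e \<in> keys f" "e \<noteq> u" for e
    proof -
      have "wall f e u \<in> arrangement \<sigma>"
        unfolding arrangement_def walls_def using f(1) e uf \<sigma> cone_face_self[OF \<sigma>] by blast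
      then have "(e - u, trop_real (lookup f u) - trop_real (lookup f e)) \<in> arrangement \<sigma>" by (simp add: wall_def)
      moreover have "\<not> (e - u) \<bullet> x \<le> trop_real (lookup f u) - trop_real (lookup f e)"
        using lt[OF e] by (simp add: term_value_less_iff[OF uf e(1)] inner_diff_left)
      ultimately have "\<not> (e - u) \<bullet> w \<le> trop_real (lookup f u) - trop_real (lookup f e)"
        using cell_le[OF x] by blast
      then show ?thesis by (simp add: term_value_less_iff[OF uf e(1)] inner_diff_left)
    qed
    then have "initial_support f w = {u}" using uf by (simp add: initial_support_singleton_iff)
    then have "\<not> min_attained_twice f w" using not_min_attained_twice_iff[OF f0(1)] by blast
    then show False using w f0 by (simp add: stratum_variety_def)
  qed
qed

text \<open>A polynomial with a unique minimum at \<open>x\<close> lifts to the local ideal of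
  \<open>\<sigma>\<close>, which is part of that of \<open>\<tau>\<close>. Truncated to the stratum
  of \<open>\<tau>\<close>, the lift may have additional terms, but near \<open>x\<close> their
  values are large, so the minimum stays unique.\<close>

lemma closure_subset_variety:
  assumes \<sigma>: "\<sigma> \<in> \<Sigma>" and \<tau>: "\<tau> \<in> \<Sigma>" and face: "\<tau> face_of \<sigma>" and P: "P \<subseteq> variety \<tau>"
    and x: "x \<in> stratum N \<sigma>" and cl: "(\<sigma>, x) \<in> trop_toric_topology N \<Sigma> closure_of ({\<tau>} \<times> P)"
  shows "x \<in> variety \<sigma>"
proof (rule ccontr)
  assume "x \<notin> variety \<sigma>"
  then obtain f where f: "f \<in> stratum_ideal N \<Sigma> v I \<sigma>" "f \<noteq> 0" "\<not> min_attained_twice f x"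
    using x by (auto simp: stratum_variety_def)
  obtain u where u: "initial_support f x = {u}" using f(3) not_min_attained_twice_iff[OF f(2)] by blast
  obtain F where F: "F \<in> local_ideal \<sigma>" "f = filter_terms (\<lambda>u. u \<in> perp_lattice N \<sigma>) F"
    using f(1) unfolding stratum_ideal_eq[OF \<sigma>] by blast
  define F' where "F' = filter_terms (\<lambda>u. u \<in> perp_lattice N \<tau>) F"
  have F': "F' \<in> stratum_ideal N \<Sigma> v I \<tau>"
    unfolding stratum_ideal_eq[OF \<tau>] F'_def using F(1) local_ideal_face[OF face] by blast
  have perp: "perp_lattice N \<sigma> \<subseteq> perp_lattice N \<tau>" by (rule perp_lattice_antimono[OF face_of_imp_subset[OF face]])
  have keysF: "keys F \<subseteq> dual_monoid N \<sigma>" using F(1) by (auto simp: local_ideal_def poly_over_def)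
  have kf: "e \<in> keys f \<longleftrightarrow> e \<in> keys F \<and> e \<in> perp_lattice N \<sigma>" for e by (simp add: F(2) keys_filter_terms)
  have kF': "e \<in> keys F' \<longleftrightarrow> e \<in> keys F \<and> e \<in> perp_lattice N \<tau>" for e by (simp add: F'_def keys_filter_terms)
  have lf: "lookup f e = lookup F e" if "e \<in> keys f" for e using that kf by (simp add: F(2) lookup_filter_terms)
  have lF': "lookup F' e = lookup F e" if "e \<in> keys F'" for e using that kF' by (simp add: F'_def lookup_filter_terms)
  define c where "c e = trop_real (lookup F e)" for e
  have uf: "u \<in> keys f" and lt: "\<And>e. e \<in> keys f \<Longrightarrow> e \<noteq> u \<Longrightarrow> c u + u \<bullet> x < c e + e \<bullet> x"
    using u term_value_less_iff[of u f _ x] lf by (auto simp: initial_support_singleton_iff c_def)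
  let ?h = "hom_of_point N \<sigma>"
  have uF': "u \<in> keys F'" using uf kf kF' perp by blast
  have hx: "?h (\<sigma>, x) e = (if e \<in> perp_lattice N \<sigma> then Fin (e \<bullet> x) else Infty)"
    and hy: "?h (\<tau>, y) e = (if e \<in> perp_lattice N \<tau> then Fin (e \<bullet> y) else Infty)" if "e \<in> keys F" for e y
    using that keysF by (auto simp: hom_of_point_apply)
  have "\<exists>d>0. \<forall>\<epsilon> y. 0 < \<epsilon> \<longrightarrow> \<epsilon> \<le> d \<longrightarrow> \<bar>u \<bullet> y - u \<bullet> x\<bar> < \<epsilon> \<longrightarrow> trop_near \<epsilon> (?h (\<sigma>, x) e) (?h (\<tau>, y) e) \<longrightarrow>
      c u + u \<bullet> y < c e + e \<bullet> y" if e: "e \<in> keys F'" "e \<noteq> u" for e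
  proof (cases "e \<in> perp_lattice N \<sigma>")
    case True
    then have ef: "e \<in> keys f" using e kf kF' by blast
    \<comment> \<open>Half of the gap at \<open>x\<close>, as both values may move by less than
      \<open>\<epsilon>\<close>.\<close>
    define d where "d = ((c e + e \<bullet> x) - (c u + u \<bullet> x)) / 2"
    have d: "d > 0" using lt[OF ef e(2)] by (simp add: d_def)
    have "c u + u \<bullet> y < c e + e \<bullet> y"
      if "\<epsilon> \<le> d" "\<bar>u \<bullet> y - u \<bullet> x\<bar> < \<epsilon>" "trop_near \<epsilon> (?h (\<sigma>, x) e) (?h (\<tau>, y) e)" for \<epsilon> y
    proof -
      have "\<bar>e \<bullet> y - e \<bullet> x\<bar> < \<epsilon>" using that(3) True e kF' perp by (auto simp: hx hy)
      then have "e \<bullet> x - \<epsilon> < e \<bullet> y" "u \<bullet> y < u \<bullet> x + \<epsilon>" using that(2) by (auto simp: abs_less_iff)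
      moreover have "\<epsilon> + \<epsilon> \<le> (c e + e \<bullet> x) - (c u + u \<bullet> x)" using that(1) by (simp add: d_def)
      ultimately show ?thesis by linarith
    qed
    then show ?thesis using d by blast
  next
    case False
    \<comment> \<open>A pairing of \<open>e\<close> above \<open>K\<close> puts the term
      \<open>e\<close> above \<open>u\<close>; the added one covers the variation of
      \<open>u \<bullet> y\<close>, which is below \<open>1 / K \<le> 1\<close>.\<close>
    define K where "K = \<bar>c u + u \<bullet> x - c e\<bar> + 1"
    have K: "K \<ge> 1" by (simp add: K_def)
    have "c u + u \<bullet> y < c e + e \<bullet> y"
      if "0 < \<epsilon>" "\<epsilon> \<le> 1 / K" "\<bar>u \<bullet> y - u \<bullet> x\<bar> < \<epsilon>" "trop_near \<epsilon> (?h (\<sigma>, x) e) (?h (\<tau>, y) e)" for \<epsilon> y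
    proof -
      have "1 / \<epsilon> < e \<bullet> y" using that(4) False e kF' by (auto simp: hx hy)
      moreover have "K \<le> 1 / \<epsilon>" using that(1,2) K by (simp add: field_simps)
      moreover have "1 / K \<le> 1" using K by simp
      ultimately show ?thesis using that(2,3) unfolding K_def by linarith
    qed
    then show ?thesis using K by (intro exI[of _ "1 / K"]) auto
  qed
  then obtain d where d: "\<And>e. e \<in> keys F' \<Longrightarrow> e \<noteq> u \<Longrightarrow> d e > 0"
    "\<And>e \<epsilon> y. e \<in> keys F' \<Longrightarrow> e \<noteq> u \<Longrightarrow> 0 < \<epsilon> \<Longrightarrow> \<epsilon> \<le> d e \<Longrightarrow> \<bar>u \<bullet> y - u \<bullet> x\<bar> < \<epsilon> \<Longrightarrow>
       trop_near \<epsilon> (?h (\<sigma>, x) e) (?h (\<tau>, y) e) \<Longrightarrow> c u + u \<bullet> y < c e + e \<bullet> y"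
    by metis
  define \<epsilon> where "\<epsilon> = Min (insert 1 (d ` (keys F' - {u})))"
  have \<epsilon>: "\<epsilon> > 0" using d(1) by (simp add: \<epsilon>_def)
  have \<epsilon>le: "\<epsilon> \<le> d e" if "e \<in> keys F'" "e \<noteq> u" for e using that by (simp add: \<epsilon>_def)
  have Ps: "P \<subseteq> stratum N \<tau>" using P variety_subset by blast
  have "\<exists>y\<in>P. hom_near (keys F) \<epsilon> (?h (\<sigma>, x)) (?h (\<tau>, y))"
    using cl keysF \<epsilon> unfolding stratum_closure_iff[OF \<sigma> \<tau> face Ps x] by simp
  then obtain y where y: "y \<in> P" "hom_near (keys F) \<epsilon> (?h (\<sigma>, x)) (?h (\<tau>, y))" by blast
  have near: "trop_near \<epsilon> (?h (\<sigma>, x) e) (?h (\<tau>, y) e)" if "e \<in> keys F" for e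
    using y(2) that by (simp add: hom_near_def)
  have uF: "u \<in> keys F" "u \<in> perp_lattice N \<sigma>" "u \<in> perp_lattice N \<tau>" using uf kf perp by auto
  have uy: "\<bar>u \<bullet> y - u \<bullet> x\<bar> < \<epsilon>" using near[OF uF(1)] uF by (simp add: hx hy)
  have "term_value F' y u < term_value F' y e" if e: "e \<in> keys F'" "e \<noteq> u" for e
  proof -
    have "c u + u \<bullet> y < c e + e \<bullet> y"
      by (rule d(2)[OF e \<epsilon> \<epsilon>le[OF e] uy near]) (use e kF' in blast)
    then show ?thesis by (simp add: term_value_less_iff[OF uF' e(1)] lF'[OF uF'] lF'[OF e(1)] c_def)
  qed
  then have "initial_support F' y = {u}" using uF' by (simp add: initial_support_singleton_iff)
  moreover have "F' \<noteq> 0" using uF' by auto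
  ultimately have "\<not> min_attained_twice F' y" using not_min_attained_twice_iff by blast
  then show False using P y(1) F' \<open>F' \<noteq> 0\<close> by (auto simp: stratum_variety_def)
qed

lemma closure_in_cell:
  assumes \<sigma>: "\<sigma> \<in> \<Sigma>" and \<tau>: "\<tau> \<in> \<Sigma>" and face: "\<tau> face_of \<sigma>" and w: "w \<in> variety \<tau>"
    and X: "X = {x\<in>stratum N \<sigma>. (\<sigma>, x) \<in> trop_toric_topology N \<Sigma> closure_of ({\<tau>} \<times> face_cell \<tau> w)}" "X \<noteq> {}"
  shows "\<exists>z\<in>variety \<sigma>. X \<subseteq> face_cell \<sigma> z"
proof -
  let ?P = "face_cell \<tau> w" and ?h = "hom_of_point N \<sigma>"
  have PV: "?P \<subseteq> variety \<tau>" by (rule cell_subset_variety[OF \<tau> w])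
  have Ps: "?P \<subseteq> stratum N \<tau>" by (rule cell_subset)
  have conv: "convex ?P"
    by (intro polyhedron_imp_convex polyhedron_cell finite_arrangement affine_imp_polyhedron
        subspace_imp_affine subspace_stratum)
  have Xs: "X \<subseteq> stratum N \<sigma>" using X(1) by blast
  have approx: "\<exists>y\<in>?P. hom_near G e (?h (\<sigma>, x)) (?h (\<tau>, y))"
    if "x \<in> X" "finite G" "G \<subseteq> dual_monoid N \<sigma>" "0 < e" for x G e
    using that stratum_closure_iff[OF \<sigma> \<tau> face Ps, of x] unfolding X(1) by simp
  have XV: "X \<subseteq> variety \<sigma>"
    using closure_subset_variety[OF \<sigma> \<tau> face PV] unfolding X(1) by blast
  have perp: "perp_lattice N \<sigma> \<subseteq> perp_lattice N \<tau>" by (rule perp_lattice_antimono[OF face_of_imp_subset[OF face]])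
  have avg: "\<bar>(p + q) / 2 - (r + s) / 2\<bar> < e" if "\<bar>p - r\<bar> < e" "\<bar>q - s\<bar> < e" for p q r s e :: real
    using that by (auto simp: abs_less_iff field_simps)
  have "\<exists>z\<in>X. X \<subseteq> face_cell \<sigma> z"
  proof (rule exists_generic_point[OF finite_arrangement X(2) Xs])
    fix x x' assume x: "x \<in> X" and x': "x' \<in> X"
    define z where "z = (1 / 2) *\<^sub>R (x + x')"
    have zs: "z \<in> stratum N \<sigma>"
      unfolding z_def using x x' Xs subspace_stratum[of N \<sigma>] by (auto intro!: subspace_scale subspace_add)
    have "\<exists>y\<in>?P. hom_near G e (?h (\<sigma>, z)) (?h (\<tau>, y))"
      if G: "finite G" "G \<subseteq> dual_monoid N \<sigma>" "0 < e" for G e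
    proof -
      obtain y where y: "y \<in> ?P" "hom_near G e (?h (\<sigma>, x)) (?h (\<tau>, y))" using approx[OF x G] by blast
      obtain y' where y': "y' \<in> ?P" "hom_near G e (?h (\<sigma>, x')) (?h (\<tau>, y'))" using approx[OF x' G] by blast
      \<comment> \<open>Whether \<open>u\<close> is finite on the stratum of \<open>\<tau>\<close>
        does not depend on the point. Errors of finite values average, and values beyond
        \<open>1 / e\<close> average to a value beyond it.\<close>
      have "trop_near e (?h (\<sigma>, z) u) (?h (\<tau>, (1 / 2) *\<^sub>R (y + y')) u)" if u: "u \<in> G" for u
      proof -
        have um: "u \<in> dual_monoid N \<sigma>" using u G by blast
        have 1: "trop_near e (?h (\<sigma>, x) u) (?h (\<tau>, y) u)" and 2: "trop_near e (?h (\<sigma>, x') u) (?h (\<tau>, y') u)"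
          using y(2) y'(2) u by (auto simp: hom_near_def)
        show ?thesis
        proof (cases "u \<in> perp_lattice N \<sigma>")
          case True
          then have "u \<in> perp_lattice N \<tau>" using perp by blast
          then show ?thesis using 1 2 True
            by (simp add: hom_of_point_apply[OF um] z_def inner_add_right avg)
        next
          case False
          then show ?thesis using 1 2
            by (auto simp: hom_of_point_apply[OF um] inner_add_right)
        qed
      qed
      then have "hom_near G e (?h (\<sigma>, z)) (?h (\<tau>, (1 / 2) *\<^sub>R (y + y')))" by (simp add: hom_near_def)
      then show ?thesis using convex_midpoint[OF conv y(1) y'(1)] by blast
    qed
    then have "(\<sigma>, z) \<in> trop_toric_topology N \<Sigma> closure_of ({\<tau>} \<times> ?P)"
      unfolding stratum_closure_iff[OF \<sigma> \<tau> face Ps zs] by simp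
    then show "(1 / 2) *\<^sub>R (x + x') \<in> X" using zs unfolding X(1) z_def by blast
  next
    fix a b assume ab: "(a, b) \<in> arrangement \<sigma>"
    have a: "a \<in> perp_lattice N \<sigma>" by (rule arrangement_perp[OF ab])
    then have am: "a \<in> dual_monoid N \<sigma>" and a\<tau>: "a \<in> perp_lattice N \<tau>"
      using perp perp_lattice_subset_dual_monoid by auto
    \<comment> \<open>A wall form is finite on both strata, so closeness in the chart is closeness
      of its real values, and the side taken by the cell passes to the limit.\<close>
    have near: "\<exists>y\<in>?P. \<bar>a \<bullet> y - a \<bullet> x\<bar> < e" if "x \<in> X" "0 < e" for x e
      using approx[OF that(1), of "{a}" e] that(2) am a a\<tau> by (simp add: hom_near_def hom_of_point_apply)
    have ab\<tau>: "(a, b) \<in> arrangement \<tau>" using ab arrangement_face[OF face] by blast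
    consider "\<forall>y\<in>?P. a \<bullet> y \<le> b" | "\<forall>y\<in>?P. b \<le> a \<bullet> y"
      using cell_side[OF arrangement_symmetric ab\<tau>] by blast
    then show "(\<forall>x\<in>X. a \<bullet> x \<le> b) \<or> (\<forall>x\<in>X. b \<le> a \<bullet> x)"
    proof cases
      case 1
      have "a \<bullet> x \<le> b" if "x \<in> X" for x
      proof (rule ccontr)
        assume "\<not> a \<bullet> x \<le> b"
        then obtain y where "y \<in> ?P" "\<bar>a \<bullet> y - a \<bullet> x\<bar> < a \<bullet> x - b" using near[OF \<open>x \<in> X\<close>, of "a \<bullet> x - b"] by auto
        then show False using 1 by force
      qed
      then show ?thesis by blast
    next
      case 2
      have "b \<le> a \<bullet> x" if "x \<in> X" for x
      proof (rule ccontr)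
        assume "\<not> b \<le> a \<bullet> x"
        then obtain y where "y \<in> ?P" "\<bar>a \<bullet> y - a \<bullet> x\<bar> < b - a \<bullet> x" using near[OF \<open>x \<in> X\<close>, of "b - a \<bullet> x"] by auto
        then show False using 2 by force
      qed
      then show ?thesis by blast
    qed
  qed
  then show ?thesis using XV by blast
qed

lemma real_rational_cell:
  "real_rational_polyhedron N \<sigma> (face_cell \<sigma> w)"
  unfolding real_rational_polyhedron_def
proof (intro exI conjI)
  let ?C = "{(a, b)\<in>arrangement \<sigma>. a \<bullet> w \<le> b}"
  show "finite ?C" using finite_arrangement[of \<sigma>] by (rule rev_finite_subset) auto
  have "perp_lattice N \<sigma> \<subseteq> rational_forms N \<sigma>"
    using Ints_subset_Rats by (auto simp: perp_lattice_def dual_lattice_def rational_forms_def)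
  then show "?C \<subseteq> rational_forms N \<sigma> \<times> UNIV" using arrangement_perp by blast
  show "face_cell \<sigma> w = {x \<in> stratum N \<sigma>. \<forall>(a, b)\<in>?C. a \<bullet> x \<le> b}" by (auto simp: cell_def)
qed

lemma real_rational_empty: "real_rational_polyhedron N \<sigma> {}"
  unfolding real_rational_polyhedron_def
  \<comment> \<open>The zero form with bound \<open>-1\<close> gives an inequality without
    solutions.\<close>
  by (rule exI[of _ "{(0, -1)}"]) (auto simp: rational_forms_def span_0)

text \<open>A cell depends only on the set of inequalities that hold at its point, a subset of the
  finite arrangement.\<close>

lemma finite_cells: "finite (face_cell \<sigma> ` V)"
proof -
  have "face_cell \<sigma> ` V \<subseteq> (\<lambda>C. {x\<in>stratum N \<sigma>. \<forall>(a, b)\<in>C. a \<bullet> x \<le> b}) ` Pow (arrangement \<sigma>)"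
  proof
    fix P assume "P \<in> face_cell \<sigma> ` V"
    then obtain w where "P = face_cell \<sigma> w" by blast
    then have "P = {x\<in>stratum N \<sigma>. \<forall>(a, b)\<in>{(a, b)\<in>arrangement \<sigma>. a \<bullet> w \<le> b}. a \<bullet> x \<le> b}"
      by (auto simp: cell_def)
    then show "P \<in> (\<lambda>C. {x\<in>stratum N \<sigma>. \<forall>(a, b)\<in>C. a \<bullet> x \<le> b}) ` Pow (arrangement \<sigma>)"
      by (rule image_eqI) auto
  qed
  then show ?thesis using finite_arrangement by (meson finite_Pow_iff finite_imageI finite_subset)
qed

definition variety_complex where
  "variety_complex \<sigma> = insert {} (face_cell \<sigma> ` variety \<sigma>)"

lemma trop_polyhedral_complex_variety: "trop_polyhedral_complex N \<Sigma> variety_complex"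
  unfolding trop_polyhedral_complex_def
proof (intro conjI ballI impI)
  fix \<sigma> assume \<sigma>: "\<sigma> \<in> \<Sigma>"
  show "polyhedral_complex (variety_complex \<sigma>)"
    unfolding variety_complex_def
    by (rule polyhedral_complex_cells[OF finite_arrangement arrangement_symmetric subspace_stratum
          variety_subset cell_subset_variety[OF \<sigma>]])
  show "P \<subseteq> stratum N \<sigma>" if "P \<in> variety_complex \<sigma>" for P
    using that cell_subset by (auto simp: variety_complex_def)
  fix \<tau> P assume \<tau>: "\<tau> \<in> \<Sigma>" "\<tau> face_of \<sigma>" and P: "P \<in> variety_complex \<tau>"
  let ?cl = "trop_toric_topology N \<Sigma> closure_of ({\<tau>} \<times> P)"
  let ?X = "{x\<in>stratum N \<sigma>. (\<sigma>, x) \<in> ?cl}"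
  have "\<exists>P'\<in>variety_complex \<sigma>. ?X \<subseteq> P'"
  proof (cases "?X = {}")
    case True
    \<comment> \<open>The empty member of the complex covers this case, even if the variety has no
      point in the stratum of \<open>\<sigma>\<close>.\<close>
    then show ?thesis by (auto simp: variety_complex_def)
  next
    case False
    then have "P \<noteq> {}" by auto
    then obtain w where w: "w \<in> variety \<tau>" "P = face_cell \<tau> w" using P by (auto simp: variety_complex_def)
    obtain z where "z \<in> variety \<sigma>" "?X \<subseteq> face_cell \<sigma> z"
      using closure_in_cell[OF \<sigma> \<tau> w(1) _ False] w(2) by blast
    then show ?thesis by (auto simp: variety_complex_def)
  qed
  then show "\<exists>P'\<in>variety_complex \<sigma>. ?cl \<inter> ({\<sigma>} \<times> stratum N \<sigma>) \<subseteq> {\<sigma>} \<times> P'"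
    by (auto simp: subset_iff)
qed

lemma variety_complex_support: "\<sigma> \<in> \<Sigma> \<Longrightarrow> \<Union>(variety_complex \<sigma>) = variety \<sigma>"
proof (intro antisym subsetI)
  fix x assume "\<sigma> \<in> \<Sigma>" "x \<in> \<Union>(variety_complex \<sigma>)"
  then show "x \<in> variety \<sigma>" using cell_subset_variety by (auto simp: variety_complex_def)
next
  fix x assume "x \<in> variety \<sigma>"
  then show "x \<in> \<Union>(variety_complex \<sigma>)"
    using cell_self[of x "stratum N \<sigma>" "arrangement \<sigma>"] variety_subset by (auto simp: variety_complex_def)
qed

end

theorem theorem5p11:
  fixes N :: "'v::euclidean_space set"
    and \<Sigma> :: "'v set set"
    and v :: "nat \<Rightarrow> 'v"
    and I :: "laurent set"
  assumes "is_lattice N"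
    and "fan N \<Sigma>"
    and "cox_matrix N \<Sigma> v"
    and "locally_tropical N \<Sigma> v I"
  shows "\<exists>\<Delta>. trop_polyhedral_complex N \<Sigma> \<Delta> \<and> finite_complex \<Sigma> \<Delta>
           \<and> real_rational_complex N \<Sigma> \<Delta>
           \<and> trop_variety N \<Sigma> v I = complex_support \<Sigma> \<Delta>"
proof -
  interpret cox_ideal N \<Sigma> v I
    using assms by unfold_locales
  have "finite_complex \<Sigma> variety_complex"
    by (simp add: finite_complex_def variety_complex_def finite_cells)
  moreover have "real_rational_complex N \<Sigma> variety_complex"
    using real_rational_cell real_rational_empty by (auto simp: real_rational_complex_def variety_complex_def)
  moreover have "trop_variety N \<Sigma> v I = complex_support \<Sigma> variety_complex"
    unfolding trop_variety_def complex_support_def using variety_complex_support by (intro Sigma_cong) auto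
  ultimately show ?thesis using trop_polyhedral_complex_variety by blast
qed

end
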